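(* Let $(E,\mathcal{P})$ be a random locally convex module over $\mathbb{R}$ with base $(\Omega,\mathcal{F},P)$ and $f:E\to\bar L^0(\mathcal{F})$ a local function. Then $f^{\ast\ast}_{\varepsilon,\lambda}=Cl_{\varepsilon,\lambda}(f)$.
   Context: $(\Omega,\mathcal{F},P)$ is a probability space. $L^0(\mathcal{F})$ (resp. $\bar L^0(\mathcal{F})$) is the set of equivalence classes (a.s. equality) of real (resp. extended real)-valued $\mathcal{F}$-measurable random variables, with the a.s. order; $\bar L^0(\mathcal{F})$ is a complete lattice, with suprema $\bigvee$ and infima $\bigwedge$. $L^0_+(\mathcal{F})=\{\xi\in L^0(\mathcal{F}):\xi\ge0\}$; $\tilde I_A$ is the class of the indicator of $A\in\mathcal{F}$. "$\xi<\eta$ on $A$" means $\xi(\omega)<\eta(\omega)$ for $P$-almost all $\omega\in A$. Conventions: $0\cdot(\pm\infty)=0$, $+\infty\pm(\pm\infty)=+\infty$. Random locally convex module (RLC module) over $\mathbb{R}$ with base $(\Omega,\mathcal{F},P)$: a pair $(E,\mathcal{P})$ with $E$ an $L^0(\mathcal{F})$-module and $\mathcal{P}$ a family of $L^0$-seminorms on $E$ (maps $\|\cdot\|:E\to L^0_+(\mathcal{F})$ with $\|\xi x\|=|\xi|\|x\|$ for $\xi\in L^0(\mathcal{F})$ and $\|x+y\|\le\|x\|+\|y\|$) such that $\bigvee\{\|x\|:\|\cdot\|\in\mathcal{P}\}=0$ iff $x=\theta$ (null element). $\mathcal{P}_f$ is the family of (nonempty) finite subsets of $\mathcal{P}$,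 and $\|x\|_{\mathcal{Q}}=\bigvee\{\|x\|:\|\cdot\|\in\mathcal{Q}\}$. The $(\varepsilon,\lambda)$-topology $\mathcal{T}_{\varepsilon,\lambda}$ on $E$ is the linear topology with local base at $\theta$: $\{x: P(\|x\|_{\mathcal{Q}}<\varepsilon)>1-\lambda\}$, $\mathcal{Q}\in\mathcal{P}_f$, real $\varepsilon>0$, $0<\lambda<1$; on $L^0(\mathcal{F})$, $\mathcal{T}_{\varepsilon,\lambda}$ (from $|\cdot|$) is the topology of convergence in probability. $E^\ast_{\varepsilon,\lambda}$ is the set of continuous module homomorphisms from $(E,\mathcal{T}_{\varepsilon,\lambda})$ to $(L^0(\mathcal{F}),\mathcal{T}_{\varepsilon,\lambda})$. For $f:E\to\bar L^0(\mathcal{F})$: $f$ is local if $\tilde I_Af(x)=\tilde I_Af(\tilde I_Ax)$ for all $x\in E$, $A\in\mathcal{F}$; proper if $f(x)>-\infty$ on $\Omega$ for all $x\in E$ and there is $x\in E$ with $f(x)<+\infty$ on $\Omega$; $L^0$-convex if $f(\xi x+(1-\xi)y)\le\xi f(x)+(1-\xi)f(y)$ for all $x,y\in E$, $\xi\in L^0_+(\mathcal{F})$, $0\le\xi\le1$. A proper $L^0$-convex $f$ is $\mathcal{T}_{\varepsilon,\lambda}$-lower semicontinuous if $epi(f)=\{(x,r)\in E\times L^0(\mathcal{F}):f(x)\le r\}$ is closed in $(E,\mathcal{T}_{\varepsilon,\lambda})\times(L^0(\mathcal{F}),\mathcal{T}_{\varepsilon,\lambda})$. For a local $f$: $MI(f)$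 is the essential supremum of $\{A\in\mathcal{F}:\text{there is }x\in E\text{ with }\tilde I_Af(x)=\tilde I_A(-\infty)\}$, $PI(f)$ the essential supremum of $\{A\in\mathcal{F}:\tilde I_Af(x)=\tilde I_A(+\infty)\text{ for all }x\in E\}$ (they may be chosen disjoint), and $BP(f)=\Omega\setminus(MI(f)\cup PI(f))$. For $D\in\mathcal{F}$ with $P(D)>0$, $E^D=\tilde I_DE$ with the restricted seminorms $\mathcal{P}^D=\{\|\cdot\||_{E^D}:\|\cdot\|\in\mathcal{P}\}$ is an RLC module over $\mathbb{R}$ with base $(D,D\cap\mathcal{F},P(\cdot|D))$, and $f_D:E^D\to\tilde I_D\bar L^0(\mathcal{F})$ (identified with $\bar L^0(D\cap\mathcal{F})$) is $f_D(\tilde I_Dx)=\tilde I_Df(\tilde I_Dx)$. A local $f$ is $\mathcal{T}_{\varepsilon,\lambda}$-closed if $\tilde I_{MI(f)}f=\tilde I_{MI(f)}(-\infty)$ and if $f_A$ is $L^0(A\cap\mathcal{F})$-convex and $\mathcal{T}_{\varepsilon,\lambda}$-lower semicontinuous for each $A\in\mathcal{F}$ with $A\subset BP(f)$, $P(A)>0$ such that $f_A$ is proper. $Cl_{\varepsilon,\lambda}(f)$ is the greatest $\mathcal{T}_{\varepsilon,\lambda}$-closed function majorized by $f$ (pointwise suprema of $\mathcal{T}_{\varepsilon,\lambda}$-closed functions are $\mathcal{T}_{\varepsilon,\lambda}$-closed, so it exists). $f^\ast_{\varepsilon,\lambda}(g)=\bigvee\{g(x)-f(x):x\in E\}$ for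 $g\in E^\ast_{\varepsilon,\lambda}$, and $f^{\ast\ast}_{\varepsilon,\lambda}(x)=\bigvee\{g(x)-f^\ast_{\varepsilon,\lambda}(g):g\in E^\ast_{\varepsilon,\lambda}\}$ for $x\in E$. *)

theory Defs
  imports "HOL-Probability.Probability" "HOL-Algebra.Module" "HOL-Algebra.Lattice"
begin

section \<open>Equivalence classes of random variables\<close>

text \<open>An element of \<open>L\<^sup>0\<close> is the set of all measurable functions that are almost surely equal to a
  given one. For a measure whose space is a proper subset of the type, the values outside the
  space are thereby ignored. \<open>rep\<close> picks a version of a class; all notions below are
  independent of this choice.\<close>

definition L0_class :: "'a measure \<Rightarrow> ('a \<Rightarrow> 'b::topological_space) \<Rightarrow> ('a \<Rightarrow> 'b) set" where
  "L0_class M u = {v \<in> borel_measurable M. AE \<omega> in M. v \<omega> = u \<omega>}"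

definition rep :: "('a \<Rightarrow> 'b) set \<Rightarrow> 'a \<Rightarrow> 'b" where
  "rep X = (SOME u. u \<in> X)"

text \<open>Scalars: \<open>L\<^sup>0(\<F>)\<close> as a commutative ring, and at the same time as a module over itself.\<close>

definition L0 :: "'a measure \<Rightarrow> (('a \<Rightarrow> real) set, ('a \<Rightarrow> real) set) module" where
  "L0 M =
    \<lparr>carrier = L0_class M ` borel_measurable M,
     mult = (\<lambda>X Y. L0_class M (\<lambda>\<omega>. rep X \<omega> * rep Y \<omega>)),
     one = L0_class M (\<lambda>_. 1),
     zero = L0_class M (\<lambda>_. 0),
     add = (\<lambda>X Y. L0_class M (\<lambda>\<omega>. rep X \<omega> + rep Y \<omega>)),
     smult = (\<lambda>X Y. L0_class M (\<lambda>\<omega>. rep X \<omega> * rep Y \<omega>))\<rparr>"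

definition L0_abs :: "'a measure \<Rightarrow> ('a \<Rightarrow> real) set \<Rightarrow> ('a \<Rightarrow> real) set" where
  "L0_abs M X = L0_class M (\<lambda>\<omega>. \<bar>rep X \<omega>\<bar>)"

definition L0_le :: "'a measure \<Rightarrow> ('a \<Rightarrow> 'b::{topological_space, order}) set \<Rightarrow> ('a \<Rightarrow> 'b) set \<Rightarrow> bool" where
  "L0_le M X Y \<longleftrightarrow> (AE \<omega> in M. rep X \<omega> \<le> rep Y \<omega>)"

definition L0_pos :: "'a measure \<Rightarrow> ('a \<Rightarrow> real) set set" where
  "L0_pos M = {X \<in> carrier (L0 M). L0_le M \<zero>\<^bsub>L0 M\<^esub> X}"

definition L0_ind :: "'a measure \<Rightarrow> 'a set \<Rightarrow> ('a \<Rightarrow> real) set" where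
  "L0_ind M A = L0_class M (indicator A)"

text \<open>Extended real valued classes. Suprema are taken in this order with the library operator
  \<open>\<Squnion>\<close>; in particular the supremum of the empty family is the class of \<open>- \<infinity>\<close>.\<close>

definition L0bar :: "'a measure \<Rightarrow> ('a \<Rightarrow> ereal) set gorder" where
  "L0bar M = \<lparr>carrier = L0_class M ` borel_measurable M, eq = (=), le = L0_le M\<rparr>"

definition L0_ereal :: "'a measure \<Rightarrow> ('a \<Rightarrow> real) set \<Rightarrow> ('a \<Rightarrow> ereal) set" where
  "L0_ereal M X = L0_class M (\<lambda>\<omega>. ereal (rep X \<omega>))"

text \<open>The library arithmetic of \<^typ>\<open>ereal\<close> agrees with the conventions \<open>0 \<cdot> (\<plusminus>\<infinity>) = 0\<close> and
  \<open>\<infinity> \<plusminus> (\<plusminus>\<infinity>) = \<infinity>\<close>.\<close>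

definition L0bar_add :: "'a measure \<Rightarrow> ('a \<Rightarrow> ereal) set \<Rightarrow> ('a \<Rightarrow> ereal) set \<Rightarrow> ('a \<Rightarrow> ereal) set" where
  "L0bar_add M X Y = L0_class M (\<lambda>\<omega>. rep X \<omega> + rep Y \<omega>)"

definition L0bar_diff :: "'a measure \<Rightarrow> ('a \<Rightarrow> ereal) set \<Rightarrow> ('a \<Rightarrow> ereal) set \<Rightarrow> ('a \<Rightarrow> ereal) set" where
  "L0bar_diff M X Y = L0_class M (\<lambda>\<omega>. rep X \<omega> - rep Y \<omega>)"

definition L0bar_scale :: "'a measure \<Rightarrow> ('a \<Rightarrow> real) set \<Rightarrow> ('a \<Rightarrow> ereal) set \<Rightarrow> ('a \<Rightarrow> ereal) set" where
  "L0bar_scale M X Y = L0_class M (\<lambda>\<omega>. ereal (rep X \<omega>) * rep Y \<omega>)"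


section \<open>Random locally convex modules\<close>

definition L0_seminorm ::
    "'a measure \<Rightarrow> (('a \<Rightarrow> real) set, 'e) module \<Rightarrow> ('e \<Rightarrow> ('a \<Rightarrow> real) set) \<Rightarrow> bool" where
  "L0_seminorm M E n \<longleftrightarrow>
     n \<in> carrier E \<rightarrow> L0_pos M \<and>
     (\<forall>\<xi>\<in>carrier (L0 M). \<forall>x\<in>carrier E. n (\<xi> \<odot>\<^bsub>E\<^esub> x) = L0_abs M \<xi> \<otimes>\<^bsub>L0 M\<^esub> n x) \<and>
     (\<forall>x\<in>carrier E. \<forall>y\<in>carrier E. L0_le M (n (x \<oplus>\<^bsub>E\<^esub> y)) (n x \<oplus>\<^bsub>L0 M\<^esub> n y))"

definition seminorm_sup ::
    "'a measure \<Rightarrow> ('e \<Rightarrow> ('a \<Rightarrow> real) set) set \<Rightarrow> 'e \<Rightarrow> ('a \<Rightarrow> ereal) set" where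
  "seminorm_sup M Q x = \<Squnion>\<^bsub>L0bar M\<^esub> {L0_ereal M (n x) |n. n \<in> Q}"

definition rlc_module ::
    "'a measure \<Rightarrow> (('a \<Rightarrow> real) set, 'e) module \<Rightarrow> ('e \<Rightarrow> ('a \<Rightarrow> real) set) set \<Rightarrow> bool" where
  "rlc_module M E P \<longleftrightarrow>
     prob_space M \<and> module (L0 M) E \<and> (\<forall>n\<in>P. L0_seminorm M E n) \<and>
     (\<forall>x\<in>carrier E. seminorm_sup M P x = L0_ereal M \<zero>\<^bsub>L0 M\<^esub> \<longleftrightarrow> x = \<zero>\<^bsub>E\<^esub>)"

definition eps_lambda_nbhd ::
    "'a measure \<Rightarrow> (('a \<Rightarrow> real) set, 'e) module \<Rightarrow> ('e \<Rightarrow> ('a \<Rightarrow> real) set) set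
      \<Rightarrow> real \<Rightarrow> real \<Rightarrow> 'e set" where
  "eps_lambda_nbhd M E Q \<epsilon> \<delta> =
     {x \<in> carrier E. measure M {\<omega> \<in> space M. rep (seminorm_sup M Q x) \<omega> < ereal \<epsilon>} > 1 - \<delta>}"

definition eps_lambda_open ::
    "'a measure \<Rightarrow> (('a \<Rightarrow> real) set, 'e) module \<Rightarrow> ('e \<Rightarrow> ('a \<Rightarrow> real) set) set \<Rightarrow> 'e set \<Rightarrow> bool" where
  "eps_lambda_open M E P U \<longleftrightarrow>
     U \<subseteq> carrier E \<and>
     (\<forall>x\<in>U. \<exists>Q \<epsilon> \<delta>. finite Q \<and> Q \<noteq> {} \<and> Q \<subseteq> P \<and> 0 < \<epsilon> \<and> 0 < \<delta> \<and> \<delta> < 1 \<and>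
        (\<lambda>y. x \<oplus>\<^bsub>E\<^esub> y) ` eps_lambda_nbhd M E Q \<epsilon> \<delta> \<subseteq> U)"

definition eps_lambda_topology ::
    "'a measure \<Rightarrow> (('a \<Rightarrow> real) set, 'e) module \<Rightarrow> ('e \<Rightarrow> ('a \<Rightarrow> real) set) set \<Rightarrow> 'e topology" where
  "eps_lambda_topology M E P = topology (eps_lambda_open M E P)"

abbreviation L0_topology :: "'a measure \<Rightarrow> ('a \<Rightarrow> real) set topology" where
  "L0_topology M \<equiv> eps_lambda_topology M (L0 M) {L0_abs M}"

definition random_dual ::
    "'a measure \<Rightarrow> (('a \<Rightarrow> real) set, 'e) module \<Rightarrow> ('e \<Rightarrow> ('a \<Rightarrow> real) set) set
      \<Rightarrow> ('e \<Rightarrow> ('a \<Rightarrow> real) set) set" where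
  "random_dual M E P =
     {g \<in> carrier E \<rightarrow>\<^sub>E carrier (L0 M).
        (\<forall>x\<in>carrier E. \<forall>y\<in>carrier E. g (x \<oplus>\<^bsub>E\<^esub> y) = g x \<oplus>\<^bsub>L0 M\<^esub> g y) \<and>
        (\<forall>\<xi>\<in>carrier (L0 M). \<forall>x\<in>carrier E. g (\<xi> \<odot>\<^bsub>E\<^esub> x) = \<xi> \<otimes>\<^bsub>L0 M\<^esub> g x) \<and>
        continuous_map (eps_lambda_topology M E P) (L0_topology M) g}"


subsection \<open>The open sets form a topology\<close>

lemma rep_L0_class:
  assumes "u \<in> borel_measurable M"
  shows "rep (L0_class M u) \<in> borel_measurable M" "AE w in M. rep (L0_class M u) w = u w"
proof -
  have "u \<in> L0_class M u" using assms by (simp add: L0_class_def)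
  hence "rep (L0_class M u) \<in> L0_class M u" unfolding rep_def by (metis someI_ex)
  thus "rep (L0_class M u) \<in> borel_measurable M" "AE w in M. rep (L0_class M u) w = u w"
    by (auto simp: L0_class_def)
qed

lemma L0_class_cong:
  assumes "AE w in M. u w = v w"
  shows "L0_class M u = L0_class M v"
  unfolding L0_class_def using assms by (auto elim: eventually_elim2)

lemma L0_class_eq_iff:
  assumes "u \<in> borel_measurable M" "v \<in> borel_measurable M"
  shows "L0_class M u = L0_class M v \<longleftrightarrow> (AE w in M. u w = v w)"
proof
  assume "L0_class M u = L0_class M v"
  then have "u \<in> L0_class M v" using assms by (auto simp: L0_class_def)
  then show "AE w in M. u w = v w" by (auto simp: L0_class_def)
qed (rule L0_class_cong)

lemma L0_class_rep:
  assumes "X \<in> L0_class M ` borel_measurable M"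
  shows "rep X \<in> borel_measurable M" "L0_class M (rep X) = X"
proof -
  from assms obtain u where u: "u \<in> borel_measurable M" "X = L0_class M u" by auto
  show "rep X \<in> borel_measurable M" using rep_L0_class[OF u(1)] u by simp
  show "L0_class M (rep X) = X" using rep_L0_class(2)[OF u(1)] u by (auto intro!: L0_class_cong)
qed

lemma L0bar_partial: "partial_order (L0bar M)"
proof (unfold_locales; (simp add: L0bar_def)?)
  fix X Y Z assume X: "X \<in> L0_class M ` (borel_measurable M :: ('a \<Rightarrow> ereal) set)"
   and Y: "Y \<in> L0_class M ` (borel_measurable M :: ('a \<Rightarrow> ereal) set)"
  show "L0_le M X X" by (simp add: L0_le_def)
  show "L0_le M X Y \<Longrightarrow> L0_le M Y X \<Longrightarrow> X = Y"
  proof -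
    assume "L0_le M X Y" "L0_le M Y X"
    then have "AE w in M. rep X w = rep Y w" unfolding L0_le_def by eventually_elim simp
    then have "L0_class M (rep X) = L0_class M (rep Y)" by (rule L0_class_cong)
    then show "X = Y" using L0_class_rep(2)[OF X] L0_class_rep(2)[OF Y] by simp
  qed
  assume "L0_le M X Y" "L0_le M Y Z"
  then show "L0_le M X Z" unfolding L0_le_def by eventually_elim simp
qed

lemma L0bar_sup_countable:
  assumes A: "A \<subseteq> carrier (L0bar M)" "countable A"
  shows "least (L0bar M) (L0_class M (\<lambda>w. SUP X\<in>A. rep X w)) (Upper (L0bar M) A)"
proof -
  have [measurable]: "rep X \<in> borel_measurable M" if "X \<in> A" for X
    using L0_class_rep(1)[of X M] A that by (auto simp: L0bar_def)
  have m: "(\<lambda>w. SUP X\<in>A. rep X w) \<in> borel_measurable M"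
    using A(2) by (rule borel_measurable_SUP) simp
  note r = rep_L0_class[OF m]
  have le: "L0_le M X (L0_class M (\<lambda>w. SUP X\<in>A. rep X w))" if "X \<in> A" for X
    unfolding L0_le_def using r(2) by eventually_elim (use that in \<open>auto intro: SUP_upper\<close>)
  have ub: "L0_le M (L0_class M (\<lambda>w. SUP X\<in>A. rep X w)) U" if "\<forall>X\<in>A. L0_le M X U" for U
  proof -
    have "AE w in M. \<forall>X\<in>A. rep X w \<le> rep U w"
      using that A(2) by (simp add: AE_ball_countable L0_le_def)
    with r(2) show ?thesis unfolding L0_le_def
      by eventually_elim (auto intro: SUP_least)
  qed
  show ?thesis unfolding least_def Upper_def using le m A
    by (auto simp: L0bar_def intro!: ub)
qed

lemma seminorm_sup_finite:
  assumes Q: "finite Q" "\<And>n. n \<in> Q \<Longrightarrow> n x \<in> carrier (L0 M)"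
  shows "seminorm_sup M Q x \<in> carrier (L0bar M)"
    "AE w in M. rep (seminorm_sup M Q x) w = (SUP n\<in>Q. ereal (rep (n x) w))"
proof -
  let ?A = "{L0_ereal M (n x) |n. n \<in> Q}"
  have [measurable]: "rep (n x) \<in> borel_measurable M" if "n \<in> Q" for n
    using L0_class_rep(1)[of "n x" M] Q(2)[OF that] by (simp add: L0_def)
  have A: "?A \<subseteq> carrier (L0bar M)" "countable ?A"
    using Q(1) by (auto simp: L0bar_def L0_ereal_def intro: countable_finite)
  interpret partial_order "L0bar M" by (rule L0bar_partial)
  let ?s = "L0_class M (\<lambda>w. SUP X\<in>?A. rep X w)"
  have l: "least (L0bar M) ?s (Upper (L0bar M) ?A)" by (rule L0bar_sup_countable[OF A])
  have eq: "seminorm_sup M Q x = ?s"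
    unfolding seminorm_sup_def Lattice.sup_def
    using someI[of "\<lambda>s. least (L0bar M) s (Upper (L0bar M) ?A)", OF l] l
    by (rule least_unique)
  show "seminorm_sup M Q x \<in> carrier (L0bar M)" using l eq unfolding least_def Upper_def by auto
  have mm: "(\<lambda>w. SUP X\<in>?A. rep X w) \<in> borel_measurable M"
    using A by (intro borel_measurable_SUP) (auto simp: L0_ereal_def intro!: rep_L0_class(1))
  have "AE w in M. \<forall>n\<in>Q. rep (L0_ereal M (n x)) w = ereal (rep (n x) w)"
    using Q(1) by (intro AE_finite_allI) (auto simp: L0_ereal_def intro!: rep_L0_class(2))
  with rep_L0_class(2)[OF mm]
  show "AE w in M. rep (seminorm_sup M Q x) w = (SUP n\<in>Q. ereal (rep (n x) w))"
    unfolding eq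
  proof eventually_elim
    case (elim w)
    have "{L0_ereal M (n x) |n. n \<in> Q} = (\<lambda>n. L0_ereal M (n x)) ` Q" by auto
    then have "(SUP X\<in>{L0_ereal M (n x) |n. n \<in> Q}. rep X w) = (SUP n\<in>Q. rep (L0_ereal M (n x)) w)"
      by (simp only: image_image)
    also have "\<dots> = (SUP n\<in>Q. ereal (rep (n x) w))"
      using elim(2) by (intro SUP_cong) auto
    finally show ?case using elim(1) by simp
  qed
qed

lemma eps_lambda_nbhd_mono:
  assumes "rlc_module M E P" "finite R" "R \<subseteq> P" "Q \<subseteq> R" "e' \<le> e" "d' \<le> d"
  shows "eps_lambda_nbhd M E R e' d' \<subseteq> eps_lambda_nbhd M E Q e d"
proof
  fix x assume x: "x \<in> eps_lambda_nbhd M E R e' d'"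
  interpret prob_space M using assms by (simp add: rlc_module_def)
  have xE: "x \<in> carrier E" using x by (simp add: eps_lambda_nbhd_def)
  have c: "n x \<in> carrier (L0 M)" if "n \<in> P" for n
    using assms(1) that xE by (auto simp: rlc_module_def L0_seminorm_def L0_pos_def)
  have fQ: "finite Q" using assms finite_subset by auto
  note s = seminorm_sup_finite[OF assms(2), of x M] seminorm_sup_finite[OF fQ, of x M]
  have sR: "seminorm_sup M R x \<in> carrier (L0bar M)" "seminorm_sup M Q x \<in> carrier (L0bar M)"
    using s c assms by blast+
  have [measurable]: "rep (seminorm_sup M Q x) \<in> borel_measurable M" "rep (seminorm_sup M R x) \<in> borel_measurable M"
    using sR by (auto simp: L0bar_def intro!: L0_class_rep)
  have "AE w in M. rep (seminorm_sup M R x) w = (SUP n\<in>R. ereal (rep (n x) w))"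
   "AE w in M. rep (seminorm_sup M Q x) w = (SUP n\<in>Q. ereal (rep (n x) w))"
    using s c assms by blast+
  then have "AE w in M. rep (seminorm_sup M Q x) w \<le> rep (seminorm_sup M R x) w"
    by eventually_elim (simp add: SUP_subset_mono[OF assms(4)])
  then have "AE w in M. w \<in> {w \<in> space M. rep (seminorm_sup M R x) w < ereal e'} \<longrightarrow>
     w \<in> {w \<in> space M. rep (seminorm_sup M Q x) w < ereal e}"
  proof eventually_elim
    case (elim w)
    have "rep (seminorm_sup M Q x) w < ereal e" if "rep (seminorm_sup M R x) w < ereal e'"
      using le_less_trans[OF elim that] assms(5)
      by (meson ereal_less_eq(3) less_le_trans)
    then show ?case by simp
  qed
  then have "measure M {w \<in> space M. rep (seminorm_sup M R x) w < ereal e'}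
     \<le> measure M {w \<in> space M. rep (seminorm_sup M Q x) w < ereal e}"
    by (intro finite_measure_mono_AE) auto
  then show "x \<in> eps_lambda_nbhd M E Q e d" using x assms(6) unfolding eps_lambda_nbhd_def by auto
qed

lemma istopology_eps_lambda:
  assumes "rlc_module M E P"
  shows "istopology (eps_lambda_open M E P)"
proof -
  define B where "B Q e d x U \<longleftrightarrow> finite Q \<and> Q \<noteq> {} \<and> Q \<subseteq> P \<and> 0 < e \<and> 0 < d \<and> d < 1 \<and>
        (\<lambda>y. x \<oplus>\<^bsub>E\<^esub> y) ` eps_lambda_nbhd M E Q e d \<subseteq> U" for Q e d x U
  have op: "eps_lambda_open M E P U \<longleftrightarrow> U \<subseteq> carrier E \<and> (\<forall>x\<in>U. \<exists>Q e d. B Q e d x U)" for U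
    unfolding eps_lambda_open_def B_def ..
  have up: "B Q e d x V" if "B Q e d x U" "U \<subseteq> V" for Q e d x U V
    using that(1) subset_trans[OF _ that(2)] unfolding B_def by simp
  have int: "B (Q \<union> Q') (min e e') (min d d') x (S \<inter> T)" if "B Q e d x S" "B Q' e' d' x T"
    for Q Q' e e' d d' x S T
  proof -
    have "Q \<union> Q' \<subseteq> P" "finite (Q \<union> Q')" using that by (simp_all add: B_def)
    then have "eps_lambda_nbhd M E (Q \<union> Q') (min e e') (min d d') \<subseteq> eps_lambda_nbhd M E Q e d"
      "eps_lambda_nbhd M E (Q \<union> Q') (min e e') (min d d') \<subseteq> eps_lambda_nbhd M E Q' e' d'"
      using eps_lambda_nbhd_mono[OF assms, of "Q \<union> Q'" Q "min e e'" e "min d d'" d]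
        eps_lambda_nbhd_mono[OF assms, of "Q \<union> Q'" Q' "min e e'" e' "min d d'" d'] by simp_all
    from this[THEN image_mono, of "\<lambda>y. x \<oplus>\<^bsub>E\<^esub> y"] that show ?thesis
      unfolding B_def by (simp add: min_less_iff_disj) (meson subset_trans)
  qed
  show ?thesis
    unfolding istopology_def
  proof (intro conjI allI impI)
    fix S T assume S: "eps_lambda_open M E P S" and T: "eps_lambda_open M E P T"
    have "\<exists>Q e d. B Q e d x (S \<inter> T)" if "x \<in> S" "x \<in> T" for x
      using S T that int unfolding op by meson
    moreover have "S \<inter> T \<subseteq> carrier E" using S by (simp add: op le_infI1)
    ultimately show "eps_lambda_open M E P (S \<inter> T)" by (simp add: op)
  next
    fix K assume K: "\<forall>S\<in>K. eps_lambda_open M E P S"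
    have "\<exists>Q e d. B Q e d x (\<Union> K)" if "x \<in> S" "S \<in> K" for x S
      using K that up[OF _ Union_upper[OF that(2)]] unfolding op by meson
    moreover have "\<Union> K \<subseteq> carrier E" using K by (simp add: op Sup_least)
    ultimately show "eps_lambda_open M E P (\<Union> K)" unfolding op by (simp add: Ball_def) metis
  qed
qed

lemma openin_eps_lambda:
  assumes "rlc_module M E P"
  shows "openin (eps_lambda_topology M E P) = eps_lambda_open M E P"
  unfolding eps_lambda_topology_def using istopology_eps_lambda[OF assms] by (rule topology_inverse')


section \<open>Functions with values in extended real random variables\<close>

definition local_fun ::
    "'a measure \<Rightarrow> (('a \<Rightarrow> real) set, 'e) module \<Rightarrow> ('e \<Rightarrow> ('a \<Rightarrow> ereal) set) \<Rightarrow> bool" where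
  "local_fun M E f \<longleftrightarrow>
     (\<forall>x\<in>carrier E. \<forall>A\<in>sets M.
        L0bar_scale M (L0_ind M A) (f x) = L0bar_scale M (L0_ind M A) (f (L0_ind M A \<odot>\<^bsub>E\<^esub> x)))"

definition proper_fun ::
    "'a measure \<Rightarrow> (('a \<Rightarrow> real) set, 'e) module \<Rightarrow> ('e \<Rightarrow> ('a \<Rightarrow> ereal) set) \<Rightarrow> bool" where
  "proper_fun M E f \<longleftrightarrow>
     (\<forall>x\<in>carrier E. AE \<omega> in M. rep (f x) \<omega> > - \<infinity>) \<and>
     (\<exists>x\<in>carrier E. AE \<omega> in M. rep (f x) \<omega> < \<infinity>)"

definition L0_convex ::
    "'a measure \<Rightarrow> (('a \<Rightarrow> real) set, 'e) module \<Rightarrow> ('e \<Rightarrow> ('a \<Rightarrow> ereal) set) \<Rightarrow> bool" where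
  "L0_convex M E f \<longleftrightarrow>
     (\<forall>x\<in>carrier E. \<forall>y\<in>carrier E. \<forall>\<xi>\<in>L0_pos M. L0_le M \<xi> \<one>\<^bsub>L0 M\<^esub> \<longrightarrow>
        L0_le M (f (\<xi> \<odot>\<^bsub>E\<^esub> x \<oplus>\<^bsub>E\<^esub> (\<one>\<^bsub>L0 M\<^esub> \<ominus>\<^bsub>L0 M\<^esub> \<xi>) \<odot>\<^bsub>E\<^esub> y))
          (L0bar_add M (L0bar_scale M \<xi> (f x)) (L0bar_scale M (\<one>\<^bsub>L0 M\<^esub> \<ominus>\<^bsub>L0 M\<^esub> \<xi>) (f y))))"

definition epi ::
    "'a measure \<Rightarrow> (('a \<Rightarrow> real) set, 'e) module \<Rightarrow> ('e \<Rightarrow> ('a \<Rightarrow> ereal) set)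
      \<Rightarrow> ('e \<times> ('a \<Rightarrow> real) set) set" where
  "epi M E f = {(x, r). x \<in> carrier E \<and> r \<in> carrier (L0 M) \<and> L0_le M (f x) (L0_ereal M r)}"

definition eps_lambda_lsc ::
    "'a measure \<Rightarrow> (('a \<Rightarrow> real) set, 'e) module \<Rightarrow> ('e \<Rightarrow> ('a \<Rightarrow> real) set) set
      \<Rightarrow> ('e \<Rightarrow> ('a \<Rightarrow> ereal) set) \<Rightarrow> bool" where
  "eps_lambda_lsc M E P f \<longleftrightarrow>
     closedin (prod_topology (eps_lambda_topology M E P) (L0_topology M)) (epi M E f)"


section \<open>Restriction to an event of positive probability\<close>

text \<open>The base \<open>(D, D \<inter> \<F>, P(\<cdot>|D))\<close>.\<close>

definition cond_base :: "'a measure \<Rightarrow> 'a set \<Rightarrow> 'a measure" where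
  "cond_base M D = restrict_space (uniform_measure M D) D"

definition L0_restrict ::
    "'a measure \<Rightarrow> 'a set \<Rightarrow> ('a \<Rightarrow> 'b::topological_space) set \<Rightarrow> ('a \<Rightarrow> 'b) set" where
  "L0_restrict M D X = L0_class (cond_base M D) (rep X)"

text \<open>Extension by zero identifies \<open>L\<^sup>0(D \<inter> \<F>)\<close> with \<open>I\<^sub>D L\<^sup>0(\<F>)\<close>.\<close>

definition L0_extend :: "'a measure \<Rightarrow> 'a set \<Rightarrow> ('a \<Rightarrow> real) set \<Rightarrow> ('a \<Rightarrow> real) set" where
  "L0_extend M D X = L0_class M (\<lambda>\<omega>. indicator D \<omega> * rep X \<omega>)"

definition restrict_module ::
    "'a measure \<Rightarrow> 'a set \<Rightarrow> (('a \<Rightarrow> real) set, 'e) module \<Rightarrow> (('a \<Rightarrow> real) set, 'e) module" where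
  "restrict_module M D E =
     E\<lparr>carrier := {L0_ind M D \<odot>\<^bsub>E\<^esub> x |x. x \<in> carrier E},
       smult := (\<lambda>\<xi> x. L0_extend M D \<xi> \<odot>\<^bsub>E\<^esub> x)\<rparr>"

definition restrict_seminorms ::
    "'a measure \<Rightarrow> 'a set \<Rightarrow> ('e \<Rightarrow> ('a \<Rightarrow> real) set) set \<Rightarrow> ('e \<Rightarrow> ('a \<Rightarrow> real) set) set" where
  "restrict_seminorms M D P = (\<lambda>n x. L0_restrict M D (n x)) ` P"

text \<open>Restricting a class to \<open>D\<close> is the identification of \<open>I\<^sub>D\<close> times that class with an
  element over the base \<open>D\<close>. Only the values on \<open>I\<^sub>D E\<close> matter.\<close>

definition restrict_fun ::
    "'a measure \<Rightarrow> 'a set \<Rightarrow> ('e \<Rightarrow> ('a \<Rightarrow> ereal) set) \<Rightarrow> 'e \<Rightarrow> ('a \<Rightarrow> ereal) set" where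
  "restrict_fun M D f = (\<lambda>x. L0_restrict M D (f x))"


section \<open>Closed functions, closure and conjugates\<close>

definition is_ess_sup_sets :: "'a measure \<Rightarrow> 'a set set \<Rightarrow> 'a set \<Rightarrow> bool" where
  "is_ess_sup_sets M \<A> S \<longleftrightarrow>
     S \<in> sets M \<and> (\<forall>A\<in>\<A>. A - S \<in> null_sets M) \<and>
     (\<forall>T\<in>sets M. (\<forall>A\<in>\<A>. A - T \<in> null_sets M) \<longrightarrow> S - T \<in> null_sets M)"

definition MI ::
    "'a measure \<Rightarrow> (('a \<Rightarrow> real) set, 'e) module \<Rightarrow> ('e \<Rightarrow> ('a \<Rightarrow> ereal) set) \<Rightarrow> 'a set" where
  "MI M E f = (SOME S. is_ess_sup_sets M
     {A \<in> sets M. \<exists>x\<in>carrier E.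
        L0bar_scale M (L0_ind M A) (f x) = L0bar_scale M (L0_ind M A) (L0_class M (\<lambda>_. - \<infinity>))} S)"

definition PI ::
    "'a measure \<Rightarrow> (('a \<Rightarrow> real) set, 'e) module \<Rightarrow> ('e \<Rightarrow> ('a \<Rightarrow> ereal) set) \<Rightarrow> 'a set" where
  "PI M E f = (SOME S. is_ess_sup_sets M
     {A \<in> sets M. \<forall>x\<in>carrier E.
        L0bar_scale M (L0_ind M A) (f x) = L0bar_scale M (L0_ind M A) (L0_class M (\<lambda>_. \<infinity>))} S)"

definition BP ::
    "'a measure \<Rightarrow> (('a \<Rightarrow> real) set, 'e) module \<Rightarrow> ('e \<Rightarrow> ('a \<Rightarrow> ereal) set) \<Rightarrow> 'a set" where
  "BP M E f = space M - (MI M E f \<union> PI M E f)"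

definition eps_lambda_closed ::
    "'a measure \<Rightarrow> (('a \<Rightarrow> real) set, 'e) module \<Rightarrow> ('e \<Rightarrow> ('a \<Rightarrow> real) set) set
      \<Rightarrow> ('e \<Rightarrow> ('a \<Rightarrow> ereal) set) \<Rightarrow> bool" where
  "eps_lambda_closed M E P f \<longleftrightarrow>
     local_fun M E f \<and>
     (\<forall>x\<in>carrier E. L0bar_scale M (L0_ind M (MI M E f)) (f x) =
        L0bar_scale M (L0_ind M (MI M E f)) (L0_class M (\<lambda>_. - \<infinity>))) \<and>
     (\<forall>A\<in>sets M. A \<subseteq> BP M E f \<longrightarrow> measure M A > 0 \<longrightarrow>
        proper_fun (cond_base M A) (restrict_module M A E) (restrict_fun M A f) \<longrightarrow>
        L0_convex (cond_base M A) (restrict_module M A E) (restrict_fun M A f) \<and>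
        eps_lambda_lsc (cond_base M A) (restrict_module M A E) (restrict_seminorms M A P)
          (restrict_fun M A f))"

text \<open>Functions \<open>E \<rightarrow> L\<^sup>0\<close> (extended) with the pointwise order. They are taken extensional on the
  carrier of \<open>E\<close>, so that equality of functions is equality on \<open>E\<close>.\<close>

definition L0bar_fun ::
    "'a measure \<Rightarrow> (('a \<Rightarrow> real) set, 'e) module \<Rightarrow> ('e \<Rightarrow> ('a \<Rightarrow> ereal) set) gorder" where
  "L0bar_fun M E =
    \<lparr>carrier = carrier E \<rightarrow>\<^sub>E carrier (L0bar M), eq = (=),
     le = (\<lambda>h k. \<forall>x\<in>carrier E. L0_le M (h x) (k x))\<rparr>"

definition Cl ::
    "'a measure \<Rightarrow> (('a \<Rightarrow> real) set, 'e) module \<Rightarrow> ('e \<Rightarrow> ('a \<Rightarrow> real) set) set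
      \<Rightarrow> ('e \<Rightarrow> ('a \<Rightarrow> ereal) set) \<Rightarrow> 'e \<Rightarrow> ('a \<Rightarrow> ereal) set" where
  "Cl M E P f = (THE h. greatest (L0bar_fun M E) h
     {k \<in> carrier (L0bar_fun M E). eps_lambda_closed M E P k \<and> k \<sqsubseteq>\<^bsub>L0bar_fun M E\<^esub> f})"

definition conjugate ::
    "'a measure \<Rightarrow> (('a \<Rightarrow> real) set, 'e) module \<Rightarrow> ('e \<Rightarrow> ('a \<Rightarrow> ereal) set)
      \<Rightarrow> ('e \<Rightarrow> ('a \<Rightarrow> real) set) \<Rightarrow> ('a \<Rightarrow> ereal) set" where
  "conjugate M E f g =
     \<Squnion>\<^bsub>L0bar M\<^esub> {L0bar_diff M (L0_ereal M (g x)) (f x) |x. x \<in> carrier E}"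

definition biconjugate ::
    "'a measure \<Rightarrow> (('a \<Rightarrow> real) set, 'e) module \<Rightarrow> ('e \<Rightarrow> ('a \<Rightarrow> real) set) set
      \<Rightarrow> ('e \<Rightarrow> ('a \<Rightarrow> ereal) set) \<Rightarrow> 'e \<Rightarrow> ('a \<Rightarrow> ereal) set" where
  "biconjugate M E P f = (\<lambda>x\<in>carrier E.
     \<Squnion>\<^bsub>L0bar M\<^esub> {L0bar_diff M (L0_ereal M (g x)) (conjugate M E f g) |g. g \<in> random_dual M E P})"

end

theory Submission
  imports Defs
begin

text \<open>As a supremum of affine functions, \<open>f\<^sup>*\<^sup>*\<close> is a closed function, and it lies below \<open>f\<close>.
  Conversely, let \<open>h \<le> f\<close> be closed and suppose that \<open>f\<^sup>*\<^sup>*(x) < \<beta> < h(x)\<close> on an event of positive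
  probability, with \<open>\<beta>\<close> rational. On a smaller event lower semicontinuity yields \<open>\<epsilon> > 0\<close> with
  \<open>h(y) \<ge> \<beta>\<close> wherever \<open>\<parallel>y - x\<parallel> < \<epsilon>\<close>, for one finite family of seminorms and all \<open>y\<close>. The same
  argument at a point where \<open>h\<close> is finite, together with convexity, bounds \<open>h\<close> from below by a function
  of linear growth; hence \<open>h(y) \<ge> \<beta> - N \<parallel>y - x\<parallel>\<close> for a random variable \<open>N\<close>. A Hahn-Banach theorem
  for \<open>L\<^sup>0\<close>-modules gives \<open>g\<close> in the dual with \<open>h(y) \<ge> g(y - x) + \<beta>\<close> for all \<open>y\<close>. So
  \<open>f\<^sup>*(g) \<le> g(x) - \<beta>\<close> and \<open>f\<^sup>*\<^sup>*(x) \<ge> \<beta>\<close> on that event, a contradiction. The module need not admit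
  countable gluing; this is why one passes to smaller events instead of assembling a global \<open>g\<close>.\<close>

section \<open>The ring of random variables\<close>

text \<open>The topology need not be locally convex over the reals, so classical separation theorems
  give nothing. Domination replaces them: a functional is found below a sublinear map whose values
  are random variables, and a bound by a random multiple of a seminorm already makes it continuous.
  Semicontinuity speaks of probabilities: no point of the epigraph is close to (x, \<beta>) with
  high probability. From this an inequality has to be extracted that holds a.e. on one fixed event,
  for uncountably many y. Locality makes it possible, because points can be glued along an event.
  The value h(x) may be infinite, so convexity is of no use along segments that end in x; hence the
  auxiliary point with a finite value. It yields linear growth, but with the wrong value at x. The
  gap at x corrects this: within distance \<epsilon> of x the bound h(y) \<ge> \<beta> is there
  already, and at distance at least \<epsilon> a large N absorbs the error. Rational \<beta> form a
  countable set, so one of them works on an event of positive probability.\<close>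

lemma carrier_L0: "carrier (L0 M) = L0_class M ` borel_measurable M"
  by (simp add: L0_def)

lemma carrier_L0bar: "carrier (L0bar M) = L0_class M ` borel_measurable M"
  by (simp add: L0bar_def)

lemma L0_class_in_L0 [simp, intro]:
  "u \<in> borel_measurable M \<Longrightarrow> L0_class M u \<in> carrier (L0 M)"
  by (simp add: carrier_L0)

lemma rep_measurable_L0: "X \<in> carrier (L0 M) \<Longrightarrow> rep X \<in> borel_measurable M"
  by (simp add: carrier_L0 L0_class_rep)

lemma rep_measurable_L0bar: "X \<in> carrier (L0bar M) \<Longrightarrow> rep X \<in> borel_measurable M"
  by (simp add: carrier_L0bar L0_class_rep)

lemma L0_class_rep_L0 [simp]: "X \<in> carrier (L0 M) \<Longrightarrow> L0_class M (rep X) = X"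
  by (simp add: carrier_L0 L0_class_rep)

lemma L0_class_rep_L0bar [simp]: "X \<in> carrier (L0bar M) \<Longrightarrow> L0_class M (rep X) = X"
  by (simp add: carrier_L0bar L0_class_rep)

lemma L0_eqI:
  assumes "X \<in> carrier (L0 M)" "Y \<in> carrier (L0 M)" "AE w in M. rep X w = rep Y w"
  shows "X = Y"
  using L0_class_cong[OF assms(3)] assms(1,2) by simp

lemma L0bar_eqI:
  assumes "X \<in> carrier (L0bar M)" "Y \<in> carrier (L0bar M)" "AE w in M. rep X w = rep Y w"
  shows "X = Y"
  using L0_class_cong[OF assms(3)] assms(1,2) by simp

lemma L0_cases:
  assumes "X \<in> carrier (L0 M)"
  obtains u where "u \<in> borel_measurable M" "X = L0_class M u"
  using assms by (auto simp: carrier_L0)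

lemma L0_class_add:
  assumes [measurable]: "u \<in> borel_measurable M" "v \<in> borel_measurable M"
  shows "L0_class M u \<oplus>\<^bsub>L0 M\<^esub> L0_class M v = L0_class M (\<lambda>w. u w + v w)"
proof -
  have "AE w in M. rep (L0_class M u) w + rep (L0_class M v) w = u w + v w"
    using rep_L0_class(2)[OF assms(1)] rep_L0_class(2)[OF assms(2)] by eventually_elim simp
  then show ?thesis by (simp add: L0_def L0_class_cong)
qed

lemma L0_class_mult:
  assumes [measurable]: "u \<in> borel_measurable M" "v \<in> borel_measurable M"
  shows "L0_class M u \<otimes>\<^bsub>L0 M\<^esub> L0_class M v = L0_class M (\<lambda>w. u w * v w)"
proof -
  have "AE w in M. rep (L0_class M u) w * rep (L0_class M v) w = u w * v w"
    using rep_L0_class(2)[OF assms(1)] rep_L0_class(2)[OF assms(2)] by eventually_elim simp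
  then show ?thesis by (simp add: L0_def L0_class_cong)
qed

lemma smult_L0: "X \<odot>\<^bsub>L0 M\<^esub> Y = X \<otimes>\<^bsub>L0 M\<^esub> Y"
  by (simp add: L0_def)

lemma L0_zero: "\<zero>\<^bsub>L0 M\<^esub> = L0_class M (\<lambda>_. 0)"
  by (simp add: L0_def)

lemma L0_one: "\<one>\<^bsub>L0 M\<^esub> = L0_class M (\<lambda>_. 1)"
  by (simp add: L0_def)

lemma cring_L0: "cring (L0 M)"
proof (rule cringI)
  show "abelian_group (L0 M)"
  proof (rule abelian_groupI)
    fix X assume "X \<in> carrier (L0 M)"
    then obtain u where [measurable]: "u \<in> borel_measurable M" and X: "X = L0_class M u"
      by (rule L0_cases)
    show "\<zero>\<^bsub>L0 M\<^esub> \<oplus>\<^bsub>L0 M\<^esub> X = X"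
      by (simp add: X L0_zero L0_class_add)
    show "\<exists>Y\<in>carrier (L0 M). Y \<oplus>\<^bsub>L0 M\<^esub> X = \<zero>\<^bsub>L0 M\<^esub>"
      by (rule bexI[of _ "L0_class M (\<lambda>w. - u w)"]) (simp_all add: X L0_zero L0_class_add)
  qed (auto elim!: L0_cases simp: L0_class_add L0_zero algebra_simps)
  show "comm_monoid (L0 M)"
    by (rule comm_monoidI)
      (auto elim!: L0_cases simp: L0_class_mult L0_one algebra_simps)
qed (auto elim!: L0_cases simp: L0_class_add L0_class_mult algebra_simps)

lemma module_L0: "module (L0 M) (L0 M)"
proof -
  interpret cring "L0 M" by (rule cring_L0)
  show ?thesis
    by (rule moduleI) (auto simp: smult_L0 l_distr r_distr m_assoc intro: cring_L0 is_abelian_group)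
qed

lemma L0_class_uminus:
  assumes [measurable]: "u \<in> borel_measurable M"
  shows "\<ominus>\<^bsub>L0 M\<^esub> L0_class M u = L0_class M (\<lambda>w. - u w)"
proof -
  interpret cring "L0 M" by (rule cring_L0)
  show ?thesis
    by (rule minus_equality) (simp_all add: L0_class_add L0_zero)
qed

lemma L0_class_minus:
  assumes [measurable]: "u \<in> borel_measurable M" "v \<in> borel_measurable M"
  shows "L0_class M u \<ominus>\<^bsub>L0 M\<^esub> L0_class M v = L0_class M (\<lambda>w. u w - v w)"
  by (simp add: a_minus_def L0_class_uminus L0_class_add)

lemma L0_abs_class:
  assumes "u \<in> borel_measurable M"
  shows "L0_abs M (L0_class M u) = L0_class M (\<lambda>w. \<bar>u w\<bar>)"
proof -
  have "AE w in M. \<bar>rep (L0_class M u) w\<bar> = \<bar>u w\<bar>"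
    using rep_L0_class(2)[OF assms] by eventually_elim simp
  then show ?thesis by (simp add: L0_abs_def L0_class_cong)
qed

lemma L0_le_class_iff:
  assumes "u \<in> borel_measurable M" "v \<in> borel_measurable M"
  shows "L0_le M (L0_class M u) (L0_class M v) \<longleftrightarrow> (AE w in M. u w \<le> v w)"
  unfolding L0_le_def
proof
  assume "AE w in M. rep (L0_class M u) w \<le> rep (L0_class M v) w"
  with rep_L0_class(2)[OF assms(1)] rep_L0_class(2)[OF assms(2)]
  show "AE w in M. u w \<le> v w" by eventually_elim simp
next
  assume "AE w in M. u w \<le> v w"
  with rep_L0_class(2)[OF assms(1)] rep_L0_class(2)[OF assms(2)]
  show "AE w in M. rep (L0_class M u) w \<le> rep (L0_class M v) w" by eventually_elim simp
qed

lemma L0_pos_class_iff: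
  assumes "u \<in> borel_measurable M"
  shows "L0_class M u \<in> L0_pos M \<longleftrightarrow> (AE w in M. 0 \<le> u w)"
  using assms by (simp add: L0_pos_def L0_zero L0_le_class_iff)

lemma L0_pos_iff: "X \<in> L0_pos M \<longleftrightarrow> X \<in> carrier (L0 M) \<and> (AE w in M. 0 \<le> rep X w)"
  using L0_pos_class_iff[OF rep_measurable_L0, of X M] by (auto simp: L0_pos_def)

lemma rep_L0_add:
  assumes "X \<in> carrier (L0 M)" "Y \<in> carrier (L0 M)"
  shows "AE w in M. rep (X \<oplus>\<^bsub>L0 M\<^esub> Y) w = rep X w + rep Y w"
  using rep_L0_class(2)[of "\<lambda>w. rep X w + rep Y w" M] assms[THEN rep_measurable_L0]
  by (simp add: L0_def)

lemma rep_L0_mult: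
  assumes "X \<in> carrier (L0 M)" "Y \<in> carrier (L0 M)"
  shows "AE w in M. rep (X \<otimes>\<^bsub>L0 M\<^esub> Y) w = rep X w * rep Y w"
  using rep_L0_class(2)[of "\<lambda>w. rep X w * rep Y w" M] assms[THEN rep_measurable_L0]
  by (simp add: L0_def)

lemma L0_ereal_in_L0bar [simp, intro]:
  "X \<in> carrier (L0 M) \<Longrightarrow> L0_ereal M X \<in> carrier (L0bar M)"
  using rep_measurable_L0[of X M] by (simp add: L0_ereal_def carrier_L0bar)

lemma rep_L0_ereal:
  assumes "X \<in> carrier (L0 M)"
  shows "AE w in M. rep (L0_ereal M X) w = ereal (rep X w)"
  using rep_L0_class(2)[of "\<lambda>w. ereal (rep X w)" M] rep_measurable_L0[OF assms]
  by (simp add: L0_ereal_def)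

text \<open>The convention 0 * \<infinity> = 0 makes both products vanish off A, whatever the values
  there. Locality, \<open>MI\<close>, \<open>PI\<close> and closedness are all used through this
  a.e. form.\<close>

lemma L0bar_scale_ind_eq_iff:
  assumes "A \<in> sets M" "X \<in> carrier (L0bar M)" "Y \<in> carrier (L0bar M)"
  shows "L0bar_scale M (L0_ind M A) X = L0bar_scale M (L0_ind M A) Y \<longleftrightarrow>
    (AE w in M. w \<in> A \<longrightarrow> rep X w = rep Y w)"
proof -
  have [measurable]: "rep X \<in> borel_measurable M" "rep Y \<in> borel_measurable M"
    "rep (L0_ind M A) \<in> borel_measurable M"
    using assms by (auto intro!: rep_measurable_L0bar rep_measurable_L0 simp: L0_ind_def)
  have ind: "AE w in M. rep (L0_ind M A) w = indicator A w"
    unfolding L0_ind_def using assms(1) by (intro rep_L0_class(2)) simp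
  have "L0bar_scale M (L0_ind M A) X = L0bar_scale M (L0_ind M A) Y \<longleftrightarrow>
    (AE w in M. ereal (rep (L0_ind M A) w) * rep X w = ereal (rep (L0_ind M A) w) * rep Y w)"
    unfolding L0bar_scale_def by (subst L0_class_eq_iff) simp_all
  also have "\<dots> \<longleftrightarrow> (AE w in M. w \<in> A \<longrightarrow> rep X w = rep Y w)"
  proof
    assume "AE w in M. ereal (rep (L0_ind M A) w) * rep X w = ereal (rep (L0_ind M A) w) * rep Y w"
    with ind show "AE w in M. w \<in> A \<longrightarrow> rep X w = rep Y w"
      by eventually_elim (auto simp: one_ereal_def[symmetric])
  next
    assume "AE w in M. w \<in> A \<longrightarrow> rep X w = rep Y w"
    with ind show "AE w in M. ereal (rep (L0_ind M A) w) * rep X w = ereal (rep (L0_ind M A) w) * rep Y w"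
      by eventually_elim (auto simp: indicator_def zero_ereal_def[symmetric])
  qed
  finally show ?thesis .
qed

section \<open>Essential suprema\<close>

context prob_space
begin

text \<open>A countable subfamily whose union has maximal probability is essentially the largest one.\<close>

lemma ess_union_countable:
  assumes sub: "\<A> \<subseteq> events"
  obtains \<C> where "countable \<C>" "\<C> \<subseteq> \<A>" "\<And>A. A \<in> \<A> \<Longrightarrow> A - \<Union>\<C> \<in> null_sets M"
proof -
  define V where "V = {prob (\<Union>\<C>) |\<C>. countable \<C> \<and> \<C> \<subseteq> \<A>}"
  have ne: "V \<noteq> {}" unfolding V_def by auto
  have bdd: "bdd_above V" unfolding V_def by (rule bdd_aboveI[of _ 1]) auto
  have "\<exists>\<C>. countable \<C> \<and> \<C> \<subseteq> \<A> \<and> Sup V - 1 / Suc n < prob (\<Union>\<C>)" for n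
  proof -
    have "\<exists>v\<in>V. Sup V - 1 / Suc n < v" using less_cSup_iff[OF ne bdd, of "Sup V - 1 / Suc n"] by simp
    thus ?thesis by (auto simp: V_def)
  qed
  then obtain \<C> where C: "\<And>n. countable (\<C> n)" "\<And>n. \<C> n \<subseteq> \<A>"
    "\<And>n. Sup V - 1 / Suc n < prob (\<Union>(\<C> n))" by metis
  define \<D> where "\<D> = (\<Union>n::nat. \<C> n)"
  have D: "countable \<D>" "\<D> \<subseteq> \<A>" using C by (auto simp: \<D>_def)
  have Dev: "\<Union>\<D> \<in> events" using D sub by (intro sets.countable_Union) auto
  have D_ge: "Sup V \<le> prob (\<Union>\<D>)"
  proof (rule field_le_epsilon)
    fix e :: real assume "e > 0"
    then obtain n :: nat where n: "1 / Suc n < e" using nat_approx_posE by blast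
    have "prob (\<Union>(\<C> n)) \<le> prob (\<Union>\<D>)"
      using Dev by (intro finite_measure_mono) (auto simp: \<D>_def)
    with C(3)[of n] n show "Sup V \<le> prob (\<Union>\<D>) + e" by linarith
  qed
  have "A - \<Union>\<D> \<in> null_sets M" if A: "A \<in> \<A>" for A
  proof -
    have [simp]: "A \<in> events" using A sub by auto
    have "prob (\<Union>(insert A \<D>)) \<in> V" unfolding V_def using A D
      by (intro CollectI exI[of _ "insert A \<D>"]) simp
    then have "prob (\<Union>(insert A \<D>)) \<le> Sup V" using bdd by (rule cSup_upper)
    moreover have "prob (\<Union>(insert A \<D>)) = prob (\<Union>\<D>) + prob (A - \<Union>\<D>)"
    proof -
      have "\<Union>(insert A \<D>) = \<Union>\<D> \<union> (A - \<Union>\<D>)" by auto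
      moreover have "prob (\<Union>\<D> \<union> (A - \<Union>\<D>)) = prob (\<Union>\<D>) + prob (A - \<Union>\<D>)"
        using Dev by (intro finite_measure_Union) auto
      ultimately show ?thesis by simp
    qed
    ultimately have "prob (A - \<Union>\<D>) \<le> 0" using D_ge by linarith
    then have "prob (A - \<Union>\<D>) = 0" using measure_le_0_iff by blast
    then show ?thesis using Dev by (auto simp: null_sets_def emeasure_eq_measure)
  qed
  with D show ?thesis using that by blast
qed

text \<open>For each rational level q the sets {f > q} are exhausted by countably many of them. An f
  that exceeds the countable supremum at a point does so across a rational level, and that point
  then lies in one of countably many null sets.\<close>

lemma ess_SUP_countable:
  fixes F :: "('a \<Rightarrow> ereal) set"
  assumes meas: "F \<subseteq> borel_measurable M"
  obtains C where "countable C" "C \<subseteq> F" "\<And>f. f \<in> F \<Longrightarrow> AE w in M. f w \<le> (SUP h\<in>C. h w)"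
proof -
  have [measurable]: "f \<in> borel_measurable M" if "f \<in> F" for f using meas that by auto
  define lev where "lev q f = {w \<in> space M. ereal q < f w}" for q :: real and f
  have "\<exists>\<C>. countable \<C> \<and> \<C> \<subseteq> lev q ` F \<and> (\<forall>f\<in>F. lev q f - \<Union>\<C> \<in> null_sets M)" for q
  proof -
    have "lev q ` F \<subseteq> events" unfolding lev_def by auto
    from ess_union_countable[OF this] show ?thesis by (metis imageI)
  qed
  then obtain \<C> where C: "\<And>q. countable (\<C> q)" "\<And>q. \<C> q \<subseteq> lev q ` F"
    "\<And>q f. f \<in> F \<Longrightarrow> lev q f - \<Union>(\<C> q) \<in> null_sets M" by metis
  have "\<exists>K. countable K \<and> K \<subseteq> F \<and> \<C> q = lev q ` K" for q
    using C(1,2)[of q] by (metis countable_subset_image)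
  then obtain K where K: "\<And>q. countable (K q)" "\<And>q. K q \<subseteq> F" "\<And>q. \<C> q = lev q ` K q" by metis
  define D where "D = (\<Union>q\<in>\<rat>. K q)"
  have D: "countable D" "D \<subseteq> F" using K countable_rat by (auto simp: D_def)
  have "AE w in M. f w \<le> (SUP h\<in>D. h w)" if f: "f \<in> F" for f
  proof -
    have "AE w in M. \<forall>q\<in>\<rat>. w \<notin> lev q f - \<Union>(\<C> q)"
      using C(3)[OF f] by (intro AE_ball_countable'[OF _ countable_rat] AE_not_in)
    then show ?thesis using AE_space
    proof eventually_elim
      case (elim w)
      show ?case
      proof (rule ccontr)
        assume "\<not> ?thesis"
        then obtain x y where xy: "(SUP h\<in>D. h w) < ereal x" "ereal x < ereal y" "ereal y < f w"
          by (metis ereal_dense2 not_le)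
        then obtain q where q: "q \<in> \<rat>" "x < q" "q < y" using Rats_dense_in_real by auto
        have "ereal q < f w" using xy q by (metis ereal_less_eq(3) less_imp_le less_le_trans not_le)
        then have "w \<in> lev q f" using elim(2) by (simp add: lev_def)
        then obtain h where h: "h \<in> K q" "w \<in> lev q h" using elim(1) q(1) K(3) by auto
        have "ereal q < h w" using h by (simp add: lev_def)
        also have "h w \<le> (SUP h\<in>D. h w)" using h q by (intro SUP_upper) (auto simp: D_def)
        also have "\<dots> < ereal x" by (rule xy)
        finally show False using q by simp
      qed
    qed
  qed
  with D show ?thesis using that by blast
qed

text \<open>Passing to -f reduces the infimum to an essential supremum. A member of F and the bound
  b enclose it between real numbers a.e., so \<open>real_of_ereal\<close> changes it on a null set
  only.\<close>

lemma ess_INF_real: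
  fixes F :: "('a \<Rightarrow> real) set"
  assumes meas: "F \<subseteq> borel_measurable M" and "F \<noteq> {}"
    and [measurable]: "b \<in> borel_measurable M" and lb: "\<And>f. f \<in> F \<Longrightarrow> AE w in M. b w \<le> f w"
  obtains s where "s \<in> borel_measurable M" "\<And>f. f \<in> F \<Longrightarrow> AE w in M. s w \<le> f w"
    "\<And>l. l \<in> borel_measurable M \<Longrightarrow> (\<And>f. f \<in> F \<Longrightarrow> AE w in M. l w \<le> f w) \<Longrightarrow> AE w in M. l w \<le> s w"
proof -
  define G where "G = (\<lambda>f w. ereal (- f w)) ` F"
  have [measurable]: "f \<in> borel_measurable M" if "f \<in> F" for f using meas that by auto
  have "G \<subseteq> borel_measurable M" by (auto simp: G_def)
  then obtain C where C: "countable C" "C \<subseteq> G" "\<And>g. g \<in> G \<Longrightarrow> AE w in M. g w \<le> (SUP h\<in>C. h w)"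
    by (rule ess_SUP_countable) blast
  have [measurable]: "h \<in> borel_measurable M" if "h \<in> C" for h
    using that C(2) by (auto simp: G_def)
  define s where "s w = - real_of_ereal (SUP h\<in>C. h w)" for w
  have s [measurable]: "s \<in> borel_measurable M" unfolding s_def using C(1) by measurable
  obtain f0 where f0: "f0 \<in> F" using \<open>F \<noteq> {}\<close> by blast
  have C_le: "AE w in M. (SUP h\<in>C. h w) \<le> ereal (- l w)"
    if "\<And>f. f \<in> F \<Longrightarrow> AE w in M. l w \<le> f w" for l
  proof -
    have "AE w in M. \<forall>h\<in>C. h w \<le> ereal (- l w)"
    proof (rule AE_ball_countable'[OF _ C(1)])
      fix h assume "h \<in> C"
      then obtain f where "f \<in> F" "h = (\<lambda>w. ereal (- f w))" using C(2) by (auto simp: G_def)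
      with that show "AE w in M. h w \<le> ereal (- l w)" by simp
    qed
    then show ?thesis by eventually_elim (rule SUP_least, simp)
  qed
  have fin: "AE w in M. (SUP h\<in>C. h w) = ereal (- s w)"
  proof -
    have "AE w in M. ereal (- f0 w) \<le> (SUP h\<in>C. h w)" using C(3) f0 by (auto simp: G_def)
    moreover have "AE w in M. (SUP h\<in>C. h w) \<le> ereal (- b w)"
      by (rule C_le) (rule lb)
    ultimately show ?thesis
      by eventually_elim (auto simp: s_def intro!: ereal_real'[symmetric])
  qed
  show ?thesis
  proof (rule that[OF s])
    fix f assume "f \<in> F"
    then have "AE w in M. ereal (- f w) \<le> (SUP h\<in>C. h w)" using C(3) by (auto simp: G_def)
    with fin show "AE w in M. s w \<le> f w" by eventually_elim simp
  next
    fix l assume l: "\<And>f. f \<in> F \<Longrightarrow> AE w in M. l w \<le> f w"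
    have "AE w in M. (SUP h\<in>C. h w) \<le> ereal (- l w)" by (rule C_le) (rule l)
    with fin show "AE w in M. l w \<le> s w" by eventually_elim simp
  qed
qed

text \<open>A countable subfamily already attains the essential supremum, and its pointwise supremum
  is measurable. The operator \<open>\<Squnion>\<close> chooses some least upper bound; antisymmetry
  of the order on classes identifies it with this one.\<close>

lemma L0bar_sup:
  assumes A: "A \<subseteq> carrier (L0bar M)"
  shows "\<Squnion>\<^bsub>L0bar M\<^esub> A \<in> carrier (L0bar M)"
    "\<And>X. X \<in> A \<Longrightarrow> AE w in M. rep X w \<le> rep (\<Squnion>\<^bsub>L0bar M\<^esub> A) w"
    "\<exists>C. countable C \<and> C \<subseteq> A \<and> (AE w in M. rep (\<Squnion>\<^bsub>L0bar M\<^esub> A) w = (SUP X\<in>C. rep X w))"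
proof -
  interpret partial_order "L0bar M" by (rule L0bar_partial)
  have m: "rep ` A \<subseteq> borel_measurable M" using A by (auto intro: rep_measurable_L0bar)
  obtain K where cK: "countable K" "K \<subseteq> rep ` A"
    and Kle: "\<And>f. f \<in> rep ` A \<Longrightarrow> AE w in M. f w \<le> (SUP h\<in>K. h w)"
    by (rule ess_SUP_countable[OF m]) blast
  from cK obtain C where C: "countable C" "C \<subseteq> A" and K: "K = rep ` C"
    by (metis countable_subset_image)
  have le: "AE w in M. rep X w \<le> (SUP X\<in>C. rep X w)" if "X \<in> A" for X
    using Kle[of "rep X"] that by (simp add: K image_image)
  let ?s = "L0_class M (\<lambda>w. SUP X\<in>C. rep X w)"
  have cC: "C \<subseteq> carrier (L0bar M)" using C A by auto
  have m: "(\<lambda>w. SUP X\<in>C. rep X w) \<in> borel_measurable M"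
    using C cC by (intro borel_measurable_SUP) (auto intro: rep_measurable_L0bar)
  have l: "least (L0bar M) ?s (Upper (L0bar M) C)" by (rule L0bar_sup_countable[OF cC C(1)])
  have up: "?s \<in> Upper (L0bar M) A"
    unfolding Upper_def
  proof (safe)
    fix X assume "X \<in> A"
    then show "X \<sqsubseteq>\<^bsub>L0bar M\<^esub> ?s"
      using le[of X] rep_L0_class(2)[OF m] by (auto simp: L0bar_def L0_le_def elim: eventually_elim2)
  qed (use m in \<open>simp add: carrier_L0bar\<close>)
  have "Upper (L0bar M) A \<subseteq> Upper (L0bar M) C" using C(2) by (rule Upper_antimono)
  then have l': "least (L0bar M) ?s (Upper (L0bar M) A)"
    using l up unfolding least_def by auto
  have eq: "\<Squnion>\<^bsub>L0bar M\<^esub> A = ?s"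
    unfolding Lattice.sup_def
    using someI[of "\<lambda>s. least (L0bar M) s (Upper (L0bar M) A)", OF l'] l' by (rule least_unique)
  show "\<Squnion>\<^bsub>L0bar M\<^esub> A \<in> carrier (L0bar M)" unfolding eq using m by (simp add: carrier_L0bar)
  show "AE w in M. rep X w \<le> rep (\<Squnion>\<^bsub>L0bar M\<^esub> A) w" if "X \<in> A" for X
    using le[OF that] rep_L0_class(2)[OF m] unfolding eq by eventually_elim simp
  show "\<exists>C. countable C \<and> C \<subseteq> A \<and> (AE w in M. rep (\<Squnion>\<^bsub>L0bar M\<^esub> A) w = (SUP X\<in>C. rep X w))"
    using C rep_L0_class(2)[OF m] unfolding eq by auto
qed

text \<open>Only countably many members of A enter, so the inequality can be taken pointwise off one
  null set. This allows arbitrary B and h, measurable or not.\<close>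

lemma L0bar_sup_least:
  assumes A: "A \<subseteq> carrier (L0bar M)" and le: "\<And>X. X \<in> A \<Longrightarrow> AE w in M. w \<in> B \<longrightarrow> rep X w \<le> h w"
  shows "AE w in M. w \<in> B \<longrightarrow> rep (\<Squnion>\<^bsub>L0bar M\<^esub> A) w \<le> h w"
proof -
  obtain C where C: "countable C" "C \<subseteq> A"
    and eq: "AE w in M. rep (\<Squnion>\<^bsub>L0bar M\<^esub> A) w = (SUP X\<in>C. rep X w)"
    using L0bar_sup(3)[OF A] by auto
  have "AE w in M. \<forall>X\<in>C. w \<in> B \<longrightarrow> rep X w \<le> h w"
    using C le by (intro AE_ball_countable') auto
  with eq show ?thesis by eventually_elim (auto intro: SUP_least)
qed

lemma is_ess_sup_sets_countable:
  assumes "\<A> \<subseteq> events" "is_ess_sup_sets M \<A> S"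
  shows "\<exists>\<C>. countable \<C> \<and> \<C> \<subseteq> \<A> \<and> S - \<Union>\<C> \<in> null_sets M"
proof -
  obtain \<C> where C: "countable \<C>" "\<C> \<subseteq> \<A>" "\<And>A. A \<in> \<A> \<Longrightarrow> A - \<Union>\<C> \<in> null_sets M"
    using ess_union_countable[OF assms(1)] by metis
  moreover have "\<Union>\<C> \<in> events" using C assms(1) by (intro sets.countable_Union) auto
  ultimately show ?thesis using assms(2) unfolding is_ess_sup_sets_def by blast
qed

text \<open>This existence statement gives the choices made by \<open>MI\<close> and
  \<open>PI\<close> their meaning.\<close>

lemma is_ess_sup_sets_SOME:
  assumes "\<A> \<subseteq> events"
  shows "is_ess_sup_sets M \<A> (SOME S. is_ess_sup_sets M \<A> S)"
proof -
  obtain \<C> where C: "countable \<C>" "\<C> \<subseteq> \<A>" "\<And>A. A \<in> \<A> \<Longrightarrow> A - \<Union>\<C> \<in> null_sets M"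
    using ess_union_countable[OF assms] by metis
  have "\<Union>\<C> \<in> events" using C assms by (intro sets.countable_Union) auto
  moreover have "\<Union>\<C> - T \<in> null_sets M" if "T \<in> events" "\<forall>A\<in>\<A>. A - T \<in> null_sets M" for T
  proof -
    have "\<Union>\<C> - T = (\<Union>A\<in>\<C>. A - T)" by auto
    also have "\<dots> \<in> null_sets M" using that C by (intro null_sets_UN') auto
    finally show ?thesis .
  qed
  ultimately have "is_ess_sup_sets M \<A> (\<Union>\<C>)" using C by (auto simp: is_ess_sup_sets_def)
  then show ?thesis by (rule someI)
qed

end


section \<open>Dominated linear functionals on an \<open>L\<^sup>0\<close>-module\<close>

locale L0_module = prob_space M + module "L0 M" E
  for M :: "'a measure" and E :: "(('a \<Rightarrow> real) set, 'e) module" (structure)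
begin

text \<open>Scalars are measurable functions here instead of classes, so that indicators, constants
  and piecewise definitions can be written down without choosing versions.\<close>

definition scal :: "('a \<Rightarrow> real) \<Rightarrow> 'e \<Rightarrow> 'e" where
  "scal u x = L0_class M u \<odot> x"

lemma scal_closed [simp, intro]:
  "u \<in> borel_measurable M \<Longrightarrow> x \<in> carrier E \<Longrightarrow> scal u x \<in> carrier E"
  by (simp add: scal_def)

lemma scal_cong: "AE w in M. u w = v w \<Longrightarrow> scal u x = scal v x"
  unfolding scal_def by (simp cong: L0_class_cong)

lemma scal_add_left:
  assumes "u \<in> borel_measurable M" "v \<in> borel_measurable M" "x \<in> carrier E"
  shows "scal (\<lambda>w. u w + v w) x = scal u x \<oplus> scal v x"
  using assms by (simp add: scal_def L0_class_add[symmetric] smult_l_distr)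

lemma scal_add_right:
  assumes "u \<in> borel_measurable M" "x \<in> carrier E" "y \<in> carrier E"
  shows "scal u (x \<oplus> y) = scal u x \<oplus> scal u y"
  using assms by (simp add: scal_def smult_r_distr)

lemma scal_scal:
  assumes "u \<in> borel_measurable M" "v \<in> borel_measurable M" "x \<in> carrier E"
  shows "scal u (scal v x) = scal (\<lambda>w. u w * v w) x"
  using assms by (simp add: scal_def L0_class_mult[symmetric] smult_assoc1)

lemma scal_one [simp]: "x \<in> carrier E \<Longrightarrow> scal (\<lambda>_. 1) x = x"
  by (simp add: scal_def L0_one[symmetric])

lemma scal_null [simp]: "x \<in> carrier E \<Longrightarrow> scal (\<lambda>_. 0) x = \<zero>"
  by (simp add: scal_def L0_zero[symmetric])

lemma scal_zero [simp]: "u \<in> borel_measurable M \<Longrightarrow> scal u \<zero> = \<zero>"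
  by (simp add: scal_def)

lemma scal_uminus_left:
  assumes [measurable]: "u \<in> borel_measurable M" and x: "x \<in> carrier E"
  shows "scal (\<lambda>w. - u w) x = \<ominus> scal u x"
proof -
  have "scal (\<lambda>w. - u w) x \<oplus> scal u x = \<zero>"
    using x by (subst scal_add_left[symmetric]) simp_all
  then show ?thesis using x by (intro M.minus_equality[symmetric]) auto
qed

lemma scal_minus_one [simp]: "x \<in> carrier E \<Longrightarrow> scal (\<lambda>_. - 1) x = \<ominus> x"
  using scal_uminus_left[of "\<lambda>_. 1" x] by simp

lemma uminus_zero [simp]: "\<ominus> \<zero> = \<zero>"
  by (rule M.minus_equality) simp_all

lemma scal_uminus_right:
  assumes "u \<in> borel_measurable M" "x \<in> carrier E"
  shows "scal u (\<ominus> x) = \<ominus> scal u x"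
  using assms by (simp add: scal_def smult_r_minus)

lemma scal_diff_right:
  assumes "u \<in> borel_measurable M" "x \<in> carrier E" "y \<in> carrier E"
  shows "scal u (x \<ominus> y) = scal u x \<ominus> scal u y"
  using assms by (simp add: a_minus_def scal_add_right scal_uminus_right)

text \<open>Values are functions, and all relations hold a.e. Homogeneity is demanded as an
  inequality only, which is easier to verify for infima; \<open>sublin_scal\<close> recovers
  equality.\<close>

definition sublin :: "('e \<Rightarrow> 'a \<Rightarrow> real) \<Rightarrow> bool" where
  "sublin q \<longleftrightarrow>
     (\<forall>x\<in>carrier E. q x \<in> borel_measurable M) \<and>
     (\<forall>x\<in>carrier E. \<forall>y\<in>carrier E. AE w in M. q (x \<oplus> y) w \<le> q x w + q y w) \<and>
     (\<forall>x\<in>carrier E. \<forall>u\<in>borel_measurable M. (\<forall>w. 0 \<le> u w) \<longrightarrow>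
        (AE w in M. q (scal u x) w \<le> u w * q x w))"

lemma sublinI:
  assumes "\<And>x. x \<in> carrier E \<Longrightarrow> q x \<in> borel_measurable M"
    and "\<And>x y. x \<in> carrier E \<Longrightarrow> y \<in> carrier E \<Longrightarrow> AE w in M. q (x \<oplus> y) w \<le> q x w + q y w"
    and "\<And>x u. x \<in> carrier E \<Longrightarrow> u \<in> borel_measurable M \<Longrightarrow> (\<And>w. 0 \<le> u w) \<Longrightarrow>
      AE w in M. q (scal u x) w \<le> u w * q x w"
  shows "sublin q"
  using assms unfolding sublin_def by blast

lemma sublin_measurable: "sublin q \<Longrightarrow> x \<in> carrier E \<Longrightarrow> q x \<in> borel_measurable M"
  unfolding sublin_def by blast

lemma sublin_add:
  "sublin q \<Longrightarrow> x \<in> carrier E \<Longrightarrow> y \<in> carrier E \<Longrightarrow> AE w in M. q (x \<oplus> y) w \<le> q x w + q y w"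
  unfolding sublin_def by blast

lemma sublin_scal_le:
  "sublin q \<Longrightarrow> x \<in> carrier E \<Longrightarrow> u \<in> borel_measurable M \<Longrightarrow> (\<And>w. 0 \<le> u w) \<Longrightarrow>
    AE w in M. q (scal u x) w \<le> u w * q x w"
  unfolding sublin_def by blast

lemma sublin_zero:
  assumes "sublin q"
  shows "AE w in M. q \<zero> w = 0"
proof -
  have "AE w in M. q (scal (\<lambda>_. 0) \<zero>) w \<le> 0 * q \<zero> w"
    by (rule sublin_scal_le[OF assms]) auto
  moreover have "AE w in M. q (\<zero> \<oplus> \<zero>) w \<le> q \<zero> w + q \<zero> w"
    by (rule sublin_add[OF assms]) auto
  ultimately show ?thesis by eventually_elim simp
qed

lemma sublin_uminus:
  assumes "sublin q" "x \<in> carrier E"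
  shows "AE w in M. - q (\<ominus> x) w \<le> q x w"
proof -
  have "AE w in M. q \<zero> w \<le> q x w + q (\<ominus> x) w"
    using sublin_add[OF assms(1), of x "\<ominus> x"] assms(2) by (simp add: M.r_neg)
  with sublin_zero[OF assms(1)] show ?thesis by eventually_elim simp
qed

text \<open>The part of x outside A contributes at most 0 on A and at most q x off A, so splitting x
  yields the missing lower bound in both places.\<close>

lemma sublin_ind:
  assumes q: "sublin q" and x: "x \<in> carrier E" and [measurable]: "A \<in> events"
  shows "AE w in M. q (scal (indicator A) x) w = indicator A w * q x w"
proof -
  have "scal (indicator A) x \<oplus> scal (indicator (space M - A)) x
      = scal (\<lambda>w. indicator A w + indicator (space M - A) w) x"
    using x by (subst scal_add_left) auto
  also have "\<dots> = scal (\<lambda>_. 1) x"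
    by (rule scal_cong) (use AE_space in eventually_elim, auto simp: indicator_def)
  finally have "AE w in M. q x w \<le> q (scal (indicator A) x) w + q (scal (indicator (space M - A)) x) w"
    using x sublin_add[OF q, of "scal (indicator A) x" "scal (indicator (space M - A)) x"] by simp
  moreover have "AE w in M. q (scal (indicator A) x) w \<le> indicator A w * q x w"
    "AE w in M. q (scal (indicator (space M - A)) x) w \<le> indicator (space M - A) w * q x w"
    using x by (auto intro!: sublin_scal_le[OF q])
  ultimately show ?thesis using AE_space
    by eventually_elim (auto simp: indicator_def split: if_splits)
qed

text \<open>Multiplication by the pointwise inverse of u turns the inequality around on {u > 0};
  where u = 0, \<open>sublin_ind\<close> gives the value 0.\<close>

lemma sublin_scal:
  assumes q: "sublin q" and x: "x \<in> carrier E" and [measurable]: "u \<in> borel_measurable M"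
    and u: "\<And>w. 0 \<le> u w"
  shows "AE w in M. q (scal u x) w = u w * q x w"
proof -
  define A where "A = {w \<in> space M. 0 < u w}"
  define v where "v w = (if 0 < u w then 1 / u w else 0)" for w
  have [measurable]: "A \<in> events" "v \<in> borel_measurable M" by (simp_all add: A_def v_def[abs_def])
  have "scal v (scal u x) = scal (indicator A) x"
    using x by (subst scal_scal) (auto simp: v_def A_def intro!: scal_cong AE_I2)
  moreover have "AE w in M. q (scal v (scal u x)) w \<le> v w * q (scal u x) w"
    using x by (intro sublin_scal_le[OF q]) (auto simp: v_def)
  ultimately have "AE w in M. q (scal (indicator A) x) w \<le> v w * q (scal u x) w" by simp
  moreover have "AE w in M. q (scal u x) w \<le> u w * q x w"
    by (rule sublin_scal_le) (use assms in auto)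
  moreover have "scal (indicator A) (scal u x) = scal u x"
    using x u by (subst scal_scal) (auto simp: A_def indicator_def less_le intro!: scal_cong AE_I2)
  then have "AE w in M. q (scal u x) w = indicator A w * q (scal u x) w"
    using sublin_ind[OF q, of "scal u x" A] x by simp
  moreover note sublin_ind[OF q x \<open>A \<in> events\<close>] AE_space
  ultimately show ?thesis
  proof eventually_elim
    case (elim w)
    show ?case
    proof (cases "0 < u w")
      case True
      with elim have "q x w \<le> q (scal u x) w / u w" by (simp add: A_def v_def)
      with True have "u w * q x w \<le> q (scal u x) w" by (simp add: field_simps)
      with elim(2) show ?thesis by simp
    next
      case False
      with u[of w] have "u w = 0" by simp
      with elim(3) show ?thesis by (simp add: A_def)
    qed
  qed
qed

text \<open>Infimal convolution of a sublinear map with the convex cone of constraints \<open>S z \<le> r\<close>.\<close>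

lemma sublin_constraints:
  assumes p: "sublin p" and C: "C \<subseteq> carrier E \<times> borel_measurable M"
    and C0: "(\<zero>, \<lambda>_. 0) \<in> C"
    and C_add: "\<And>z r z' r'. (z, r) \<in> C \<Longrightarrow> (z', r') \<in> C \<Longrightarrow>
      \<exists>s. (z \<oplus> z', s) \<in> C \<and> (AE w in M. s w \<le> r w + r' w)"
    and C_scal: "\<And>z r u. (z, r) \<in> C \<Longrightarrow> u \<in> borel_measurable M \<Longrightarrow> (\<And>w. 0 \<le> u w) \<Longrightarrow>
      \<exists>s. (scal u z, s) \<in> C \<and> (AE w in M. s w \<le> u w * r w)"
    and lower: "\<And>z r. (z, r) \<in> C \<Longrightarrow> AE w in M. 0 \<le> p (\<ominus> z) w + r w"
  obtains S where "sublin S" "\<And>x. x \<in> carrier E \<Longrightarrow> AE w in M. S x w \<le> p x w"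
    "\<And>z r. (z, r) \<in> C \<Longrightarrow> AE w in M. S z w \<le> r w"
proof -
  have mp [measurable]: "x \<in> carrier E \<Longrightarrow> p x \<in> borel_measurable M" for x
    using p by (rule sublin_measurable)
  have CE: "z \<in> carrier E" "r \<in> borel_measurable M" if "(z, r) \<in> C" for z r using C that by auto
  define F where "F x = (\<lambda>(z, r) w. p (x \<ominus> z) w + r w) ` C" for x
  define inf_F where "inf_F x s \<longleftrightarrow> s \<in> borel_measurable M \<and> (\<forall>f\<in>F x. AE w in M. s w \<le> f w) \<and>
      (\<forall>l\<in>borel_measurable M. (\<forall>f\<in>F x. AE w in M. l w \<le> f w) \<longrightarrow> (AE w in M. l w \<le> s w))" for x s
  have "\<forall>x\<in>carrier E. \<exists>s. inf_F x s"
  proof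
    fix x assume x: "x \<in> carrier E"
    have 1: "F x \<subseteq> borel_measurable M" using x CE by (auto simp: F_def)
    have 2: "F x \<noteq> {}" using C0 by (auto simp: F_def)
    have 3: "(\<lambda>w. - p (\<ominus> x) w) \<in> borel_measurable M" using x by simp
    \<comment> \<open>This keeps the infimum finite: -z = (x - z) + (-x), hence 0 \<le> p(-z) + r
      \<le> p(x - z) + p(-x) + r by \<open>lower\<close>.\<close>
    have 4: "AE w in M. - p (\<ominus> x) w \<le> f w" if f: "f \<in> F x" for f
    proof -
      obtain z r where zr: "(z, r) \<in> C" and f_def: "f = (\<lambda>w. p (x \<ominus> z) w + r w)"
        using f by (auto simp: F_def)
      have "\<ominus> z = (x \<ominus> z) \<oplus> \<ominus> x"
        using x CE[OF zr] by (simp add: a_minus_def M.a_ac M.r_neg2)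
      then have "AE w in M. p (\<ominus> z) w \<le> p (x \<ominus> z) w + p (\<ominus> x) w"
        using sublin_add[OF p, of "x \<ominus> z" "\<ominus> x"] x CE[OF zr] by simp
      with lower[OF zr] show ?thesis unfolding f_def by eventually_elim simp
    qed
    show "\<exists>s. inf_F x s"
      by (rule ess_INF_real[OF 1 2 3 4]) (auto simp: inf_F_def)
  qed
  then obtain S where "\<forall>x\<in>carrier E. inf_F x (S x)" by (rule bchoice[THEN exE])
  then have S: "\<And>x. x \<in> carrier E \<Longrightarrow> S x \<in> borel_measurable M"
    "\<And>x f. x \<in> carrier E \<Longrightarrow> f \<in> F x \<Longrightarrow> AE w in M. S x w \<le> f w"
    "\<And>x l. x \<in> carrier E \<Longrightarrow> l \<in> borel_measurable M \<Longrightarrow> (\<And>f. f \<in> F x \<Longrightarrow> AE w in M. l w \<le> f w) \<Longrightarrow>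
       AE w in M. l w \<le> S x w" by (auto simp: inf_F_def)
  note [measurable] = S(1)
  have S_le: "AE w in M. S x w \<le> p (x \<ominus> z) w + r w" if "x \<in> carrier E" "(z, r) \<in> C" for x z r
    using S(2)[OF that(1), of "\<lambda>w. p (x \<ominus> z) w + r w"] that(2) by (force simp: F_def)
  have S_ge: "AE w in M. l w \<le> S x w" if "x \<in> carrier E" "l \<in> borel_measurable M"
    "\<And>z r. (z, r) \<in> C \<Longrightarrow> AE w in M. l w \<le> p (x \<ominus> z) w + r w" for x l
    using that by (intro S(3)) (auto simp: F_def)
  have S_p: "AE w in M. S x w \<le> p x w" if "x \<in> carrier E" for x
    using S_le[OF that C0] that by (simp add: a_minus_def)
  show ?thesis
  proof (rule that)
    show "sublin S"
    proof (rule sublinI)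
      fix x y assume x: "x \<in> carrier E" and y: "y \<in> carrier E"
      \<comment> \<open>The infimum over pairs of constraints is taken in one variable at a time:
        first over (z, r) with (z', r') fixed, then over (z', r').\<close>
      have "AE w in M. S (x \<oplus> y) w - (p (y \<ominus> z') w + r' w) \<le> S x w"
        if c': "(z', r') \<in> C" for z' r'
      proof (rule S_ge[OF x])
        show "(\<lambda>w. S (x \<oplus> y) w - (p (y \<ominus> z') w + r' w)) \<in> borel_measurable M"
          using x y CE[OF c'] by simp
        fix z r assume c: "(z, r) \<in> C"
        obtain s where s: "(z \<oplus> z', s) \<in> C" "AE w in M. s w \<le> r w + r' w"
          using C_add[OF c c'] by blast
        have "AE w in M. S (x \<oplus> y) w \<le> p ((x \<oplus> y) \<ominus> (z \<oplus> z')) w + s w"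
          using s x y by (intro S_le) auto
        moreover have "(x \<oplus> y) \<ominus> (z \<oplus> z') = (x \<ominus> z) \<oplus> (y \<ominus> z')"
          using x y CE(1)[OF c] CE(1)[OF c'] by (simp add: a_minus_def M.minus_add M.a_ac)
        moreover have "AE w in M. p ((x \<ominus> z) \<oplus> (y \<ominus> z')) w \<le> p (x \<ominus> z) w + p (y \<ominus> z') w"
          using x y CE(1)[OF c] CE(1)[OF c'] by (intro sublin_add[OF p]) auto
        ultimately have "AE w in M. S (x \<oplus> y) w \<le> p ((x \<ominus> z) \<oplus> (y \<ominus> z')) w + s w"
          "AE w in M. p ((x \<ominus> z) \<oplus> (y \<ominus> z')) w \<le> p (x \<ominus> z) w + p (y \<ominus> z') w"
          by simp_all
        with s(2) show "AE w in M. S (x \<oplus> y) w - (p (y \<ominus> z') w + r' w) \<le> p (x \<ominus> z) w + r w"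
          by eventually_elim simp
      qed
      then have "AE w in M. S (x \<oplus> y) w - S x w \<le> S y w"
        using x y
      proof (intro S_ge)
        fix z r assume *: "(z, r) \<in> C"
          and "\<And>z' r'. (z', r') \<in> C \<Longrightarrow> AE w in M. S (x \<oplus> y) w - (p (y \<ominus> z') w + r' w) \<le> S x w"
        from this(2)[OF *] show "AE w in M. S (x \<oplus> y) w - S x w \<le> p (y \<ominus> z) w + r w"
          by eventually_elim simp
      qed auto
      then show "AE w in M. S (x \<oplus> y) w \<le> S x w + S y w" by eventually_elim simp
    next
      fix x and u :: "'a \<Rightarrow> real"
      assume x: "x \<in> carrier E" and [measurable]: "u \<in> borel_measurable M" and u: "\<And>w::'a. 0 \<le> u w"
      have le: "AE w in M. S (scal u x) w \<le> u w * (p (x \<ominus> z) w + r w)" if c: "(z, r) \<in> C" for z r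
      proof -
        obtain s where s: "(scal u z, s) \<in> C" "AE w in M. s w \<le> u w * r w"
          using C_scal[OF c, of u] u by auto
        have "AE w in M. S (scal u x) w \<le> p (scal u x \<ominus> scal u z) w + s w"
          using s x by (intro S_le) auto
        moreover have "AE w in M. p (scal u (x \<ominus> z)) w \<le> u w * p (x \<ominus> z) w"
          using x CE[OF c] u by (intro sublin_scal_le[OF p]) auto
        moreover have "scal u (x \<ominus> z) = scal u x \<ominus> scal u z"
          using x CE[OF c] by (simp add: scal_diff_right)
        ultimately have "AE w in M. S (scal u x) w \<le> p (scal u (x \<ominus> z)) w + s w"
          "AE w in M. p (scal u (x \<ominus> z)) w \<le> u w * p (x \<ominus> z) w" by simp_all
        with s(2) show ?thesis by eventually_elim (simp add: algebra_simps)
      qed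
      \<comment> \<open>A competing lower bound has to be defined everywhere, but division by u
        works only on {u > 0}; elsewhere S x is inserted. Where u = 0 the claim is S(u x) \<le> 0,
        which comes from the zero constraint.\<close>
      have "AE w in M. (if 0 < u w then S (scal u x) w / u w else S x w) \<le> S x w"
      proof (rule S_ge[OF x])
        fix z r assume c: "(z, r) \<in> C"
        show "AE w in M. (if 0 < u w then S (scal u x) w / u w else S x w) \<le> p (x \<ominus> z) w + r w"
          using le[OF c] S_le[OF x c] by eventually_elim (auto simp: field_simps)
      qed (use x in simp)
      moreover have "AE w in M. S (scal u x) w \<le> u w * p x w"
        using le[OF C0] x by (simp add: a_minus_def)
      ultimately show "AE w in M. S (scal u x) w \<le> u w * S x w"
      proof eventually_elim
        case (elim w)
        show ?case
        proof (cases "0 < u w")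
          case True
          with elim show ?thesis by (simp add: field_simps)
        next
          case False
          with u[of w] elim show ?thesis by simp
        qed
      qed
    qed (rule S(1))
    show "\<And>x. x \<in> carrier E \<Longrightarrow> AE w in M. S x w \<le> p x w" by (rule S_p)
    fix z r assume c: "(z, r) \<in> C"
    then have "AE w in M. S z w \<le> p \<zero> w + r w"
      using S_le[OF CE(1)[OF c] c] CE(1)[OF c] by (simp add: a_minus_def M.r_neg)
    with sublin_zero[OF p] show "AE w in M. S z w \<le> r w" by eventually_elim simp
  qed
qed

text \<open>A minimal sublinear map is odd, hence linear: adding the constraint \<open>S (- y) \<le> - q y\<close> to a
  minimal \<open>q\<close> does not change \<open>q\<close>. Minimality is formulated for the maps with values in the
  representatives chosen by \<^const>\<open>rep\<close>, for which the a.e. order is antisymmetric.\<close>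

definition canonical :: "('e \<Rightarrow> 'a \<Rightarrow> real) \<Rightarrow> 'e \<Rightarrow> 'a \<Rightarrow> real" where
  "canonical q x = (if x \<in> carrier E then rep (L0_class M (q x)) else undefined)"

lemma canonical_AE:
  assumes "q x \<in> borel_measurable M" "x \<in> carrier E"
  shows "AE w in M. canonical q x w = q x w"
  using assms rep_L0_class(2)[of "q x" M] by (simp add: canonical_def)

lemma canonical_eqI:
  assumes "\<And>x. x \<in> carrier E \<Longrightarrow> AE w in M. q x w = q' x w"
  shows "canonical q = canonical q'"
proof
  fix x show "canonical q x = canonical q' x"
    using L0_class_cong[OF assms[of x]] by (simp add: canonical_def)
qed

lemma canonical_canonical:
  assumes "\<And>x. x \<in> carrier E \<Longrightarrow> q x \<in> borel_measurable M"
  shows "canonical (canonical q) = canonical q"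
  using assms canonical_AE by (intro canonical_eqI) auto

lemma sublin_cong:
  assumes q: "sublin q" and m: "\<And>x. x \<in> carrier E \<Longrightarrow> q' x \<in> borel_measurable M"
    and eq: "\<And>x. x \<in> carrier E \<Longrightarrow> AE w in M. q' x w = q x w"
  shows "sublin q'"
proof (rule sublinI)
  fix x y assume "x \<in> carrier E" "y \<in> carrier E"
  then have "AE w in M. q' x w = q x w" "AE w in M. q' y w = q y w"
    "AE w in M. q' (x \<oplus> y) w = q (x \<oplus> y) w" "AE w in M. q (x \<oplus> y) w \<le> q x w + q y w"
    using eq sublin_add[OF q] by auto
  then show "AE w in M. q' (x \<oplus> y) w \<le> q' x w + q' y w" by eventually_elim simp
next
  fix x and u :: "'a \<Rightarrow> real"
  assume x: "x \<in> carrier E" and u: "u \<in> borel_measurable M" "\<And>w. 0 \<le> u w"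
  have "AE w in M. q' (scal u x) w = q (scal u x) w" "AE w in M. q' x w = q x w"
    using x u eq by auto
  with sublin_scal_le[OF q x u] show "AE w in M. q' (scal u x) w \<le> u w * q' x w"
    by eventually_elim simp
qed (rule m)

lemma canonical_measurable:
  "q x \<in> borel_measurable M \<Longrightarrow> x \<in> carrier E \<Longrightarrow> canonical q x \<in> borel_measurable M"
  by (simp add: canonical_def rep_L0_class(1))

lemma sublin_canonical: "sublin q \<Longrightarrow> sublin (canonical q)"
  by (rule sublin_cong) (auto intro: canonical_measurable canonical_AE sublin_measurable)

text \<open>Provides lower bounds of chains for Zorn's lemma. A chain may be uncountable and its
  pointwise infimum not measurable, so the essential infimum is taken; it is real because q x \<ge>
  -q(-x) \<ge> -p(-x). For subadditivity, two members of the chain are replaced by the smaller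
  one.\<close>

lemma sublin_chain_inf:
  assumes sub: "\<And>q. q \<in> Q \<Longrightarrow> sublin q" and ne: "Q \<noteq> {}"
    and p: "sublin p" and le_p: "\<And>q x. q \<in> Q \<Longrightarrow> x \<in> carrier E \<Longrightarrow> AE w in M. q x w \<le> p x w"
    and chain: "\<And>q q'. q \<in> Q \<Longrightarrow> q' \<in> Q \<Longrightarrow>
      (\<forall>x\<in>carrier E. AE w in M. q x w \<le> q' x w) \<or> (\<forall>x\<in>carrier E. AE w in M. q' x w \<le> q x w)"
  obtains S where "sublin S" "\<And>q x. q \<in> Q \<Longrightarrow> x \<in> carrier E \<Longrightarrow> AE w in M. S x w \<le> q x w"
proof -
  have meas [measurable]: "q x \<in> borel_measurable M" if "q \<in> Q" "x \<in> carrier E" for q x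
    using sub that by (auto intro: sublin_measurable)
  define inf_Q where "inf_Q x s \<longleftrightarrow> s \<in> borel_measurable M \<and> (\<forall>f\<in>(\<lambda>q. q x) ` Q. AE w in M. s w \<le> f w) \<and>
      (\<forall>l\<in>borel_measurable M. (\<forall>f\<in>(\<lambda>q. q x) ` Q. AE w in M. l w \<le> f w) \<longrightarrow> (AE w in M. l w \<le> s w))" for x s
  have "\<forall>x\<in>carrier E. \<exists>s. inf_Q x s"
  proof
    fix x assume x: "x \<in> carrier E"
    have 1: "(\<lambda>q. q x) ` Q \<subseteq> borel_measurable M" "(\<lambda>q. q x) ` Q \<noteq> {}" using x ne meas by auto
    have 2: "(\<lambda>w. - p (\<ominus> x) w) \<in> borel_measurable M" using x p by (auto intro: sublin_measurable)
    have 3: "AE w in M. - p (\<ominus> x) w \<le> f w" if f: "f \<in> (\<lambda>q. q x) ` Q" for f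
    proof -
      obtain q where q: "q \<in> Q" "f = q x" using f by auto
      have "AE w in M. q (\<ominus> x) w \<le> p (\<ominus> x) w" using q x by (intro le_p) auto
      with sublin_uminus[OF sub[OF q(1)] x] show ?thesis unfolding q by eventually_elim simp
    qed
    show "\<exists>s. inf_Q x s"
    proof (rule ess_INF_real[OF 1 2 3])
      fix s assume "s \<in> borel_measurable M" "\<And>f. f \<in> (\<lambda>q. q x) ` Q \<Longrightarrow> AE w in M. s w \<le> f w"
        and "\<And>l. l \<in> borel_measurable M \<Longrightarrow> (\<And>f. f \<in> (\<lambda>q. q x) ` Q \<Longrightarrow> AE w in M. l w \<le> f w) \<Longrightarrow>
          AE w in M. l w \<le> s w"
      then have "inf_Q x s" unfolding inf_Q_def by (intro conjI ballI impI; blast)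
      then show ?thesis by blast
    qed simp
  qed
  then obtain S where "\<forall>x\<in>carrier E. inf_Q x (S x)" by (rule bchoice[THEN exE])
  then have S [measurable]: "\<And>x. x \<in> carrier E \<Longrightarrow> S x \<in> borel_measurable M"
    and S_le: "\<And>x q. x \<in> carrier E \<Longrightarrow> q \<in> Q \<Longrightarrow> AE w in M. S x w \<le> q x w"
    and S_ge: "\<And>x l. x \<in> carrier E \<Longrightarrow> l \<in> borel_measurable M \<Longrightarrow>
      (\<And>q. q \<in> Q \<Longrightarrow> AE w in M. l w \<le> q x w) \<Longrightarrow> AE w in M. l w \<le> S x w"
    by (auto simp: inf_Q_def)
  show ?thesis
  proof (rule that)
    show "sublin S"
    proof (rule sublinI)
      fix x y assume x: "x \<in> carrier E" and y: "y \<in> carrier E"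
      have *: "AE w in M. S (x \<oplus> y) w \<le> q x w + q' y w" if q: "q \<in> Q" "q' \<in> Q" for q q'
      proof -
        obtain r where r: "r \<in> Q" "\<forall>x\<in>carrier E. AE w in M. r x w \<le> q x w"
          "\<forall>x\<in>carrier E. AE w in M. r x w \<le> q' x w"
          using chain[OF q] q by (meson AE_I2 order_refl)
        have "AE w in M. S (x \<oplus> y) w \<le> r (x \<oplus> y) w"
          "AE w in M. r x w \<le> q x w" "AE w in M. r y w \<le> q' y w"
          using x y r S_le by auto
        with sublin_add[OF sub[OF r(1)] x y] show ?thesis by eventually_elim simp
      qed
      have "AE w in M. S (x \<oplus> y) w - q' y w \<le> S x w" if q': "q' \<in> Q" for q'
      proof (rule S_ge[OF x])
        fix q assume "q \<in> Q"
        from *[OF this q'] show "AE w in M. S (x \<oplus> y) w - q' y w \<le> q x w"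
          by eventually_elim simp
      qed (use x y q' in simp)
      then have **: "AE w in M. S (x \<oplus> y) w - S x w \<le> q y w" if "q \<in> Q" for q
        using that by (force elim: eventually_mono)
      have "AE w in M. S (x \<oplus> y) w - S x w \<le> S y w"
        using x y by (intro S_ge **) auto
      then show "AE w in M. S (x \<oplus> y) w \<le> S x w + S y w" by eventually_elim simp
    next
      fix x and u :: "'a \<Rightarrow> real"
      assume x: "x \<in> carrier E" and [measurable]: "u \<in> borel_measurable M" and u: "\<And>w::'a. 0 \<le> u w"
      have le: "AE w in M. S (scal u x) w \<le> u w * q x w" if q: "q \<in> Q" for q
      proof -
        have "AE w in M. S (scal u x) w \<le> q (scal u x) w" using x q by (intro S_le) auto
        moreover have "AE w in M. q (scal u x) w \<le> u w * q x w"
          using x u by (intro sublin_scal_le[OF sub[OF q]]) auto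
        ultimately show ?thesis by eventually_elim simp
      qed
      obtain q0 where q0: "q0 \<in> Q" using ne by blast
      have "AE w in M. (if 0 < u w then S (scal u x) w / u w else S x w) \<le> S x w"
      proof (rule S_ge[OF x])
        fix q assume q: "q \<in> Q"
        show "AE w in M. (if 0 < u w then S (scal u x) w / u w else S x w) \<le> q x w"
          using le[OF q] S_le[OF x q] by eventually_elim (auto simp: field_simps)
      qed (use x in simp)
      with le[OF q0] show "AE w in M. S (scal u x) w \<le> u w * S x w"
      proof eventually_elim
        case (elim w)
        show ?case
        proof (cases "0 < u w")
          case True
          with elim show ?thesis by (simp add: field_simps)
        next
          case False
          with u[of w] elim show ?thesis by simp
        qed
      qed
    qed (rule S)
    show "\<And>q x. q \<in> Q \<Longrightarrow> x \<in> carrier E \<Longrightarrow> AE w in M. S x w \<le> q x w" using S_le by blast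
  qed
qed

section \<open>Linear maps and the Hahn-Banach theorem\<close>

definition linear_fun :: "('e \<Rightarrow> 'a \<Rightarrow> real) \<Rightarrow> bool" where
  "linear_fun L \<longleftrightarrow>
     (\<forall>x\<in>carrier E. L x \<in> borel_measurable M) \<and>
     (\<forall>x\<in>carrier E. \<forall>y\<in>carrier E. AE w in M. L (x \<oplus> y) w = L x w + L y w) \<and>
     (\<forall>x\<in>carrier E. \<forall>u\<in>borel_measurable M. AE w in M. L (scal u x) w = u w * L x w)"

text \<open>Oddness reverses every subadditivity bound: q x \<le> q(x + y) + q(-y) \<le> q(x + y) -
  q y. A scalar of varying sign is split into its positive and negative parts, to which
  \<open>sublin_scal\<close> applies.\<close>

lemma linear_fun_of_odd_sublin:
  assumes q: "sublin q" and odd: "\<And>x. x \<in> carrier E \<Longrightarrow> AE w in M. q (\<ominus> x) w \<le> - q x w"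
  shows "linear_fun q"
  unfolding linear_fun_def
proof (intro conjI ballI)
  fix x y assume x: "x \<in> carrier E" and y: "y \<in> carrier E"
  have "(x \<oplus> y) \<oplus> \<ominus> y = x" using x y by (simp add: M.a_assoc M.r_neg)
  then have "AE w in M. q x w \<le> q (x \<oplus> y) w + q (\<ominus> y) w"
    using sublin_add[OF q, of "x \<oplus> y" "\<ominus> y"] x y by simp
  with odd[OF y] sublin_add[OF q x y] show "AE w in M. q (x \<oplus> y) w = q x w + q y w"
    by eventually_elim simp
next
  fix x and u :: "'a \<Rightarrow> real"
      assume x: "x \<in> carrier E" and [measurable]: "u \<in> borel_measurable M"
  have odd': "AE w in M. q (\<ominus> z) w = - q z w" if "z \<in> carrier E" for z
    using odd[OF that] sublin_uminus[OF q that] by eventually_elim simp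
  define a b where "a w = max (u w) 0" and "b w = max (- u w) 0" for w
  have [measurable]: "a \<in> borel_measurable M" "b \<in> borel_measurable M"
    by (simp_all add: a_def[abs_def] b_def[abs_def])
  have "scal u x = scal (\<lambda>w. a w + - b w) x"
    by (rule scal_cong) (auto simp: a_def b_def)
  also have "\<dots> = scal a x \<oplus> \<ominus> scal b x"
    using x by (subst scal_add_left) (simp_all add: scal_uminus_left)
  finally have eq: "scal u x = scal a x \<oplus> \<ominus> scal b x" .
  have neg: "\<ominus> scal u x = scal b x \<oplus> \<ominus> scal a x"
    unfolding eq using x by (simp add: M.minus_add M.a_comm)
  have "AE w in M. q (scal u x) w \<le> q (scal a x) w + q (\<ominus> scal b x) w"
    unfolding eq using x by (intro sublin_add[OF q]) auto
  moreover have "AE w in M. q (\<ominus> scal u x) w \<le> q (scal b x) w + q (\<ominus> scal a x) w"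
    unfolding neg using x by (intro sublin_add[OF q]) auto
  moreover have "AE w in M. q (scal a x) w = a w * q x w" "AE w in M. q (scal b x) w = b w * q x w"
    by (rule sublin_scal[OF q x]; simp add: a_def b_def)+
  moreover have "AE w in M. q (\<ominus> scal a x) w = - q (scal a x) w"
    "AE w in M. q (\<ominus> scal b x) w = - q (scal b x) w" "AE w in M. q (\<ominus> scal u x) w = - q (scal u x) w"
    using x by (auto intro!: odd')
  ultimately show "AE w in M. q (scal u x) w = u w * q x w"
  proof eventually_elim
    case (elim w)
    have u_eq: "u w = a w - b w" by (simp add: a_def b_def)
    from elim have "q (scal u x) w = a w * q x w - b w * q x w" by linarith
    then show ?case by (simp add: u_eq algebra_simps)
  qed
qed (use q in \<open>auto intro: sublin_measurable\<close>)

text \<open>\<open>L0 M\<close> is not a field: u x may lie in a submodule for some nonzero u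
  although x does not, so extending a partial functional by one element is delicate. Minimal
  dominated sublinear maps are defined on all of E from the start.\<close>

theorem Hahn_Banach:
  assumes p: "sublin p"
  obtains L where "linear_fun L" "\<And>x. x \<in> carrier E \<Longrightarrow> AE w in M. L x w \<le> p x w"
proof -
  define le :: "('e \<Rightarrow> 'a \<Rightarrow> real) \<Rightarrow> ('e \<Rightarrow> 'a \<Rightarrow> real) \<Rightarrow> bool"
    where "le q q' \<longleftrightarrow> (\<forall>x\<in>carrier E. AE w in M. q x w \<le> q' x w)" for q q'
  define A where "A = {q. sublin q \<and> le q p \<and> canonical q = q}"
  have le_refl: "le q q" for q by (simp add: le_def)
  have le_trans: "le q r" if "le q q'" "le q' r" for q q' r
    unfolding le_def
  proof
    fix x assume "x \<in> carrier E"
    with that have "AE w in M. q x w \<le> q' x w" "AE w in M. q' x w \<le> r x w" by (auto simp: le_def)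
    then show "AE w in M. q x w \<le> r x w" by eventually_elim simp
  qed
  have canon_le: "le (canonical q) r" if "sublin q" "le q r" for q r
    unfolding le_def
  proof
    fix x assume x: "x \<in> carrier E"
    have "AE w in M. q x w \<le> r x w" using that x by (auto simp: le_def)
    with canonical_AE[of q x, OF sublin_measurable[OF that(1) x] x]
    show "AE w in M. canonical q x w \<le> r x w" by eventually_elim simp
  qed
  have canon_A: "canonical q \<in> A" if "sublin q" "le q p" for q
    using that canon_le[OF that] unfolding A_def
    by (auto intro: sublin_canonical canonical_canonical sublin_measurable)
  have antisym: "q = q'" if "q \<in> A" "q' \<in> A" "le q q'" "le q' q" for q q'
  proof -
    have "canonical q = canonical q'"
    proof (rule canonical_eqI)
      fix x assume "x \<in> carrier E"
      with that have "AE w in M. q x w \<le> q' x w" "AE w in M. q' x w \<le> q x w" by (auto simp: le_def)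
      then show "AE w in M. q x w = q' x w" by eventually_elim simp
    qed
    then show ?thesis using that by (simp add: A_def)
  qed
  \<comment> \<open>The order is reversed because Zorn's lemma yields maximal elements. The empty
    chain is bounded by \<open>canonical p\<close>.\<close>
  have "\<exists>q\<in>A. \<forall>q'\<in>A. le q' q \<longrightarrow> q' = q"
  proof (rule predicate_Zorn[where P = "\<lambda>q q'. le q' q"])
    show "partial_order_on A (relation_of (\<lambda>q q'. le q' q) A)"
      by (rule partial_order_on_relation_ofI) (auto intro: le_refl le_trans antisym)
    fix Q assume Q: "Q \<in> Chains (relation_of (\<lambda>q q'. le q' q) A)"
    show "\<exists>u\<in>A. \<forall>q\<in>Q. le u q"
    proof (cases "Q = {}")
      case True
      then show ?thesis using canon_A[OF p le_refl] by auto
    next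
      case False
      have QA: "Q \<subseteq> A" using Q by (auto simp: Chains_def relation_of_def)
      obtain S where S: "sublin S" "\<And>q x. q \<in> Q \<Longrightarrow> x \<in> carrier E \<Longrightarrow> AE w in M. S x w \<le> q x w"
      proof (rule sublin_chain_inf[OF _ False p])
        fix q q' assume "q \<in> Q" "q' \<in> Q"
        then show "(\<forall>x\<in>carrier E. AE w in M. q x w \<le> q' x w) \<or> (\<forall>x\<in>carrier E. AE w in M. q' x w \<le> q x w)"
          using Q by (auto simp: Chains_def relation_of_def le_def)
      qed (use QA in \<open>auto simp: A_def le_def\<close>)
      then have "le S q" if "q \<in> Q" for q using that by (auto simp: le_def)
      moreover have "le S p"
        using False QA \<open>\<And>q. q \<in> Q \<Longrightarrow> le S q\<close> le_trans by (fastforce simp: A_def)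
      ultimately show ?thesis using S(1) canon_A canon_le by blast
    qed
  qed
  then obtain q where qA: "q \<in> A" and min: "\<And>q'. q' \<in> A \<Longrightarrow> le q' q \<Longrightarrow> q' = q" by blast
  have q: "sublin q" "le q p" using qA by (auto simp: A_def)
  note [measurable] = sublin_measurable[OF q(1)]
  have "AE w in M. q (\<ominus> y) w \<le> - q y w" if y: "y \<in> carrier E" for y
  proof -
    \<comment> \<open>The constraint S(-y) \<le> -q y together with its multiples by t \<ge> 0, so
      as to obtain a convex cone. It is compatible with q because q(t y) = t q y.\<close>
    define C where "C = {(\<ominus> scal t y, \<lambda>w. - (t w * q y w)) |t. t \<in> borel_measurable M \<and> (\<forall>w. 0 \<le> t w)}"
    have CI: "(\<ominus> scal t y, \<lambda>w. - (t w * q y w)) \<in> C" if "t \<in> borel_measurable M" "\<And>w. 0 \<le> t w" for t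
      using that by (auto simp: C_def)
    obtain S where S: "sublin S" "\<And>x. x \<in> carrier E \<Longrightarrow> AE w in M. S x w \<le> q x w"
      "\<And>z r. (z, r) \<in> C \<Longrightarrow> AE w in M. S z w \<le> r w"
    proof (rule sublin_constraints[OF q(1)])
      show "C \<subseteq> carrier E \<times> borel_measurable M" using y by (auto simp: C_def)
      show "(\<zero>, \<lambda>_. 0) \<in> C" using CI[of "\<lambda>_. 0"] y by simp
    next
      fix z r z' r' assume "(z, r) \<in> C" "(z', r') \<in> C"
      then obtain t t' where t: "t \<in> borel_measurable M" "\<And>w. 0 \<le> t w" "z = \<ominus> scal t y" "r = (\<lambda>w. - (t w * q y w))"
        "t' \<in> borel_measurable M" "\<And>w. 0 \<le> t' w" "z' = \<ominus> scal t' y" "r' = (\<lambda>w. - (t' w * q y w))"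
        by (auto simp: C_def)
      have "z \<oplus> z' = \<ominus> scal (\<lambda>w. t w + t' w) y"
        using y t by (simp add: scal_add_left M.minus_add)
      with CI[of "\<lambda>w. t w + t' w"] t
      show "\<exists>s. (z \<oplus> z', s) \<in> C \<and> (AE w in M. s w \<le> r w + r' w)"
        by (auto intro!: exI[of _ "\<lambda>w. - ((t w + t' w) * q y w)"] simp: algebra_simps)
    next
      fix z r and u :: "'a \<Rightarrow> real" assume "(z, r) \<in> C" and u: "u \<in> borel_measurable M" "\<And>w::'a. 0 \<le> u w"
      then obtain t where t: "t \<in> borel_measurable M" "\<And>w. 0 \<le> t w" "z = \<ominus> scal t y" "r = (\<lambda>w. - (t w * q y w))"
        by (auto simp: C_def)
      have "scal u z = \<ominus> scal (\<lambda>w. u w * t w) y"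
        using y t u by (simp add: scal_uminus_right scal_scal)
      with CI[of "\<lambda>w. u w * t w"] t u
      show "\<exists>s. (scal u z, s) \<in> C \<and> (AE w in M. s w \<le> u w * r w)"
        by (auto intro!: exI[of _ "\<lambda>w. - (u w * t w * q y w)"])
    next
      fix z r assume "(z, r) \<in> C"
      then obtain t where t: "t \<in> borel_measurable M" "\<And>w. 0 \<le> t w" "z = \<ominus> scal t y" "r = (\<lambda>w. - (t w * q y w))"
        by (auto simp: C_def)
      show "AE w in M. 0 \<le> q (\<ominus> z) w + r w"
        using sublin_scal[OF q(1) y t(1,2)] t(1) y unfolding t(3,4)
        by (auto elim: eventually_mono)
    qed (rule that)
    have "le S q" using S by (simp add: le_def)
    then have "canonical S = q" using S(1) q(2) by (intro min canon_A canon_le) (auto intro: le_trans)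
    then have "AE w in M. q (\<ominus> y) w = S (\<ominus> y) w"
      using canonical_AE[of S "\<ominus> y"] sublin_measurable[OF S(1)] y by auto
    moreover have "AE w in M. S (\<ominus> y) w \<le> - q y w"
      using S(3)[OF CI[of "\<lambda>_. 1"]] y by simp
    ultimately show ?thesis by eventually_elim simp
  qed
  then have "linear_fun q" by (rule linear_fun_of_odd_sublin[OF q(1)])
  with q(2) show ?thesis using that by (auto simp: le_def)
qed

end


section \<open>Seminorms and the \<open>(\<epsilon>,\<lambda>)\<close>-topology\<close>

context prob_space
begin

lemma not_AE_False: "\<not> (AE w in M. False)"
  using AE_prob_1[of "{}"] prob_space by (auto simp: AE_False)

text \<open>The supremum of the empty family is -\<infinity> and not 0; therefore the condition at
  the null element forces the family of seminorms to be nonempty, as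
  \<open>seminorms_nonempty\<close> records.\<close>

lemma seminorm_sup_eq_zero_iff:
  assumes pos: "\<And>n. n \<in> P \<Longrightarrow> n x \<in> L0_pos M"
  shows "seminorm_sup M P x = L0_ereal M \<zero>\<^bsub>L0 M\<^esub> \<longleftrightarrow> P \<noteq> {} \<and> (\<forall>n\<in>P. n x = \<zero>\<^bsub>L0 M\<^esub>)"
proof -
  define A where "A = {L0_ereal M (n x) |n. n \<in> P}"
  have nx: "n x \<in> carrier (L0 M)" "AE w in M. 0 \<le> rep (n x) w" if "n \<in> P" for n
    using pos[OF that] by (auto simp: L0_pos_iff)
  have A: "A \<subseteq> carrier (L0bar M)" using nx by (auto simp: A_def)
  note sup = L0bar_sup[OF A]
  have S: "seminorm_sup M P x = \<Squnion>\<^bsub>L0bar M\<^esub> A" by (simp add: seminorm_sup_def A_def)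
  have z: "\<zero>\<^bsub>L0 M\<^esub> \<in> carrier (L0 M)" by (simp add: L0_zero)
  have rz: "AE w in M. rep \<zero>\<^bsub>L0 M\<^esub> w = 0" unfolding L0_zero by (rule rep_L0_class(2)) simp
  have z': "AE w in M. rep (L0_ereal M \<zero>\<^bsub>L0 M\<^esub>) w = 0"
    using rep_L0_ereal[OF z] rz by eventually_elim simp
  show ?thesis
  proof (intro iffI conjI ballI)
    assume eq: "seminorm_sup M P x = L0_ereal M \<zero>\<^bsub>L0 M\<^esub>"
    show "P \<noteq> {}"
    proof
      assume "P = {}"
      then have "A = {}" by (simp add: A_def)
      then have "AE w in M. w \<in> UNIV \<longrightarrow> rep (\<Squnion>\<^bsub>L0bar M\<^esub> A) w \<le> - \<infinity>"
        by (intro L0bar_sup_least[OF A]) simp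
      with z' have "AE w in M. False" unfolding S[symmetric] eq by eventually_elim simp
      then show False using not_AE_False by simp
    qed
    fix n assume n: "n \<in> P"
    have "AE w in M. rep (L0_ereal M (n x)) w \<le> rep (\<Squnion>\<^bsub>L0bar M\<^esub> A) w"
      using n by (intro sup(2)) (auto simp: A_def)
    with z' rep_L0_ereal[OF nx(1)[OF n]] nx(2)[OF n] rz
    have "AE w in M. rep (n x) w = rep \<zero>\<^bsub>L0 M\<^esub> w" unfolding S[symmetric] eq by eventually_elim simp
    then show "n x = \<zero>\<^bsub>L0 M\<^esub>" using nx(1)[OF n] z by (intro L0_eqI)
  next
    assume P: "P \<noteq> {} \<and> (\<forall>n\<in>P. n x = \<zero>\<^bsub>L0 M\<^esub>)"
    then have "A = {L0_ereal M \<zero>\<^bsub>L0 M\<^esub>}" by (auto simp: A_def)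
    then have mem: "X \<in> A \<longleftrightarrow> X = L0_ereal M \<zero>\<^bsub>L0 M\<^esub>" for X by simp
    have "AE w in M. rep (L0_ereal M \<zero>\<^bsub>L0 M\<^esub>) w \<le> rep (\<Squnion>\<^bsub>L0bar M\<^esub> A) w"
      "AE w in M. w \<in> UNIV \<longrightarrow> rep (\<Squnion>\<^bsub>L0bar M\<^esub> A) w \<le> rep (L0_ereal M \<zero>\<^bsub>L0 M\<^esub>) w"
      by (intro sup(2), simp add: mem) (intro L0bar_sup_least[OF A], simp add: mem)
    then have "AE w in M. rep (\<Squnion>\<^bsub>L0bar M\<^esub> A) w = rep (L0_ereal M \<zero>\<^bsub>L0 M\<^esub>) w"
      by eventually_elim simp
    then show "seminorm_sup M P x = L0_ereal M \<zero>\<^bsub>L0 M\<^esub>"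
      unfolding S by (rule L0bar_eqI[OF sup(1) L0_ereal_in_L0bar[OF z]])
  qed
qed

section \<open>Elementary estimates of probabilities\<close>

lemma prob_Int_ge:
  assumes "A \<in> events" "B \<in> events"
  shows "prob A + prob B - 1 \<le> prob (A \<inter> B)"
proof -
  have "prob (A \<union> B) = prob A + prob (B - A)" using assms by (rule finite_measure_Union')
  moreover have "prob (B - A) = prob B - prob (B \<inter> A)" using assms by (intro finite_measure_Diff') auto
  ultimately show ?thesis using prob_le_1[of "A \<union> B"] by (simp add: Int_commute)
qed

text \<open>Serves to replace a random factor by a constant at the price of a small
  probability.\<close>

lemma prob_less_tail:
  assumes [measurable]: "u \<in> borel_measurable M" and d: "0 < (d::real)"
  obtains c :: real where "0 < c" "1 - d < prob {w \<in> space M. u w < c}"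
proof -
  define A where "A n = {w \<in> space M. u w < real n + 1}" for n :: nat
  have "(\<lambda>n. prob (A n)) \<longlonglongrightarrow> prob (\<Union>n. A n)"
    by (rule finite_Lim_measure_incseq) (auto simp: A_def incseq_def)
  moreover have "(\<Union>n. A n) = space M"
  proof (intro equalityI subsetI)
    fix w assume w: "w \<in> space M"
    obtain n where "u w < real n" using reals_Archimedean2 by blast
    then have "w \<in> A n" using w by (simp add: A_def)
    then show "w \<in> (\<Union>n. A n)" by blast
  qed (auto simp: A_def)
  ultimately have "(\<lambda>n. prob (A n)) \<longlonglongrightarrow> 1" using prob_space by simp
  from order_tendstoD(1)[OF this, of "1 - d"] d
  obtain n where "1 - d < prob (A n)" by (auto simp: eventually_sequentially)
  then show ?thesis using that[of "real n + 1"] by (simp add: A_def)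
qed

text \<open>Continuity from below: a strict inequality for the probability leaves room for a smaller
  radius. This is what makes balls open.\<close>

lemma prob_less_approx:
  assumes [measurable]: "u \<in> borel_measurable M" and p: "p < prob {w \<in> space M. u w < (c::real)}"
  obtains e where "0 < e" "p < prob {w \<in> space M. u w < c - e}"
proof -
  define A where "A n = {w \<in> space M. u w < c - 1 / (real n + 1)}" for n :: nat
  have "(\<lambda>n. prob (A n)) \<longlonglongrightarrow> prob (\<Union>n. A n)"
  proof (rule finite_Lim_measure_incseq)
    show "incseq A"
    proof (rule incseq_SucI)
      fix n
      have "1 / (real (Suc n) + 1) \<le> 1 / (real n + 1)" by (simp add: frac_le)
      then show "A n \<subseteq> A (Suc n)" by (auto simp: A_def)
    qed
  qed (auto simp: A_def)
  moreover have "(\<Union>n. A n) = {w \<in> space M. u w < c}"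
  proof (intro equalityI subsetI)
    fix w assume w: "w \<in> {w \<in> space M. u w < c}"
    then obtain n where "1 / (real n + 1) < c - u w"
      using nat_approx_posE[of "c - u w"] by (auto simp: add.commute)
    then show "w \<in> (\<Union>n. A n)" using w by (auto simp: A_def algebra_simps)
  qed (auto simp: A_def elim: less_trans)
  ultimately have "(\<lambda>n. prob (A n)) \<longlonglongrightarrow> prob {w \<in> space M. u w < c}" by simp
  from order_tendstoD(1)[OF this p]
  obtain n where "p < prob (A n)" by (auto simp: eventually_sequentially)
  then show ?thesis using that[of "1 / (real n + 1)"] by (simp add: A_def)
qed

end

section \<open>Maxima of finitely many seminorms\<close>

locale rlc =
  fixes M :: "'a measure" and E :: "(('a \<Rightarrow> real) set, 'e) module" (structure)
    and P :: "('e \<Rightarrow> ('a \<Rightarrow> real) set) set"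
  assumes rlc: "rlc_module M E P"

sublocale rlc \<subseteq> L0_module M E
  using rlc by (simp add: rlc_module_def L0_module_def)

context rlc
begin

lemma seminorm: "n \<in> P \<Longrightarrow> L0_seminorm M E n"
  using rlc by (simp add: rlc_module_def)

lemma seminorm_closed: "n \<in> P \<Longrightarrow> x \<in> carrier E \<Longrightarrow> n x \<in> carrier (L0 M)"
  using seminorm[of n] by (auto simp: L0_seminorm_def L0_pos_def)

lemma seminorm_measurable [measurable (raw)]:
  "n \<in> P \<Longrightarrow> x \<in> carrier E \<Longrightarrow> rep (n x) \<in> borel_measurable M"
  by (intro rep_measurable_L0 seminorm_closed)

lemma seminorm_nonneg: "n \<in> P \<Longrightarrow> x \<in> carrier E \<Longrightarrow> AE w in M. 0 \<le> rep (n x) w"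
  using seminorm[of n] L0_pos_iff[of "n x" M] by (auto simp: L0_seminorm_def)

lemma seminorm_add:
  assumes "n \<in> P" "x \<in> carrier E" "y \<in> carrier E"
  shows "AE w in M. rep (n (x \<oplus> y)) w \<le> rep (n x) w + rep (n y) w"
proof -
  have "AE w in M. rep (n (x \<oplus> y)) w \<le> rep (n x \<oplus>\<^bsub>L0 M\<^esub> n y) w"
    using seminorm[OF assms(1)] assms by (simp add: L0_seminorm_def L0_le_def)
  with rep_L0_add[OF seminorm_closed[OF assms(1,2)] seminorm_closed[OF assms(1,3)]]
  show ?thesis by eventually_elim simp
qed

lemma seminorm_scal:
  assumes "n \<in> P" "x \<in> carrier E" and [measurable]: "u \<in> borel_measurable M"
  shows "AE w in M. rep (n (scal u x)) w = \<bar>u w\<bar> * rep (n x) w"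
proof -
  have "n (scal u x) = L0_abs M (L0_class M u) \<otimes>\<^bsub>L0 M\<^esub> n x"
    using seminorm[OF assms(1)] assms by (simp add: L0_seminorm_def scal_def)
  also have "\<dots> = L0_class M (\<lambda>w. \<bar>u w\<bar>) \<otimes>\<^bsub>L0 M\<^esub> L0_class M (rep (n x))"
    using assms by (simp add: L0_abs_class seminorm_closed)
  also have "\<dots> = L0_class M (\<lambda>w. \<bar>u w\<bar> * rep (n x) w)"
    using assms by (intro L0_class_mult) auto
  finally show ?thesis using assms rep_L0_class(2)[of "\<lambda>w. \<bar>u w\<bar> * rep (n x) w" M] by simp
qed

lemma seminorms_nonempty: "P \<noteq> {}"
proof -
  have "seminorm_sup M P \<zero> = L0_ereal M \<zero>\<^bsub>L0 M\<^esub>" using rlc by (simp add: rlc_module_def)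
  then show ?thesis
    using seminorm_sup_eq_zero_iff[of P "\<zero>"] seminorm by (auto simp: L0_seminorm_def)
qed

text \<open>A real-valued version of \<open>seminorm_sup M Q x\<close>, as
  \<open>rep_seminorm_sup\<close> shows. It has this meaning under \<open>fin Q\<close> only, since
  \<open>Max\<close> is unspecified on empty and infinite sets.\<close>

definition nrm :: "('e \<Rightarrow> ('a \<Rightarrow> real) set) set \<Rightarrow> 'e \<Rightarrow> 'a \<Rightarrow> real" where
  "nrm Q x w = Max ((\<lambda>n. rep (n x) w) ` Q)"

definition fin :: "('e \<Rightarrow> ('a \<Rightarrow> real) set) set \<Rightarrow> bool" where
  "fin Q \<longleftrightarrow> finite Q \<and> Q \<noteq> {} \<and> Q \<subseteq> P"

lemma finD: "fin Q \<Longrightarrow> finite Q" "fin Q \<Longrightarrow> Q \<noteq> {}" "fin Q \<Longrightarrow> n \<in> Q \<Longrightarrow> n \<in> P"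
  by (auto simp: fin_def)

lemma fin_Un: "fin Q \<Longrightarrow> fin R \<Longrightarrow> fin (Q \<union> R)"
  by (auto simp: fin_def)

lemma nrm_measurable [measurable (raw)]:
  "fin Q \<Longrightarrow> x \<in> carrier E \<Longrightarrow> nrm Q x \<in> borel_measurable M"
  unfolding nrm_def[abs_def] by (intro borel_measurable_Max) (auto simp: fin_def intro!: seminorm_measurable)

lemma AE_fin:
  assumes "fin Q" "\<And>n. n \<in> P \<Longrightarrow> AE w in M. R n w"
  shows "AE w in M. \<forall>n\<in>Q. R n w"
  using assms by (intro AE_finite_allI) (auto simp: fin_def)

lemma nrm_nonneg:
  assumes "fin Q" "x \<in> carrier E"
  shows "AE w in M. 0 \<le> nrm Q x w"
proof -
  have "AE w in M. \<forall>n\<in>Q. 0 \<le> rep (n x) w"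
    using assms by (intro AE_fin seminorm_nonneg)
  then show ?thesis
    by eventually_elim (use assms(1) in \<open>auto simp: nrm_def Max_ge_iff fin_def\<close>)
qed

lemma nrm_add:
  assumes Q: "fin Q" and x: "x \<in> carrier E" and y: "y \<in> carrier E"
  shows "AE w in M. nrm Q (x \<oplus> y) w \<le> nrm Q x w + nrm Q y w"
proof -
  have "AE w in M. \<forall>n\<in>Q. rep (n (x \<oplus> y)) w \<le> rep (n x) w + rep (n y) w"
    using assms by (intro AE_fin seminorm_add)
  then show ?thesis
  proof eventually_elim
    case (elim w)
    have "rep (n (x \<oplus> y)) w \<le> nrm Q x w + nrm Q y w" if "n \<in> Q" for n
    proof -
      have "rep (n x) w \<le> nrm Q x w" "rep (n y) w \<le> nrm Q y w"
        using that finD(1)[OF Q] by (auto simp: nrm_def)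
      with elim that show ?thesis by force
    qed
    then show ?case using finD(1,2)[OF Q] by (simp add: nrm_def[of Q "x \<oplus> y"])
  qed
qed

lemma nrm_scal:
  assumes Q: "fin Q" and x: "x \<in> carrier E" and u: "u \<in> borel_measurable M"
  shows "AE w in M. nrm Q (scal u x) w = \<bar>u w\<bar> * nrm Q x w"
proof -
  have "AE w in M. \<forall>n\<in>Q. rep (n (scal u x)) w = \<bar>u w\<bar> * rep (n x) w"
    using assms by (intro AE_fin seminorm_scal)
  then show ?thesis
  proof eventually_elim
    case (elim w)
    have "nrm Q (scal u x) w = Max ((\<lambda>t. \<bar>u w\<bar> * t) ` (\<lambda>n. rep (n x) w) ` Q)"
      unfolding nrm_def image_image using elim by (intro arg_cong[where f = Max] image_cong) auto
    also have "\<dots> = \<bar>u w\<bar> * nrm Q x w"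
      unfolding nrm_def using finD(1,2)[OF Q]
      by (intro mono_Max_commute[symmetric]) (auto simp: mono_def mult_left_mono)
    finally show ?case .
  qed
qed

lemma nrm_uminus:
  assumes Q: "fin Q" and x: "x \<in> carrier E"
  shows "AE w in M. nrm Q (\<ominus> x) w = nrm Q x w"
  using nrm_scal[OF Q x, of "\<lambda>_. - 1"] x by simp

lemma nrm_mono:
  assumes "fin R" "fin Q" "Q \<subseteq> R"
  shows "nrm Q x w \<le> nrm R x w"
  unfolding nrm_def using assms by (intro Max_mono image_mono) (auto simp: fin_def)

lemma rep_seminorm_sup:
  assumes Q: "fin Q" and x: "x \<in> carrier E"
  shows "AE w in M. rep (seminorm_sup M Q x) w = ereal (nrm Q x w)"
proof -
  have "AE w in M. rep (seminorm_sup M Q x) w = (SUP n\<in>Q. ereal (rep (n x) w))"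
    using Q x by (intro seminorm_sup_finite(2)) (auto simp: fin_def intro!: seminorm_closed)
  then show ?thesis
  proof eventually_elim
    case (elim w)
    have "ereal (nrm Q x w) = Max (ereal ` (\<lambda>n. rep (n x) w) ` Q)"
      unfolding nrm_def using finD(1,2)[OF Q] by (intro mono_Max_commute) (auto simp: mono_def)
    also have "\<dots> = (SUP n\<in>Q. ereal (rep (n x) w))"
      using finD(1,2)[OF Q] by (subst Max_Sup) (auto simp: image_image)
    finally show ?case using elim by simp
  qed
qed

section \<open>Neighbourhoods and open sets\<close>

lemma mem_nbhd_iff:
  assumes Q: "fin Q"
  shows "x \<in> eps_lambda_nbhd M E Q e d \<longleftrightarrow>
    x \<in> carrier E \<and> 1 - d < prob {w \<in> space M. nrm Q x w < e}"
proof (cases "x \<in> carrier E")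
  case True
  have c: "seminorm_sup M Q x \<in> carrier (L0bar M)"
    using Q True by (intro seminorm_sup_finite(1)) (auto simp: fin_def intro!: seminorm_closed)
  have [measurable]: "rep (seminorm_sup M Q x) \<in> borel_measurable M" "nrm Q x \<in> borel_measurable M"
    using c Q True by (auto intro: rep_measurable_L0bar nrm_measurable)
  have "prob {w \<in> space M. rep (seminorm_sup M Q x) w < ereal e} = prob {w \<in> space M. nrm Q x w < e}"
  proof (rule finite_measure_eq_AE)
    show "AE w in M. (w \<in> {w \<in> space M. rep (seminorm_sup M Q x) w < ereal e}) =
       (w \<in> {w \<in> space M. nrm Q x w < e})"
      using rep_seminorm_sup[OF Q True] by eventually_elim simp
  qed auto
  then show ?thesis using True by (simp add: eps_lambda_nbhd_def)
qed (simp add: eps_lambda_nbhd_def)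

lemma openin_iff:
  "openin (eps_lambda_topology M E P) U \<longleftrightarrow> U \<subseteq> carrier E \<and>
    (\<forall>x\<in>U. \<exists>Q e d. fin Q \<and> 0 < e \<and> 0 < d \<and> d < 1 \<and>
       (\<forall>z\<in>carrier E. 1 - d < prob {w \<in> space M. nrm Q z w < e} \<longrightarrow> x \<oplus> z \<in> U))"
proof -
  have "finite Q \<and> Q \<noteq> {} \<and> Q \<subseteq> P \<and> 0 < e \<and> 0 < d \<and> d < 1 \<and>
      (\<lambda>y. x \<oplus> y) ` eps_lambda_nbhd M E Q e d \<subseteq> U \<longleftrightarrow>
    fin Q \<and> 0 < e \<and> 0 < d \<and> d < 1 \<and>
      (\<forall>z\<in>carrier E. 1 - d < prob {w \<in> space M. nrm Q z w < e} \<longrightarrow> x \<oplus> z \<in> U)" for Q e d x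
  proof (cases "fin Q")
    case True
    then have "(\<lambda>y. x \<oplus> y) ` eps_lambda_nbhd M E Q e d \<subseteq> U \<longleftrightarrow>
      (\<forall>z\<in>carrier E. 1 - d < prob {w \<in> space M. nrm Q z w < e} \<longrightarrow> x \<oplus> z \<in> U)"
      using mem_nbhd_iff[OF True] by auto
    with True show ?thesis by (simp add: fin_def)
  qed (auto simp: fin_def)
  then show ?thesis
    unfolding openin_eps_lambda[OF rlc] eps_lambda_open_def by presburger
qed

lemma topspace_eq: "topspace (eps_lambda_topology M E P) = carrier E"
proof
  obtain n where "n \<in> P" using seminorms_nonempty by blast
  then have "openin (eps_lambda_topology M E P) (carrier E)"
    unfolding openin_iff by (auto intro!: exI[of _ "{n}"] exI[of _ 1] exI[of _ "1/2"] simp: fin_def)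
  then show "carrier E \<subseteq> topspace (eps_lambda_topology M E P)" by (rule openin_subset)
qed (auto simp: topspace_def openin_iff)

lemma openin_ball:
  assumes Q: "fin Q" and x: "x \<in> carrier E"
  shows "openin (eps_lambda_topology M E P)
    {y \<in> carrier E. 1 - d < prob {w \<in> space M. nrm Q (y \<ominus> x) w < e}}"
  unfolding openin_iff
proof (intro conjI ballI)
  fix y assume "y \<in> {y \<in> carrier E. 1 - d < prob {w \<in> space M. nrm Q (y \<ominus> x) w < e}}"
  then have y: "y \<in> carrier E" and p: "1 - d < prob {w \<in> space M. nrm Q (y \<ominus> x) w < e}" by auto
  note [measurable] = nrm_measurable[OF Q]
  have "nrm Q (y \<ominus> x) \<in> borel_measurable M" using x y by simp
  from prob_less_approx[OF this p]
  obtain e' where e': "0 < e'" "1 - d < prob {w \<in> space M. nrm Q (y \<ominus> x) w < e - e'}" (is "_ < ?p")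
    by blast
  \<comment> \<open>The surplus of probability that remains after the radius has shrunk by e'; the
    cap 1/2 keeps d' below 1.\<close>
  define d' where "d' = min (?p - (1 - d)) (1 / 2)"
  have "y \<oplus> z \<in> {y \<in> carrier E. 1 - d < prob {w \<in> space M. nrm Q (y \<ominus> x) w < e}}"
    if z: "z \<in> carrier E" "1 - d' < prob {w \<in> space M. nrm Q z w < e'}" for z
  proof -
    have [measurable]: "nrm Q (y \<ominus> x) \<in> borel_measurable M" "nrm Q z \<in> borel_measurable M"
      "nrm Q (y \<oplus> z \<ominus> x) \<in> borel_measurable M"
      using x y z by simp_all
    have eq: "y \<oplus> z \<ominus> x = (y \<ominus> x) \<oplus> z" using x y z by (simp add: a_minus_def M.a_ac)
    have "1 - d < ?p + prob {w \<in> space M. nrm Q z w < e'} - 1"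
      using z(2) e' by (simp add: d'_def min_def split: if_splits)
    also have "\<dots> \<le> prob ({w \<in> space M. nrm Q (y \<ominus> x) w < e - e'} \<inter> {w \<in> space M. nrm Q z w < e'})"
      by (rule prob_Int_ge) measurable
    also have "\<dots> \<le> prob {w \<in> space M. nrm Q (y \<oplus> z \<ominus> x) w < e}"
    proof (rule finite_measure_mono_AE)
      have "AE w in M. nrm Q (y \<oplus> z \<ominus> x) w \<le> nrm Q (y \<ominus> x) w + nrm Q z w"
        unfolding eq using x y z by (intro nrm_add[OF Q]) auto
      then show "AE w in M. w \<in> {w \<in> space M. nrm Q (y \<ominus> x) w < e - e'} \<inter> {w \<in> space M. nrm Q z w < e'} \<longrightarrow>
          w \<in> {w \<in> space M. nrm Q (y \<oplus> z \<ominus> x) w < e}"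
        by eventually_elim auto
    qed measurable
    finally show ?thesis using y z by simp
  qed
  moreover have "0 < d'" "d' < 1" using e' by (auto simp: d'_def)
  ultimately show "\<exists>Q' e' d'. fin Q' \<and> 0 < e' \<and> 0 < d' \<and> d' < 1 \<and>
      (\<forall>z\<in>carrier E. 1 - d' < prob {w \<in> space M. nrm Q' z w < e'} \<longrightarrow>
        y \<oplus> z \<in> {y \<in> carrier E. 1 - d < prob {w \<in> space M. nrm Q (y \<ominus> x) w < e}})"
    using Q e'(1) by blast
qed auto

end

text \<open>Makes the facts on balls and open sets available for the scalar factor of the product
  topology and for the target of the functionals.\<close>

lemma rlc_L0:
  assumes "prob_space M"
  shows "rlc M (L0 M) {L0_abs M}"
proof -
  interpret prob_space M by fact
  interpret cring "L0 M" by (rule cring_L0)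
  have pos: "L0_abs M X \<in> L0_pos M" if "X \<in> carrier (L0 M)" for X
    using that by (auto elim!: L0_cases simp: L0_abs_class L0_pos_class_iff)
  have "L0_seminorm M (L0 M) (L0_abs M)"
    unfolding L0_seminorm_def using pos
    by (auto elim!: L0_cases
        simp: L0_abs_class L0_class_add L0_class_mult L0_le_class_iff smult_L0 abs_mult)
  moreover have "L0_abs M X = \<zero>\<^bsub>L0 M\<^esub> \<longleftrightarrow> X = \<zero>\<^bsub>L0 M\<^esub>" if X: "X \<in> carrier (L0 M)" for X
  proof -
    obtain u where u: "u \<in> borel_measurable M" "X = L0_class M u" using X by (rule L0_cases)
    have "L0_class M (\<lambda>w. \<bar>u w\<bar>) = L0_class M (\<lambda>_. 0) \<longleftrightarrow> L0_class M u = L0_class M (\<lambda>_. 0)"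
      using u(1) by (simp add: L0_class_eq_iff)
    then show ?thesis using u by (simp add: L0_abs_class L0_zero)
  qed
  ultimately show ?thesis
    unfolding rlc_def rlc_module_def
    using pos seminorm_sup_eq_zero_iff[of "{L0_abs M}"] module_L0 assms by simp
qed

lemma (in prob_space) nrm_L0:
  assumes "X \<in> carrier (L0 M)"
  shows "AE w in M. rlc.nrm {L0_abs M} X w = \<bar>rep X w\<bar>"
proof -
  interpret L: rlc M "L0 M" "{L0_abs M}" by (rule rlc_L0) unfold_locales
  show ?thesis
    using rep_L0_class(2)[of "\<lambda>w. \<bar>rep X w\<bar>" M] rep_measurable_L0[OF assms]
    by (simp add: L.nrm_def L0_abs_def)
qed

lemma (in prob_space) nrm_L0_class:
  assumes "u \<in> borel_measurable M"
  shows "AE w in M. rlc.nrm {L0_abs M} (L0_class M u) w = \<bar>u w\<bar>"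
proof -
  have "AE w in M. rlc.nrm {L0_abs M} (L0_class M u) w = \<bar>rep (L0_class M u) w\<bar>"
    using assms by (intro nrm_L0) simp
  with rep_L0_class(2)[OF assms] show ?thesis by eventually_elim simp
qed

section \<open>Linear maps and the random dual\<close>

context L0_module
begin

lemma linear_fun_measurable: "linear_fun L \<Longrightarrow> x \<in> carrier E \<Longrightarrow> L x \<in> borel_measurable M"
  by (simp add: linear_fun_def)

lemma linear_fun_add:
  "linear_fun L \<Longrightarrow> x \<in> carrier E \<Longrightarrow> y \<in> carrier E \<Longrightarrow> AE w in M. L (x \<oplus> y) w = L x w + L y w"
  by (simp add: linear_fun_def)

lemma linear_fun_scal:
  "linear_fun L \<Longrightarrow> x \<in> carrier E \<Longrightarrow> u \<in> borel_measurable M \<Longrightarrow> AE w in M. L (scal u x) w = u w * L x w"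
  by (simp add: linear_fun_def)

lemma linear_fun_uminus:
  "linear_fun L \<Longrightarrow> x \<in> carrier E \<Longrightarrow> AE w in M. L (\<ominus> x) w = - L x w"
  using linear_fun_scal[of L x "\<lambda>_. - 1"] by simp

lemma linear_fun_diff:
  assumes "linear_fun L" "x \<in> carrier E" "y \<in> carrier E"
  shows "AE w in M. L (x \<ominus> y) w = L x w - L y w"
  using linear_fun_add[OF assms(1,2), of "\<ominus> y"] linear_fun_uminus[OF assms(1,3)] assms(3)
  unfolding a_minus_def by (auto elim: eventually_elim2)

end

context rlc
begin

lemma random_dual_closed: "g \<in> random_dual M E P \<Longrightarrow> x \<in> carrier E \<Longrightarrow> g x \<in> carrier (L0 M)"
  by (auto simp: random_dual_def)

lemma linear_fun_random_dual:
  assumes g: "g \<in> random_dual M E P"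
  shows "linear_fun (\<lambda>x. rep (g x))"
  unfolding linear_fun_def
proof (intro conjI ballI)
  fix x y assume x: "x \<in> carrier E" and y: "y \<in> carrier E"
  have "g (x \<oplus> y) = g x \<oplus>\<^bsub>L0 M\<^esub> g y" using g x y by (auto simp: random_dual_def)
  then show "AE w in M. rep (g (x \<oplus> y)) w = rep (g x) w + rep (g y) w"
    using rep_L0_add[OF random_dual_closed[OF g x] random_dual_closed[OF g y]] by simp
next
  fix x and u :: "'a \<Rightarrow> real"
      assume x: "x \<in> carrier E" and u: "u \<in> borel_measurable M"
  have "g (scal u x) = L0_class M u \<otimes>\<^bsub>L0 M\<^esub> g x" using g x u by (auto simp: random_dual_def scal_def)
  then have "AE w in M. rep (g (scal u x)) w = rep (L0_class M u) w * rep (g x) w"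
    using rep_L0_mult[OF L0_class_in_L0[OF u] random_dual_closed[OF g x]] by simp
  with rep_L0_class(2)[OF u] show "AE w in M. rep (g (scal u x)) w = u w * rep (g x) w"
    by eventually_elim simp
qed (auto intro: rep_measurable_L0 random_dual_closed[OF g])

text \<open>The factor N may be unbounded. It is below a constant c up to probability d/2, and the
  other d/2 is spent on the event where the seminorm is at least e/c.\<close>

lemma random_dualI:
  assumes L: "linear_fun L" and Q: "fin Q" and N [measurable]: "N \<in> borel_measurable M"
    and bound: "\<And>x. x \<in> carrier E \<Longrightarrow> AE w in M. \<bar>L x w\<bar> \<le> N w * nrm Q x w"
  shows "(\<lambda>x\<in>carrier E. L0_class M (L x)) \<in> random_dual M E P" (is "?g \<in> _")
  unfolding random_dual_def
proof (intro CollectI conjI ballI)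
  interpret S: rlc M "L0 M" "{L0_abs M}" by (rule rlc_L0) unfold_locales
  note [measurable] = linear_fun_measurable[OF L] nrm_measurable[OF Q]
  show "?g \<in> carrier E \<rightarrow>\<^sub>E carrier (L0 M)" by auto
  show g_add: "?g (x \<oplus> y) = ?g x \<oplus>\<^bsub>L0 M\<^esub> ?g y" if "x \<in> carrier E" "y \<in> carrier E" for x y
    using that L0_class_cong[OF linear_fun_add[OF L that]] by (simp add: L0_class_add)
  show "?g (\<xi> \<odot> x) = \<xi> \<otimes>\<^bsub>L0 M\<^esub> ?g x" if xi: "\<xi> \<in> carrier (L0 M)" and x: "x \<in> carrier E" for \<xi> x
  proof -
    obtain u where u: "u \<in> borel_measurable M" "\<xi> = L0_class M u" using xi by (rule L0_cases)
    show ?thesis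
      using u x L0_class_cong[OF linear_fun_scal[OF L x u(1)]] scal_closed[OF u(1) x]
      by (simp add: L0_class_mult scal_def)
  qed
  show "continuous_map (eps_lambda_topology M E P) (L0_topology M) ?g"
    unfolding continuous_map_def
  proof (intro conjI allI impI)
    show "?g \<in> topspace (eps_lambda_topology M E P) \<rightarrow> topspace (L0_topology M)"
      by (auto simp: topspace_eq S.topspace_eq)
    fix V assume V: "openin (L0_topology M) V"
    show "openin (eps_lambda_topology M E P) {x \<in> topspace (eps_lambda_topology M E P). ?g x \<in> V}"
      unfolding topspace_eq openin_iff
    proof (intro conjI ballI)
      fix x assume "x \<in> {x \<in> carrier E. ?g x \<in> V}"
      then have x: "x \<in> carrier E" and gV: "?g x \<in> V" by auto
      from conjunct2[OF V[unfolded S.openin_iff], THEN bspec, OF gV]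
      obtain Q' e d where Q': "S.fin Q'" and ed: "0 < e" "0 < d" "d < 1" and
        V': "\<And>z. z \<in> carrier (L0 M) \<Longrightarrow> 1 - d < prob {w \<in> space M. S.nrm Q' z w < e} \<Longrightarrow> ?g x \<oplus>\<^bsub>L0 M\<^esub> z \<in> V"
        by blast
      have Q'_eq: "Q' = {L0_abs M}" using Q' by (auto simp: S.fin_def)
      obtain c where c: "0 < c" "1 - d / 2 < prob {w \<in> space M. N w < c}"
        using prob_less_tail[OF N, of "d / 2"] ed by auto
      have "x \<oplus> z \<in> {x \<in> carrier E. ?g x \<in> V}"
        if z: "z \<in> carrier E" and p: "1 - d / 2 < prob {w \<in> space M. nrm Q z w < e / c}" for z
      proof -
        have [measurable]: "S.nrm {L0_abs M} (L0_class M (L z)) \<in> borel_measurable M"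
          using z by (intro S.nrm_measurable) (auto simp: S.fin_def)
        have [measurable]: "nrm Q z \<in> borel_measurable M" using z by measurable
        have "1 - d < prob {w \<in> space M. nrm Q z w < e / c} + prob {w \<in> space M. N w < c} - 1"
          using p c by simp
        also have "\<dots> \<le> prob ({w \<in> space M. nrm Q z w < e / c} \<inter> {w \<in> space M. N w < c})"
          by (rule prob_Int_ge) measurable
        also have "\<dots> \<le> prob {w \<in> space M. S.nrm {L0_abs M} (L0_class M (L z)) w < e}"
        proof (rule finite_measure_mono_AE)
          show "AE w in M. w \<in> {w \<in> space M. nrm Q z w < e / c} \<inter> {w \<in> space M. N w < c} \<longrightarrow>
              w \<in> {w \<in> space M. S.nrm {L0_abs M} (L0_class M (L z)) w < e}"
            using nrm_L0_class[OF linear_fun_measurable[OF L z]] bound[OF z] nrm_nonneg[OF Q z]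
          proof eventually_elim
            case (elim w)
            have "\<bar>L z w\<bar> < e" if "nrm Q z w < e / c" "N w < c"
            proof -
              have "\<bar>L z w\<bar> \<le> c * nrm Q z w"
                using elim(2,3) that(2) by (meson less_imp_le mult_right_mono order_trans)
              also have "\<dots> < e" using that(1) c(1) by (simp add: field_simps)
              finally show ?thesis .
            qed
            then show ?case using elim(1) by auto
          qed
        qed measurable
        finally have "?g x \<oplus>\<^bsub>L0 M\<^esub> L0_class M (L z) \<in> V"
          using z by (intro V') (auto simp: Q'_eq)
        then show ?thesis using g_add[OF x z] x z by simp
      qed
      moreover have "0 < e / c" "0 < d / 2" "d / 2 < 1" using ed c by simp_all
      ultimately show "\<exists>Q e d. fin Q \<and> 0 < e \<and> 0 < d \<and> d < 1 \<and> (\<forall>z\<in>carrier E.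
          1 - d < prob {w \<in> space M. nrm Q z w < e} \<longrightarrow> x \<oplus> z \<in> {x \<in> carrier E. ?g x \<in> V})"
        using Q by blast
    qed auto
  qed
qed

end


section \<open>Restriction to an event\<close>

lemma (in L0_module) add_minus_cancel:
  "x \<in> carrier E \<Longrightarrow> y \<in> carrier E \<Longrightarrow> x \<oplus> (y \<ominus> x) = y"
  by (simp add: a_minus_def M.a_lcomm[of x y] M.r_neg)

locale rlc_on = rlc M E P
  for M :: "'a measure" and E :: "(('a \<Rightarrow> real) set, 'e) module" (structure)
    and P :: "('e \<Rightarrow> ('a \<Rightarrow> real) set) set" +
  fixes D :: "'a set"
  assumes D [measurable]: "D \<in> events" and D_pos: "0 < prob D"
begin

abbreviation "N \<equiv> cond_base M D"
abbreviation "F \<equiv> restrict_module M D E"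
abbreviation "P' \<equiv> restrict_seminorms M D P"

lemma emeasure_D: "emeasure M D \<noteq> 0" "emeasure M D \<noteq> \<infinity>" "emeasure M D < \<infinity>"
  using D_pos by (auto simp: emeasure_eq_measure)

lemma D_space [simp]: "D \<inter> space M = D" "space M \<inter> D = D"
  using sets.sets_into_space[OF D] by auto

lemma space_N [simp]: "space N = D"
  by (simp add: cond_base_def space_restrict_space)

text \<open>Conditioning on D keeps the null subsets of D. All statements over the base D are moved
  to M by this equivalence, where different events can be compared.\<close>

lemma AE_N_iff: "(AE w in N. R w) \<longleftrightarrow> (AE w in M. w \<in> D \<longrightarrow> R w)"
  unfolding cond_base_def using emeasure_D
  by (subst AE_restrict_space_iff) (auto simp: AE_uniform_measure)

lemma prob_space_N: "prob_space N"
  unfolding cond_base_def using emeasure_D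
  by (intro prob_space_restrict_space) (auto simp: emeasure_uniform_measure_1)

lemma measure_N: "A \<in> events \<Longrightarrow> A \<subseteq> D \<Longrightarrow> measure N A = prob A / prob D"
  unfolding cond_base_def using emeasure_D
  by (subst measure_restrict_space) (auto simp: Int_absorb1)

lemma measurable_N: "u \<in> borel_measurable M \<Longrightarrow> u \<in> borel_measurable N"
  unfolding cond_base_def by (intro measurable_restrict_space1) (simp cong: measurable_cong_sets)

lemma measurable_N_extend:
  assumes "u \<in> borel_measurable N"
  shows "(\<lambda>w. if w \<in> D then u w else c) \<in> borel_measurable M"
proof -
  have "(\<lambda>w. if w \<in> D then u w else c) \<in> borel_measurable (uniform_measure M D)"
    using assms unfolding cond_base_def by (subst (asm) measurable_restrict_space_iff[where c = c]) simp_all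
  then show ?thesis by (simp cong: measurable_cong_sets)
qed

sublocale N: prob_space N
  by (rule prob_space_N)

text \<open>Extension by 0 gives each scalar over D a version that is measurable on the whole space,
  so that \<open>scal\<close> applies to it.\<close>

lemma L0_N_cases:
  assumes "X \<in> carrier (L0 N)"
  obtains v where "v \<in> borel_measurable M" "X = L0_class N v"
proof (rule that)
  let ?v = "\<lambda>w. if w \<in> D then rep X w else 0"
  show "?v \<in> borel_measurable M" using rep_measurable_L0[OF assms] by (rule measurable_N_extend)
  have "L0_class N ?v = L0_class N (rep X)" by (rule L0_class_cong) (simp add: AE_N_iff)
  then show "X = L0_class N ?v" using assms by simp
qed

lemma rep_N: "u \<in> borel_measurable M \<Longrightarrow> AE w in M. w \<in> D \<longrightarrow> rep (L0_class N u) w = u w"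
  using rep_L0_class(2)[OF measurable_N[of u]] by (simp add: AE_N_iff)

lemma L0_restrict_L0 [simp]: "X \<in> carrier (L0 M) \<Longrightarrow> L0_restrict M D X \<in> carrier (L0 N)"
  unfolding L0_restrict_def by (intro L0_class_in_L0 measurable_N rep_measurable_L0)

lemma L0_restrict_L0bar [simp]: "X \<in> carrier (L0bar M) \<Longrightarrow> L0_restrict M D X \<in> carrier (L0bar N)"
  unfolding L0_restrict_def carrier_L0bar[of N] by (intro imageI measurable_N rep_measurable_L0bar)

lemma rep_L0_restrict:
  "X \<in> carrier (L0 M) \<Longrightarrow> AE w in M. w \<in> D \<longrightarrow> rep (L0_restrict M D X) w = rep X w"
  unfolding L0_restrict_def by (intro rep_N rep_measurable_L0)

lemma rep_L0_restrict_L0bar: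
  "X \<in> carrier (L0bar M) \<Longrightarrow> AE w in M. w \<in> D \<longrightarrow> rep (L0_restrict M D X) w = rep X w"
  unfolding L0_restrict_def by (intro rep_N rep_measurable_L0bar)

lemma scal_ind_ind [simp]:
  "x \<in> carrier E \<Longrightarrow> scal (indicator D) (scal (indicator D) x) = scal (indicator D) x"
  by (subst scal_scal) (simp_all add: indicator_inter_arith[symmetric])

text \<open>The indicator of D is idempotent, so its range on E is its set of fixed points; closure
  under the operations is easier to check in this form.\<close>

lemma carrier_F: "x \<in> carrier F \<longleftrightarrow> x \<in> carrier E \<and> scal (indicator D) x = x"
proof -
  have "x \<in> carrier F \<longleftrightarrow> (\<exists>y\<in>carrier E. x = scal (indicator D) y)"
    by (auto simp: restrict_module_def L0_ind_def scal_def)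
  also have "\<dots> \<longleftrightarrow> x \<in> carrier E \<and> scal (indicator D) x = x"
    by (auto intro!: bexI[of _ x])
  finally show ?thesis .
qed

lemma ind_F [simp]: "x \<in> carrier E \<Longrightarrow> scal (indicator D) x \<in> carrier F"
  by (simp add: carrier_F)

lemma F_simps [simp]: "add F = add E" "zero F = zero E"
  by (simp_all add: restrict_module_def)

lemma scal_on_D:
  assumes "u \<in> borel_measurable M" "v \<in> borel_measurable M" "x \<in> carrier F"
    and "AE w in M. w \<in> D \<longrightarrow> u w = v w"
  shows "scal u x = scal v x"
proof -
  have x: "x \<in> carrier E" "scal (indicator D) x = x" using assms(3) by (auto simp: carrier_F)
  have "scal u (scal (indicator D) x) = scal v (scal (indicator D) x)"
    using x(1) assms(1,2) by (simp add: scal_scal)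
      (intro scal_cong, use assms(4) in eventually_elim, auto simp: indicator_def)
  then show ?thesis by (simp add: x)
qed

lemma smult_F:
  assumes v [measurable]: "v \<in> borel_measurable M" and x: "x \<in> carrier F"
  shows "L0_class N v \<odot>\<^bsub>F\<^esub> x = scal v x"
proof -
  let ?u = "\<lambda>w. indicator D w * rep (L0_class N v) w"
  have "(\<lambda>w. if w \<in> D then rep (L0_class N v) w else 0) \<in> borel_measurable M"
    by (intro measurable_N_extend rep_L0_class(1) measurable_N v)
  also have "(\<lambda>w. if w \<in> D then rep (L0_class N v) w else 0) = ?u" by (auto simp: indicator_def)
  finally have [measurable]: "?u \<in> borel_measurable M" .
  have "L0_class N v \<odot>\<^bsub>F\<^esub> x = scal ?u x"
    by (simp add: restrict_module_def scal_def L0_extend_def)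
  also have "\<dots> = scal v x"
    using x rep_N[OF v] by (intro scal_on_D) (auto elim: eventually_mono)
  finally show ?thesis .
qed

lemma scal_F: "u \<in> borel_measurable M \<Longrightarrow> x \<in> carrier F \<Longrightarrow> scal u x \<in> carrier F"
  by (auto simp: carrier_F scal_scal mult.commute[of "indicator D _"])
    (metis scal_scal[OF _ borel_measurable_indicator[OF D]])

lemma minus_F: "x \<in> carrier F \<Longrightarrow> \<ominus> x \<in> carrier F"
  using scal_F[of "\<lambda>_. - 1" x] by (simp add: carrier_F)

lemma add_F: "x \<in> carrier F \<Longrightarrow> y \<in> carrier F \<Longrightarrow> x \<oplus> y \<in> carrier F"
  by (simp add: carrier_F scal_add_right)

lemma module_F: "module (L0 N) F"
proof (rule moduleI)
  show "cring (L0 N)" by (rule cring_L0)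
  show "abelian_group F"
  proof (rule abelian_groupI; simp)
    show "\<zero> \<in> carrier F" by (simp add: carrier_F)
    fix x assume x: "x \<in> carrier F"
    show "\<exists>y\<in>carrier F. y \<oplus> x = \<zero>"
      using minus_F[OF x] x by (intro bexI[of _ "\<ominus> x"]) (simp_all add: carrier_F M.l_neg)
  qed (auto simp: carrier_F scal_add_right M.a_ac)
next
  fix a x assume "a \<in> carrier (L0 N)" and x: "x \<in> carrier F"
  then show "a \<odot>\<^bsub>F\<^esub> x \<in> carrier F" by (auto elim!: L0_N_cases simp: smult_F scal_F)
next
  fix a b x assume a: "a \<in> carrier (L0 N)" and b: "b \<in> carrier (L0 N)" and x: "x \<in> carrier F"
  obtain u where u: "u \<in> borel_measurable M" "a = L0_class N u" using a by (rule L0_N_cases)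
  obtain v where v: "v \<in> borel_measurable M" "b = L0_class N v" using b by (rule L0_N_cases)
  have xE: "x \<in> carrier E" using x by (simp add: carrier_F)
  show "(a \<oplus>\<^bsub>L0 N\<^esub> b) \<odot>\<^bsub>F\<^esub> x = a \<odot>\<^bsub>F\<^esub> x \<oplus>\<^bsub>F\<^esub> b \<odot>\<^bsub>F\<^esub> x"
    using u v x xE by (simp add: L0_class_add measurable_N smult_F scal_add_left)
  show "(a \<otimes>\<^bsub>L0 N\<^esub> b) \<odot>\<^bsub>F\<^esub> x = a \<odot>\<^bsub>F\<^esub> (b \<odot>\<^bsub>F\<^esub> x)"
    using u v x xE by (simp add: L0_class_mult measurable_N smult_F scal_scal scal_F)
next
  fix a x y assume a: "a \<in> carrier (L0 N)" and x: "x \<in> carrier F" and y: "y \<in> carrier F"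
  obtain u where u: "u \<in> borel_measurable M" "a = L0_class N u" using a by (rule L0_N_cases)
  show "a \<odot>\<^bsub>F\<^esub> (x \<oplus>\<^bsub>F\<^esub> y) = a \<odot>\<^bsub>F\<^esub> x \<oplus>\<^bsub>F\<^esub> a \<odot>\<^bsub>F\<^esub> y"
    using u x y by (simp add: smult_F add_F) (simp add: scal_add_right carrier_F)
next
  fix x assume x: "x \<in> carrier F"
  then show "\<one>\<^bsub>L0 N\<^esub> \<odot>\<^bsub>F\<^esub> x = x" by (simp add: L0_one smult_F) (simp add: carrier_F)
qed

text \<open>A seminorm of an element of F vanishes off D, hence it is zero over the base D exactly
  if it is zero over the whole base. This transfers the separation axiom.\<close>

lemma rlc_N: "rlc N F P'"
proof -
  have FE: "x \<in> carrier E" if "x \<in> carrier F" for x using that by (simp add: carrier_F)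
  have rn: "AE w in N. rep (L0_restrict M D (n x)) w = rep (n x) w" if "n \<in> P" "x \<in> carrier E" for n x
    using rep_L0_restrict[OF seminorm_closed[OF that]] by (simp add: AE_N_iff)
  have pos: "L0_restrict M D (n x) \<in> L0_pos N" if "n \<in> P" "x \<in> carrier E" for n x
  proof -
    have "AE w in N. 0 \<le> rep (n x) w" using seminorm_nonneg[OF that] by (auto simp: AE_N_iff elim: eventually_mono)
    with rn[OF that] have "AE w in N. 0 \<le> rep (L0_restrict M D (n x)) w" by eventually_elim simp
    then show ?thesis using seminorm_closed[OF that] by (simp add: L0_pos_iff)
  qed
  have "L0_seminorm N F (\<lambda>x. L0_restrict M D (n x))" if n: "n \<in> P" for n
    unfolding L0_seminorm_def
  proof (intro conjI ballI)
    show "(\<lambda>x. L0_restrict M D (n x)) \<in> carrier F \<rightarrow> L0_pos N" using pos[OF n] FE by auto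
  next
    fix \<xi> x assume \<xi>: "\<xi> \<in> carrier (L0 N)" and x: "x \<in> carrier F"
    obtain u where u: "u \<in> borel_measurable M" "\<xi> = L0_class N u" using \<xi> by (rule L0_N_cases)
    have abs: "L0_abs N \<xi> = L0_class N (\<lambda>w. \<bar>u w\<bar>)" using u by (simp add: L0_abs_class measurable_N)
    have 1: "AE w in N. rep (n (scal u x)) w = \<bar>u w\<bar> * rep (n x) w"
      using seminorm_scal[OF n FE[OF x] u(1)] by (auto simp: AE_N_iff elim: eventually_mono)
    have m: "(\<lambda>w. \<bar>u w\<bar>) \<in> borel_measurable N" using u by (intro measurable_N) simp
    have c: "L0_restrict M D (n x) \<in> carrier (L0 N)" using seminorm_closed[OF n FE[OF x]] by simp
    interpret N: cring "L0 N" by (rule cring_L0)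
    show "L0_restrict M D (n (\<xi> \<odot>\<^bsub>F\<^esub> x)) = L0_abs N \<xi> \<otimes>\<^bsub>L0 N\<^esub> L0_restrict M D (n x)"
    proof (rule L0_eqI)
      show "AE w in N. rep (L0_restrict M D (n (\<xi> \<odot>\<^bsub>F\<^esub> x))) w = rep (L0_abs N \<xi> \<otimes>\<^bsub>L0 N\<^esub> L0_restrict M D (n x)) w"
        unfolding u(2) smult_F[OF u(1) x] unfolding u(2)[symmetric] abs
        using rn[OF n scal_closed[OF u(1) FE[OF x]]] 1 rn[OF n FE[OF x]] rep_L0_class(2)[OF m]
          rep_L0_mult[OF L0_class_in_L0[OF m] c]
        by eventually_elim simp
      show "L0_restrict M D (n (\<xi> \<odot>\<^bsub>F\<^esub> x)) \<in> carrier (L0 N)"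
        unfolding u(2) smult_F[OF u(1) x] using n u(1) FE[OF x]
        by (intro L0_restrict_L0 seminorm_closed scal_closed)
      show "L0_abs N \<xi> \<otimes>\<^bsub>L0 N\<^esub> L0_restrict M D (n x) \<in> carrier (L0 N)"
        unfolding abs by (intro N.m_closed L0_class_in_L0 m c)
    qed
  next
    fix x y assume x: "x \<in> carrier F" and y: "y \<in> carrier F"
    have 1: "AE w in N. rep (n (x \<oplus> y)) w \<le> rep (n x) w + rep (n y) w"
      using seminorm_add[OF n FE[OF x] FE[OF y]] by (auto simp: AE_N_iff elim: eventually_mono)
    show "L0_le N (L0_restrict M D (n (x \<oplus>\<^bsub>F\<^esub> y))) (L0_restrict M D (n x) \<oplus>\<^bsub>L0 N\<^esub> L0_restrict M D (n y))"
      unfolding L0_le_def F_simps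
      using rn[OF n FE[OF x]] rn[OF n FE[OF y]] rn[OF n FE[OF add_F[OF x y]]] 1
        rep_L0_add[OF L0_restrict_L0[OF seminorm_closed[OF n FE[OF x]]]
          L0_restrict_L0[OF seminorm_closed[OF n FE[OF y]]]]
      by eventually_elim simp
  qed
  moreover have "seminorm_sup N P' x = L0_ereal N \<zero>\<^bsub>L0 N\<^esub> \<longleftrightarrow> x = \<zero>" if x: "x \<in> carrier F" for x
  proof -
    have xE: "x \<in> carrier E" and xD: "scal (indicator D) x = x" using x by (auto simp: carrier_F)
    have "n x = \<zero>\<^bsub>L0 M\<^esub> \<longleftrightarrow> L0_restrict M D (n x) = \<zero>\<^bsub>L0 N\<^esub>" if n: "n \<in> P" for n
    proof -
      have "AE w in M. rep (n x) w = \<bar>indicator D w\<bar> * rep (n x) w"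
        using seminorm_scal[OF n xE borel_measurable_indicator[OF D]] by (simp add: xD)
      then have off: "AE w in M. w \<notin> D \<longrightarrow> rep (n x) w = 0"
        by eventually_elim (auto simp: indicator_def)
      have "n x = \<zero>\<^bsub>L0 M\<^esub> \<longleftrightarrow> L0_class M (rep (n x)) = L0_class M (\<lambda>_. 0)"
        using seminorm_closed[OF n xE] by (simp add: L0_zero)
      also have "\<dots> \<longleftrightarrow> (AE w in M. rep (n x) w = 0)"
        using seminorm_measurable[OF n xE] by (intro L0_class_eq_iff) auto
      also have "\<dots> \<longleftrightarrow> (AE w in M. w \<in> D \<longrightarrow> rep (n x) w = 0)"
        using off by (auto elim: eventually_elim2)
      also have "\<dots> \<longleftrightarrow> L0_class N (rep (n x)) = L0_class N (\<lambda>_. 0)"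
        using measurable_N[OF seminorm_measurable[OF n xE]] by (subst L0_class_eq_iff) (auto simp: AE_N_iff)
      finally show ?thesis by (simp add: L0_restrict_def L0_zero)
    qed
    then have "(P' \<noteq> {} \<and> (\<forall>n\<in>P'. n x = \<zero>\<^bsub>L0 N\<^esub>)) \<longleftrightarrow> P \<noteq> {} \<and> (\<forall>n\<in>P. n x = \<zero>\<^bsub>L0 M\<^esub>)"
      by (auto simp: restrict_seminorms_def)
    also have "\<dots> \<longleftrightarrow> seminorm_sup M P x = L0_ereal M \<zero>\<^bsub>L0 M\<^esub>"
      using seminorm xE by (intro seminorm_sup_eq_zero_iff[symmetric]) (auto simp: L0_seminorm_def Pi_iff)
    also have "\<dots> \<longleftrightarrow> x = \<zero>" using rlc xE by (simp add: rlc_module_def)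
    finally show ?thesis
      by (subst N.seminorm_sup_eq_zero_iff) (use pos xE in \<open>auto simp: restrict_seminorms_def\<close>)
  qed
  ultimately show ?thesis
    unfolding rlc_def rlc_module_def using prob_space_N module_F by (auto simp: restrict_seminorms_def)
qed

sublocale R: rlc N F P'
  by (rule rlc_N)

sublocale S: rlc N "L0 N" "{L0_abs N}"
  by (rule rlc_L0) (rule prob_space_N)

lemma FE: "x \<in> carrier F \<Longrightarrow> x \<in> carrier E"
  by (simp add: carrier_F)

lemma measure_N_less:
  assumes "v \<in> borel_measurable N" and [measurable]: "u \<in> borel_measurable M"
    and eq: "AE w in M. w \<in> D \<longrightarrow> v w = u w"
  shows "measure N {w \<in> space N. v w < (c::real)} = prob {w \<in> D. u w < c} / prob D"
proof -
  have 1: "{w \<in> D. u w < c} \<in> events"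
  proof -
    have "{w \<in> D. u w < c} = D \<inter> {w \<in> space M. u w < c}" using sets.sets_into_space[OF D] by auto
    then show ?thesis by simp
  qed
  have 2: "{w \<in> D. u w < c} = {w \<in> space N. u w < c}" by simp
  have "measure N {w \<in> space N. v w < c} = measure N {w \<in> space N. u w < c}"
  proof (rule N.finite_measure_eq_AE)
    show "AE w in N. (w \<in> {w \<in> space N. v w < c}) = (w \<in> {w \<in> space N. u w < c})"
      using eq by (auto simp: AE_N_iff elim: eventually_mono)
    have m: "v \<in> borel_measurable N" "u \<in> borel_measurable N" using assms by (auto intro: measurable_N)
    show "{w \<in> space N. v w < c} \<in> sets N" using m(1) by (rule borel_measurable_less) simp
    show "{w \<in> space N. u w < c} \<in> sets N" using m(2) by (rule borel_measurable_less) simp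
  qed
  also have "\<dots> = measure N {w \<in> D. u w < c}" by simp
  also have "\<dots> = prob {w \<in> D. u w < c} / prob D" using 1 by (rule measure_N) auto
  finally show ?thesis .
qed

definition restr :: "('e \<Rightarrow> ('a \<Rightarrow> real) set) set \<Rightarrow> ('e \<Rightarrow> ('a \<Rightarrow> real) set) set" where
  "restr Q = (\<lambda>n x. L0_restrict M D (n x)) ` Q"

lemma fin_restr: "fin Q \<Longrightarrow> R.fin (restr Q)"
  unfolding fin_def R.fin_def restr_def unfolding restrict_seminorms_def by auto

lemma R_fin_cases:
  assumes "R.fin Q'"
  obtains Q where "fin Q" "Q' = restr Q"
proof -
  have "finite Q'" "Q' \<subseteq> (\<lambda>n x. L0_restrict M D (n x)) ` P" "Q' \<noteq> {}"
    using assms unfolding R.fin_def unfolding restrict_seminorms_def by auto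
  from finite_subset_image[OF this(1,2)] this(3) show ?thesis
    by (auto simp: fin_def restr_def intro: that)
qed

lemma nrm_restr:
  assumes Q: "fin Q" and x: "x \<in> carrier E"
  shows "AE w in M. w \<in> D \<longrightarrow> R.nrm (restr Q) x w = nrm Q x w"
proof -
  have "AE w in M. \<forall>n\<in>Q. w \<in> D \<longrightarrow> rep (L0_restrict M D (n x)) w = rep (n x) w"
    using Q by (rule AE_fin) (intro rep_L0_restrict seminorm_closed x)
  then show ?thesis
  proof eventually_elim
    case (elim w)
    then show ?case
      by (auto simp: R.nrm_def nrm_def restr_def image_image intro!: arg_cong[where f = Max] image_cong)
  qed
qed

lemma measure_N_nrm:
  assumes Q: "fin Q" and x: "x \<in> carrier F" and y: "y \<in> carrier E" "x = scal (indicator D) y"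
  shows "measure N {w \<in> space N. R.nrm (restr Q) x w < e} = prob {w \<in> D. nrm Q y w < e} / prob D"
proof (rule measure_N_less)
  show "R.nrm (restr Q) x \<in> borel_measurable N" using fin_restr[OF Q] x by (rule R.nrm_measurable)
  show "nrm Q y \<in> borel_measurable M" using Q y(1) by (rule nrm_measurable)
  show "AE w in M. w \<in> D \<longrightarrow> R.nrm (restr Q) x w = nrm Q y w"
    using nrm_restr[OF Q FE[OF x]] nrm_scal[OF Q y(1) borel_measurable_indicator[OF D]]
    unfolding y(2) by eventually_elim simp
qed

lemma measure_N_abs:
  assumes [measurable]: "u \<in> borel_measurable M"
  shows "measure N {w \<in> space N. S.nrm {L0_abs N} (L0_class N u) w < e} = prob {w \<in> D. \<bar>u w\<bar> < e} / prob D"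
proof (rule measure_N_less)
  show "S.nrm {L0_abs N} (L0_class N u) \<in> borel_measurable N"
    using assms by (intro S.nrm_measurable L0_class_in_L0 measurable_N) (auto simp: S.fin_def)
  show "AE w in M. w \<in> D \<longrightarrow> S.nrm {L0_abs N} (L0_class N u) w = \<bar>u w\<bar>"
    using N.nrm_L0_class[OF measurable_N[of u]] by (simp add: AE_N_iff)
qed measurable

end

section \<open>Local functions, convexity and epigraphs under restriction\<close>

context L0_module
begin

lemma scal_indicator: "scal (indicator A) x = L0_ind M A \<odot> x"
  by (simp add: scal_def L0_ind_def)

lemma local_fun_iff:
  assumes k: "k \<in> carrier E \<rightarrow> carrier (L0bar M)"
  shows "local_fun M E k \<longleftrightarrow> (\<forall>x\<in>carrier E. \<forall>A\<in>events.
    AE w in M. w \<in> A \<longrightarrow> rep (k x) w = rep (k (scal (indicator A) x)) w)"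
  unfolding local_fun_def scal_indicator[symmetric] using k
  by (intro ball_cong refl L0bar_scale_ind_eq_iff) auto

lemma local_fun_cong:
  assumes k: "k \<in> carrier E \<rightarrow> carrier (L0bar M)" "local_fun M E k"
    and "x \<in> carrier E" "y \<in> carrier E" "A \<in> events" "scal (indicator A) x = scal (indicator A) y"
  shows "AE w in M. w \<in> A \<longrightarrow> rep (k x) w = rep (k y) w"
proof -
  have "AE w in M. w \<in> A \<longrightarrow> rep (k x) w = rep (k (scal (indicator A) x)) w"
    "AE w in M. w \<in> A \<longrightarrow> rep (k y) w = rep (k (scal (indicator A) y)) w"
    using k(2) assms(3-5) unfolding local_fun_iff[OF k(1)] by auto
  then show ?thesis unfolding assms(6) by eventually_elim simp
qed

text \<open>\<open>L0_convex\<close> for the restriction, expressed over M; see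
  \<open>convex_restrict_iff\<close>. The weights satisfy their bounds everywhere and not only a.e.,
  which costs no generality because a scalar can be altered on a null set.\<close>

definition convex_on_event :: "'a set \<Rightarrow> ('e \<Rightarrow> 'a \<Rightarrow> ereal) \<Rightarrow> bool" where
  "convex_on_event A K \<longleftrightarrow> (\<forall>x\<in>carrier E. \<forall>y\<in>carrier E. \<forall>u\<in>borel_measurable M. (\<forall>w. 0 \<le> u w \<and> u w \<le> 1) \<longrightarrow>
     (AE w in M. w \<in> A \<longrightarrow> K (scal u x \<oplus> scal (\<lambda>w. 1 - u w) y) w \<le> ereal (u w) * K x w + ereal (1 - u w) * K y w))"

end

context rlc_on
begin

context
  fixes k :: "'e \<Rightarrow> ('a \<Rightarrow> ereal) set"
  assumes k: "k \<in> carrier E \<rightarrow> carrier (L0bar M)" and loc: "local_fun M E k"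
begin

lemma k_closed: "x \<in> carrier E \<Longrightarrow> k x \<in> carrier (L0bar M)"
  using k by auto

lemma rep_restrict_fun:
  assumes "x \<in> carrier E"
  shows "AE w in N. rep (restrict_fun M D k x) w = rep (k x) w"
  using rep_L0_restrict_L0bar[OF k_closed[OF assms]] by (simp add: restrict_fun_def AE_N_iff)

lemma restrict_fun_closed: "x \<in> carrier E \<Longrightarrow> restrict_fun M D k x \<in> carrier (L0bar N)"
  by (simp add: restrict_fun_def k_closed)

lemma local_ind:
  assumes "x \<in> carrier E"
  shows "AE w in N. rep (k (scal (indicator D) x)) w = rep (k x) w"
  using local_fun_cong[OF k loc _ assms D, of "scal (indicator D) x"] assms by (simp add: AE_N_iff)

text \<open>By locality k takes the same values over D at x and at its restriction to D, so
  quantifiers over F become quantifiers over E.\<close>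

lemma proper_restrict_iff:
  "proper_fun N F (restrict_fun M D k) \<longleftrightarrow>
    (\<forall>x\<in>carrier E. AE w in M. w \<in> D \<longrightarrow> rep (k x) w > - \<infinity>) \<and>
    (\<exists>x\<in>carrier E. AE w in M. w \<in> D \<longrightarrow> rep (k x) w < \<infinity>)"
proof -
  have eq: "(AE w in N. R (rep (restrict_fun M D k (scal (indicator D) x)) w)) \<longleftrightarrow>
      (AE w in M. w \<in> D \<longrightarrow> R (rep (k x) w))" if "x \<in> carrier E" for x R
  proof -
    have "AE w in N. rep (restrict_fun M D k (scal (indicator D) x)) w = rep (k x) w"
      using rep_restrict_fun[of "scal (indicator D) x"] local_ind[OF that] that
      by (auto elim: eventually_elim2)
    then have "AE w in N. R (rep (restrict_fun M D k (scal (indicator D) x)) w) = R (rep (k x) w)"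
      by eventually_elim simp
    then have "(AE w in N. R (rep (restrict_fun M D k (scal (indicator D) x)) w)) \<longleftrightarrow> (AE w in N. R (rep (k x) w))"
      by (rule eventually_subst)
    then show ?thesis by (simp add: AE_N_iff)
  qed
  have F: "carrier F = scal (indicator D) ` carrier E" by (auto simp: carrier_F image_iff) metis
  show ?thesis
    unfolding proper_fun_def F using eq[of _ "\<lambda>v. v > - \<infinity>"] eq[of _ "\<lambda>v. v < \<infinity>"] by simp
qed

lemma convex_restrict_iff:
  "L0_convex N F (restrict_fun M D k) \<longleftrightarrow> convex_on_event D (\<lambda>x. rep (k x))"
proof -
  have eq: "L0_le N (restrict_fun M D k (L0_class N u \<odot>\<^bsub>F\<^esub> x \<oplus>\<^bsub>F\<^esub> (\<one>\<^bsub>L0 N\<^esub> \<ominus>\<^bsub>L0 N\<^esub> L0_class N u) \<odot>\<^bsub>F\<^esub> y))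
          (L0bar_add N (L0bar_scale N (L0_class N u) (restrict_fun M D k x))
             (L0bar_scale N (\<one>\<^bsub>L0 N\<^esub> \<ominus>\<^bsub>L0 N\<^esub> L0_class N u) (restrict_fun M D k y))) \<longleftrightarrow>
      (AE w in M. w \<in> D \<longrightarrow> rep (k (scal u x' \<oplus> scal (\<lambda>w. 1 - u w) y')) w
         \<le> ereal (u w) * rep (k x') w + ereal (1 - u w) * rep (k y') w)"
    if x': "x' \<in> carrier E" "x = scal (indicator D) x'" and y': "y' \<in> carrier E" "y = scal (indicator D) y'"
      and u [measurable]: "u \<in> borel_measurable M" for x y x' y' u
  proof -
    have x: "x \<in> carrier F" "x \<in> carrier E" and y: "y \<in> carrier F" "y \<in> carrier E" using x' y' by auto
    have m: "(\<lambda>w. 1 - u w) \<in> borel_measurable M" by simp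
    note mN = measurable_N[OF u] measurable_N[OF m]
    have one: "\<one>\<^bsub>L0 N\<^esub> \<ominus>\<^bsub>L0 N\<^esub> L0_class N u = L0_class N (\<lambda>w. 1 - u w)"
      unfolding L0_one using mN by (intro L0_class_minus) auto
    define z z' where "z = scal u x \<oplus> scal (\<lambda>w. 1 - u w) y"
      and "z' = scal u x' \<oplus> scal (\<lambda>w. 1 - u w) y'"
    have z: "z \<in> carrier E" "z' \<in> carrier E" using x y x' y' m by (auto simp: z_def z'_def)
    have zz: "z = scal (indicator D) z'"
      using x' y' m by (simp add: z_def z'_def scal_add_right scal_scal mult.commute)
    define X where "X = restrict_fun M D k x"
    define Y where "Y = restrict_fun M D k y"
    have [measurable]: "rep X \<in> borel_measurable N" "rep Y \<in> borel_measurable N"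
      using x y by (auto simp: X_def Y_def intro!: rep_measurable_L0bar restrict_fun_closed)
    have [measurable]: "rep (L0_class N u) \<in> borel_measurable N"
      "rep (L0_class N (\<lambda>w. 1 - u w)) \<in> borel_measurable N"
      using mN by (auto intro: rep_L0_class(1))
    have 1: "AE w in N. rep X w = rep (k x') w"
      using rep_restrict_fun[OF x(2)] local_ind[OF x'(1)] unfolding X_def x'(2) by eventually_elim simp
    have 2: "AE w in N. rep Y w = rep (k y') w"
      using rep_restrict_fun[OF y(2)] local_ind[OF y'(1)] unfolding Y_def y'(2) by eventually_elim simp
    have 3: "AE w in N. rep (restrict_fun M D k z) w = rep (k z') w"
      using rep_restrict_fun[OF z(1)] local_ind[OF z(2)] unfolding zz by eventually_elim simp
    have 4: "AE w in N. rep (L0bar_scale N (L0_class N u) X) w = ereal (rep (L0_class N u) w) * rep X w"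
      unfolding L0bar_scale_def by (rule rep_L0_class(2)) measurable
    have 5: "AE w in N. rep (L0bar_scale N (L0_class N (\<lambda>w. 1 - u w)) Y) w
        = ereal (rep (L0_class N (\<lambda>w. 1 - u w)) w) * rep Y w"
      unfolding L0bar_scale_def by (rule rep_L0_class(2)) measurable
    have [measurable]: "rep (L0bar_scale N (L0_class N u) X) \<in> borel_measurable N"
      "rep (L0bar_scale N (L0_class N (\<lambda>w. 1 - u w)) Y) \<in> borel_measurable N"
      unfolding L0bar_scale_def by (rule rep_L0_class(1); measurable)+
    have 6: "AE w in N. rep (L0bar_add N (L0bar_scale N (L0_class N u) X)
        (L0bar_scale N (L0_class N (\<lambda>w. 1 - u w)) Y)) w
      = rep (L0bar_scale N (L0_class N u) X) w + rep (L0bar_scale N (L0_class N (\<lambda>w. 1 - u w)) Y) w"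
      unfolding L0bar_add_def by (rule rep_L0_class(2)) measurable
    have 7: "AE w in N. rep (L0bar_add N (L0bar_scale N (L0_class N u) X)
        (L0bar_scale N (L0_class N (\<lambda>w. 1 - u w)) Y)) w
      = ereal (u w) * rep (k x') w + ereal (1 - u w) * rep (k y') w"
      using 1 2 4 5 6 rep_L0_class(2)[OF mN(1)] rep_L0_class(2)[OF mN(2)] by eventually_elim simp
    have "L0_class N u \<odot>\<^bsub>F\<^esub> x \<oplus>\<^bsub>F\<^esub> (\<one>\<^bsub>L0 N\<^esub> \<ominus>\<^bsub>L0 N\<^esub> L0_class N u) \<odot>\<^bsub>F\<^esub> y = z"
      unfolding one z_def using x y m by (simp add: smult_F)
    then show ?thesis
      unfolding one L0_le_def X_def[symmetric] Y_def[symmetric] z'_def[symmetric]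
      unfolding AE_N_iff[symmetric]
      by (simp only: one) (rule eventually_subst, use 3 7 in eventually_elim, simp)
  qed
  show ?thesis
  proof
    assume conv: "L0_convex N F (restrict_fun M D k)"
    show "convex_on_event D (\<lambda>x. rep (k x))"
      unfolding convex_on_event_def
    proof (intro ballI impI)
      fix x y and u :: "'a \<Rightarrow> real"
      assume x: "x \<in> carrier E" and y: "y \<in> carrier E" and u: "u \<in> borel_measurable M" "\<forall>w. 0 \<le> u w \<and> u w \<le> 1"
      have "L0_class N u \<in> L0_pos N" "L0_le N (L0_class N u) \<one>\<^bsub>L0 N\<^esub>"
        using u measurable_N[OF u(1)] by (auto simp: L0_pos_class_iff L0_one L0_le_class_iff)
      with conv x y show "AE w in M. w \<in> D \<longrightarrow> rep (k (scal u x \<oplus> scal (\<lambda>w. 1 - u w) y)) w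
         \<le> ereal (u w) * rep (k x) w + ereal (1 - u w) * rep (k y) w"
        unfolding eq[OF x refl y refl u(1), symmetric] L0_convex_def by simp
    qed
  next
    assume conv: "convex_on_event D (\<lambda>x. rep (k x))"
    show "L0_convex N F (restrict_fun M D k)"
      unfolding L0_convex_def
    proof (intro ballI impI)
      fix x y \<xi> assume x: "x \<in> carrier F" and y: "y \<in> carrier F" and \<xi>: "\<xi> \<in> L0_pos N" and le: "L0_le N \<xi> \<one>\<^bsub>L0 N\<^esub>"
      have "\<xi> \<in> carrier (L0 N)" using \<xi> by (simp add: L0_pos_def)
      then obtain v where v [measurable]: "v \<in> borel_measurable M" and \<xi>v: "\<xi> = L0_class N v" by (rule L0_N_cases)
      note vN = measurable_N[OF v]
      \<comment> \<open>Clipping changes v only off D and on a null subset of D, so u represents the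
        same scalar over D.\<close>
      define u where "u w = max 0 (min 1 (v w))" for w
      have u: "u \<in> borel_measurable M" "\<forall>w. 0 \<le> u w \<and> u w \<le> 1" by (simp_all add: u_def[abs_def])
      have "AE w in N. 0 \<le> v w" "AE w in N. v w \<le> 1"
        using \<xi> le vN by (auto simp: \<xi>v L0_pos_class_iff L0_one L0_le_class_iff)
      then have "AE w in N. v w = u w" by eventually_elim (simp add: u_def)
      then have \<xi>u: "\<xi> = L0_class N u" unfolding \<xi>v by (rule L0_class_cong)
      have "x = scal (indicator D) x" "y = scal (indicator D) y" using x y by (auto simp: carrier_F)
      from eq[OF FE[OF x] this(1) FE[OF y] this(2) u(1)] conv u FE[OF x] FE[OF y]
      show "L0_le N (restrict_fun M D k (\<xi> \<odot>\<^bsub>F\<^esub> x \<oplus>\<^bsub>F\<^esub> (\<one>\<^bsub>L0 N\<^esub> \<ominus>\<^bsub>L0 N\<^esub> \<xi>) \<odot>\<^bsub>F\<^esub> y))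
          (L0bar_add N (L0bar_scale N \<xi> (restrict_fun M D k x))
             (L0bar_scale N (\<one>\<^bsub>L0 N\<^esub> \<ominus>\<^bsub>L0 N\<^esub> \<xi>) (restrict_fun M D k y)))"
        unfolding \<xi>u convex_on_event_def by blast
    qed
  qed
qed

lemma epi_restrict_iff:
  assumes x: "x \<in> carrier E" and s: "s \<in> borel_measurable M"
  shows "(scal (indicator D) x, L0_class N s) \<in> epi N F (restrict_fun M D k) \<longleftrightarrow>
    (AE w in M. w \<in> D \<longrightarrow> rep (k x) w \<le> ereal (s w))"
proof -
  note sN = measurable_N[OF s]
  have 1: "AE w in N. rep (restrict_fun M D k (scal (indicator D) x)) w = rep (k x) w"
    using rep_restrict_fun[of "scal (indicator D) x"] local_ind[OF x] x
    by (auto elim: eventually_elim2)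
  have 2: "AE w in N. rep (L0_ereal N (L0_class N s)) w = ereal (s w)"
    using rep_L0_ereal[OF L0_class_in_L0[OF sN]] rep_L0_class(2)[OF sN] by eventually_elim simp
  have "L0_le N (restrict_fun M D k (scal (indicator D) x)) (L0_ereal N (L0_class N s)) \<longleftrightarrow>
     (AE w in N. rep (k x) w \<le> ereal (s w))"
    unfolding L0_le_def
    by (rule eventually_subst) (use 1 2 in eventually_elim, simp)
  then show ?thesis using x sN by (simp add: epi_def AE_N_iff)
qed

text \<open>The complement of the closed epigraph contains a product of neighbourhoods of (x, b),
  and one e and one d serve both factors. Probabilities under the conditional measure turn into
  probabilities of subsets of D by the factor \<open>prob D\<close>.\<close>

lemma lsc_separation:
  assumes lsc: "eps_lambda_lsc N F P' (restrict_fun M D k)"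
    and x: "x \<in> carrier E" and b [measurable]: "b \<in> borel_measurable M"
    and nle: "\<not> (AE w in M. w \<in> D \<longrightarrow> rep (k x) w \<le> ereal (b w))"
  obtains Q e d where "fin Q" "0 < e" "0 < d" "d < 1"
    "\<And>y s. y \<in> carrier E \<Longrightarrow> s \<in> borel_measurable M \<Longrightarrow> AE w in M. w \<in> D \<longrightarrow> rep (k y) w \<le> ereal (s w) \<Longrightarrow>
       (1 - d) * prob D < prob {w \<in> D. nrm Q (y \<ominus> x) w < e} \<Longrightarrow>
       prob {w \<in> D. \<bar>s w - b w\<bar> < e} \<le> (1 - d) * prob D"
proof -
  let ?x = "scal (indicator D) x" and ?b = "L0_class N b"
  let ?X = "eps_lambda_topology N F P'" and ?Y = "L0_topology N"
  let ?U = "topspace (prod_topology ?X ?Y) - epi N F (restrict_fun M D k)"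
  have "openin (prod_topology ?X ?Y) ?U"
    using lsc unfolding eps_lambda_lsc_def by (rule openin_diff[OF openin_topspace])
  moreover have "(?x, ?b) \<in> ?U"
    using epi_restrict_iff[OF x b] nle x measurable_N[OF b]
    by (simp add: topspace_prod_topology R.topspace_eq S.topspace_eq)
  ultimately obtain U V where U: "openin ?X U" "?x \<in> U" and V: "openin ?Y V" "?b \<in> V" and UV: "U \<times> V \<subseteq> ?U"
    unfolding openin_prod_topology_alt by blast
  from conjunct2[OF U(1)[unfolded R.openin_iff], THEN bspec, OF U(2)]
  obtain Q' e1 d1 where Q': "R.fin Q'" and ed1: "0 < e1" "0 < d1" "d1 < 1" and
    U': "\<And>z. z \<in> carrier F \<Longrightarrow> 1 - d1 < measure N {w \<in> space N. R.nrm Q' z w < e1} \<Longrightarrow> ?x \<oplus> z \<in> U"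
    unfolding F_simps by blast
  from conjunct2[OF V(1)[unfolded S.openin_iff], THEN bspec, OF V(2)]
  obtain Q2 e2 d2 where Q2: "S.fin Q2" and ed2: "0 < e2" "0 < d2" "d2 < 1" and
    V': "\<And>z. z \<in> carrier (L0 N) \<Longrightarrow> 1 - d2 < measure N {w \<in> space N. S.nrm Q2 z w < e2} \<Longrightarrow> ?b \<oplus>\<^bsub>L0 N\<^esub> z \<in> V"
    by blast
  have Q2_eq: "Q2 = {L0_abs N}" using Q2 by (auto simp: S.fin_def)
  obtain Q where Q: "fin Q" "Q' = restr Q" using Q' by (rule R_fin_cases)
  define e d where "e = min e1 e2" and "d = min d1 d2"
  note [measurable] = nrm_measurable[OF Q(1)]
  have ev: "{w \<in> D. u w < c} \<in> events" if [measurable]: "u \<in> borel_measurable M" for u and c :: real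
  proof -
    have "{w \<in> D. u w < c} = D \<inter> {w \<in> space M. u w < c}" using sets.sets_into_space[OF D] by auto
    then show ?thesis by simp
  qed
  show ?thesis
  proof (rule that[OF Q(1), of e d])
    show "0 < e" "0 < d" "d < 1" using ed1 ed2 by (auto simp: e_def d_def)
    fix y s assume y: "y \<in> carrier E" and s [measurable]: "s \<in> borel_measurable M"
      and le: "AE w in M. w \<in> D \<longrightarrow> rep (k y) w \<le> ereal (s w)"
      and p: "(1 - d) * prob D < prob {w \<in> D. nrm Q (y \<ominus> x) w < e}"
    show "prob {w \<in> D. \<bar>s w - b w\<bar> < e} \<le> (1 - d) * prob D"
    proof (rule ccontr)
      assume "\<not> ?thesis"
      then have q: "(1 - d) * prob D < prob {w \<in> D. \<bar>s w - b w\<bar> < e}" by simp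
      have yx: "y \<ominus> x \<in> carrier E" using x y by simp
      have "(1 - d1) * prob D \<le> (1 - d) * prob D" "(1 - d2) * prob D \<le> (1 - d) * prob D"
        by (intro mult_right_mono; simp add: d_def)+
      moreover have "prob {w \<in> D. nrm Q (y \<ominus> x) w < e} \<le> prob {w \<in> D. nrm Q (y \<ominus> x) w < e1}"
        "prob {w \<in> D. \<bar>s w - b w\<bar> < e} \<le> prob {w \<in> D. \<bar>s w - b w\<bar> < e2}"
        using nrm_measurable[OF Q(1) yx] by (auto intro!: finite_measure_mono ev simp: e_def)
      ultimately have "(1 - d1) * prob D < prob {w \<in> D. nrm Q (y \<ominus> x) w < e1}"
        "(1 - d2) * prob D < prob {w \<in> D. \<bar>s w - b w\<bar> < e2}"
        using p q by linarith+
      then have *: "1 - d1 < measure N {w \<in> space N. R.nrm Q' (scal (indicator D) (y \<ominus> x)) w < e1}"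
        "1 - d2 < measure N {w \<in> space N. S.nrm Q2 (L0_class N (\<lambda>w. s w - b w)) w < e2}"
        using D_pos unfolding Q(2) Q2_eq measure_N_nrm[OF Q(1) ind_F[OF yx] yx refl]
          measure_N_abs[OF borel_measurable_diff[OF s b]]
        by (simp_all only: pos_less_divide_eq)
      have "?x \<oplus> scal (indicator D) (y \<ominus> x) = scal (indicator D) y"
        using x y by (simp add: scal_add_right[symmetric] add_minus_cancel)
      then have "scal (indicator D) y \<in> U" using U'[OF ind_F[OF yx] *(1)] by simp
      moreover have "L0_class N s \<in> V"
        using V'[OF _ *(2)] measurable_N[OF b] measurable_N[OF s] by (simp add: L0_class_add)
      ultimately have "(scal (indicator D) y, L0_class N s) \<notin> epi N F (restrict_fun M D k)" using UV by auto
      then show False using epi_restrict_iff[OF y s] le by simp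
    qed
  qed
qed

end

end


section \<open>Affine minorants of closed functions\<close>

lemma (in prob_space) AE_in_of_null: "A - B \<in> null_sets M \<Longrightarrow> AE w in M. w \<in> A \<longrightarrow> w \<in> B"
  by (drule AE_not_in) (auto elim: eventually_mono)

lemma (in prob_space) prob_pos_of_not_AE:
  assumes "\<not> (AE w in M. w \<in> A \<longrightarrow> R w)" "{w \<in> A. \<not> R w} \<in> events"
  shows "0 < prob {w \<in> A. \<not> R w}"
proof (rule ccontr)
  assume "\<not> ?thesis"
  then have "prob {w \<in> A. \<not> R w} = 0" by (simp add: zero_less_measure_iff)
  then have "{w \<in> A. \<not> R w} \<in> null_sets M" using assms(2) by (simp add: null_sets_def emeasure_eq_measure)
  then have "AE w in M. w \<notin> {w \<in> A. \<not> R w}" by (rule AE_not_in)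
  with assms(1) show False by (auto elim: eventually_mono)
qed

section \<open>Gluing along an event\<close>

context L0_module
begin

text \<open>Gluing along a single event, and by iteration along finitely many, is possible in every
  \<open>L0 M\<close>-module.\<close>

definition glue :: "'a set \<Rightarrow> 'e \<Rightarrow> 'e \<Rightarrow> 'e" where
  "glue A x y = scal (indicator A) x \<oplus> scal (indicator (space M - A)) y"

lemma glue_closed [simp, intro]:
  "A \<in> events \<Longrightarrow> x \<in> carrier E \<Longrightarrow> y \<in> carrier E \<Longrightarrow> glue A x y \<in> carrier E"
  by (simp add: glue_def)

lemma scal_indicator_inter:
  assumes "A \<in> events" "B \<in> events" "x \<in> carrier E"
  shows "scal (indicator A) (scal (indicator B) x) = scal (indicator (A \<inter> B)) x"
  using assms by (subst scal_scal) (simp_all add: indicator_inter_arith[symmetric])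

lemma scal_indicator_empty: "x \<in> carrier E \<Longrightarrow> scal (indicator {}) x = \<zero>"
  using scal_null[of x] by (simp add: indicator_def[abs_def])

lemma glue_in:
  assumes "A \<in> events" "x \<in> carrier E" "y \<in> carrier E"
  shows "scal (indicator A) (glue A x y) = scal (indicator A) x"
  using assms by (simp add: glue_def scal_add_right scal_indicator_inter scal_indicator_empty)

lemma glue_out:
  assumes "A \<in> events" "x \<in> carrier E" "y \<in> carrier E"
  shows "scal (indicator (space M - A)) (glue A x y) = scal (indicator (space M - A)) y"
proof -
  have "(space M - A) \<inter> A = {}" by auto
  with assms show ?thesis by (simp add: glue_def scal_add_right scal_indicator_inter scal_indicator_empty)
qed

lemma linear_fun_cong:
  assumes L: "linear_fun L" and x: "x \<in> carrier E" and y: "y \<in> carrier E" and A: "A \<in> events"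
    and eq: "scal (indicator A) x = scal (indicator A) y"
  shows "AE w in M. w \<in> A \<longrightarrow> L x w = L y w"
  using linear_fun_scal[OF L x borel_measurable_indicator[OF A]]
    linear_fun_scal[OF L y borel_measurable_indicator[OF A]]
  unfolding eq by eventually_elim (simp add: indicator_def split: if_splits)

section \<open>The events \<open>MI\<close>, \<open>PI\<close> and \<open>BP\<close>\<close>

context
  fixes k :: "'e \<Rightarrow> ('a \<Rightarrow> ereal) set"
  assumes k: "k \<in> carrier E \<rightarrow> carrier (L0bar M)"
begin

lemma fun_measurable: "x \<in> carrier E \<Longrightarrow> rep (k x) \<in> borel_measurable M"
  using k by (intro rep_measurable_L0bar) auto

lemma scale_const_iff:
  assumes "A \<in> events" "x \<in> carrier E"
  shows "L0bar_scale M (L0_ind M A) (k x) = L0bar_scale M (L0_ind M A) (L0_class M (\<lambda>_. c)) \<longleftrightarrow>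
    (AE w in M. w \<in> A \<longrightarrow> rep (k x) w = c)"
proof -
  have c: "L0_class M (\<lambda>_. c) \<in> carrier (L0bar M)" by (simp add: carrier_L0bar)
  have r: "AE w in M. rep (L0_class M (\<lambda>_. c)) w = c" by (rule rep_L0_class(2)) simp
  show ?thesis
    using k assms c
    by (subst L0bar_scale_ind_eq_iff) (auto intro!: eventually_subst intro: eventually_mono[OF r])
qed

lemma MI_ess_sup:
  "is_ess_sup_sets M {A \<in> events. \<exists>x\<in>carrier E. AE w in M. w \<in> A \<longrightarrow> rep (k x) w = - \<infinity>} (MI M E k)"
proof -
  have "{A \<in> events. \<exists>x\<in>carrier E. AE w in M. w \<in> A \<longrightarrow> rep (k x) w = - \<infinity>} =
     {A \<in> events. \<exists>x\<in>carrier E.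
        L0bar_scale M (L0_ind M A) (k x) = L0bar_scale M (L0_ind M A) (L0_class M (\<lambda>_. - \<infinity>))}"
    by (intro Collect_cong conj_cong refl bex_cong scale_const_iff[symmetric])
  then show ?thesis unfolding MI_def by (simp only:) (rule is_ess_sup_sets_SOME, auto)
qed

lemma PI_ess_sup:
  "is_ess_sup_sets M {A \<in> events. \<forall>x\<in>carrier E. AE w in M. w \<in> A \<longrightarrow> rep (k x) w = \<infinity>} (PI M E k)"
proof -
  have "{A \<in> events. \<forall>x\<in>carrier E. AE w in M. w \<in> A \<longrightarrow> rep (k x) w = \<infinity>} =
     {A \<in> events. \<forall>x\<in>carrier E.
        L0bar_scale M (L0_ind M A) (k x) = L0bar_scale M (L0_ind M A) (L0_class M (\<lambda>_. \<infinity>))}"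
    by (intro Collect_cong conj_cong refl ball_cong scale_const_iff[symmetric])
  then show ?thesis unfolding PI_def by (simp only:) (rule is_ess_sup_sets_SOME, auto)
qed

lemma MI_events [simp]: "MI M E k \<in> events" and PI_events [simp]: "PI M E k \<in> events"
  using MI_ess_sup PI_ess_sup by (auto simp: is_ess_sup_sets_def)

lemma BP_events [simp]: "BP M E k \<in> events"
  unfolding BP_def by (intro sets.Diff sets.Un MI_events PI_events sets.top)

text \<open>The essential supremum is covered, up to a null set, by countably many members of the
  family, so their common property passes to it.\<close>

lemma AE_PI:
  assumes x: "x \<in> carrier E"
  shows "AE w in M. w \<in> PI M E k \<longrightarrow> rep (k x) w = \<infinity>"
proof -
  obtain \<C> where C: "countable \<C>"
    "\<C> \<subseteq> {A \<in> events. \<forall>x\<in>carrier E. AE w in M. w \<in> A \<longrightarrow> rep (k x) w = \<infinity>}" "PI M E k - \<Union>\<C> \<in> null_sets M"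
    using is_ess_sup_sets_countable[OF _ PI_ess_sup] by blast
  have "AE w in M. \<forall>A\<in>\<C>. w \<in> A \<longrightarrow> rep (k x) w = \<infinity>"
    using C(1,2) x by (intro AE_ball_countable') auto
  with AE_in_of_null[OF C(3)] show ?thesis by eventually_elim auto
qed

text \<open>Without countable gluing no single point need have the value -\<infinity> on all of
  \<open>MI M E k\<close>; hence a countable set of points.\<close>

lemma AE_MI_countable:
  obtains X where "countable X" "X \<subseteq> carrier E" "AE w in M. w \<in> MI M E k \<longrightarrow> (\<exists>x\<in>X. rep (k x) w = - \<infinity>)"
proof -
  obtain \<C> where C: "countable \<C>"
    "\<C> \<subseteq> {A \<in> events. \<exists>x\<in>carrier E. AE w in M. w \<in> A \<longrightarrow> rep (k x) w = - \<infinity>}" "MI M E k - \<Union>\<C> \<in> null_sets M"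
    using is_ess_sup_sets_countable[OF _ MI_ess_sup] by blast
  then have "\<forall>A\<in>\<C>. \<exists>x. x \<in> carrier E \<and> (AE w in M. w \<in> A \<longrightarrow> rep (k x) w = - \<infinity>)" by blast
  then obtain x where x: "\<forall>A\<in>\<C>. x A \<in> carrier E \<and> (AE w in M. w \<in> A \<longrightarrow> rep (k (x A)) w = - \<infinity>)"
    by (rule bchoice[THEN exE])
  have "AE w in M. \<forall>A\<in>\<C>. w \<in> A \<longrightarrow> rep (k (x A)) w = - \<infinity>"
    using C(1) x by (intro AE_ball_countable') auto
  with AE_in_of_null[OF C(3)] have "AE w in M. w \<in> MI M E k \<longrightarrow> (\<exists>y\<in>x ` \<C>. rep (k y) w = - \<infinity>)"
    by eventually_elim auto
  then show ?thesis using that[of "x ` \<C>"] C(1) x by auto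
qed

text \<open>The event where k x = -\<infinity> belongs to the family that defines \<open>MI\<close>,
  so it is disjoint from \<open>BP M E k\<close> up to a null set.\<close>

lemma AE_BP_gt:
  assumes x: "x \<in> carrier E"
  shows "AE w in M. w \<in> BP M E k \<longrightarrow> rep (k x) w > - \<infinity>"
proof -
  note [measurable] = fun_measurable[OF x]
  have "{w \<in> space M. rep (k x) w = - \<infinity>} - MI M E k \<in> null_sets M"
  proof -
    have "{w \<in> space M. rep (k x) w = - \<infinity>} \<in> events" by measurable
    moreover have "AE w in M. w \<in> {w \<in> space M. rep (k x) w = - \<infinity>} \<longrightarrow> rep (k x) w = - \<infinity>" by simp
    ultimately show ?thesis using MI_ess_sup x unfolding is_ess_sup_sets_def by blast
  qed
  from AE_in_of_null[OF this] AE_space show ?thesis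
    by eventually_elim (auto simp: BP_def)
qed

text \<open>If k were \<infinity> a.e. on A at every point, A would belong to the family that
  defines \<open>PI\<close>. The event has to shrink because one point is finite only on a part of
  A.\<close>

lemma BP_finite_somewhere:
  assumes A: "A \<in> events" "A \<subseteq> BP M E k" "0 < prob A"
  obtains B x where "B \<in> events" "B \<subseteq> A" "0 < prob B" "x \<in> carrier E"
    "AE w in M. w \<in> B \<longrightarrow> rep (k x) w < \<infinity>"
proof -
  have "\<exists>x\<in>carrier E. \<not> (AE w in M. w \<in> A \<longrightarrow> rep (k x) w = \<infinity>)"
  proof (rule ccontr)
    assume "\<not> ?thesis"
    then have "A - PI M E k \<in> null_sets M" using PI_ess_sup A(1) unfolding is_ess_sup_sets_def by blast
    moreover have "A - PI M E k = A" using A(2) by (auto simp: BP_def)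
    ultimately show False using A(3) by (auto simp: null_sets_def measure_def)
  qed
  then obtain x where x: "x \<in> carrier E" "\<not> (AE w in M. w \<in> A \<longrightarrow> rep (k x) w = \<infinity>)" by blast
  note [measurable] = fun_measurable[OF x(1)]
  have "{w \<in> A. \<not> rep (k x) w = \<infinity>} = A \<inter> {w \<in> space M. rep (k x) w \<noteq> \<infinity>}"
    using sets.sets_into_space[OF A(1)] by auto
  then have ev: "{w \<in> A. \<not> rep (k x) w = \<infinity>} \<in> events" using A(1) by simp
  show ?thesis
    by (rule that[of "{w \<in> A. \<not> rep (k x) w = \<infinity>}" x]) (use ev prob_pos_of_not_AE[OF x(2) ev] x in auto)
qed

end

end

context rlc
begin

lemma nrm_cong:
  assumes Q: "fin Q" and x: "x \<in> carrier E" and y: "y \<in> carrier E" and A: "A \<in> events"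
    and eq: "scal (indicator A) x = scal (indicator A) y"
  shows "AE w in M. w \<in> A \<longrightarrow> nrm Q x w = nrm Q y w"
  using nrm_scal[OF Q x borel_measurable_indicator[OF A]] nrm_scal[OF Q y borel_measurable_indicator[OF A]]
  unfolding eq by eventually_elim (simp add: indicator_def split: if_splits)

end

section \<open>From lower semicontinuity to an a.e. gap\<close>

context rlc_on
begin

text \<open>The events \<open>B y\<close> on which \<open>y\<close> comes close to the point \<open>(x, b)\<close> below the graph are directed
  upwards, since \<open>k\<close> is local; if they covered \<open>D\<close>, some \<open>y\<close> would enter the neighbourhood of
  \<open>(x, b)\<close> that misses the epigraph.\<close>

lemma gap:
  assumes k: "k \<in> carrier E \<rightarrow> carrier (L0bar M)" and loc: "local_fun M E k"
    and lsc: "eps_lambda_lsc N F P' (restrict_fun M D k)"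
    and gt: "\<And>y. y \<in> carrier E \<Longrightarrow> AE w in M. w \<in> D \<longrightarrow> rep (k y) w > - \<infinity>"
    and y0: "y0 \<in> carrier E" "AE w in M. w \<in> D \<longrightarrow> rep (k y0) w < \<infinity>"
    and x: "x \<in> carrier E" and b [measurable]: "b \<in> borel_measurable M"
    and less: "AE w in M. w \<in> D \<longrightarrow> ereal (b w) < rep (k x) w"
  obtains D' Q e where "D' \<in> events" "D' \<subseteq> D" "0 < prob D'" "fin Q" "0 < e"
    "\<And>y. y \<in> carrier E \<Longrightarrow>
       AE w in M. w \<in> D' \<longrightarrow> nrm Q (y \<ominus> x) w < e \<longrightarrow> ereal (b w + e) \<le> rep (k y) w"
proof -
  have nle: "\<not> (AE w in M. w \<in> D \<longrightarrow> rep (k x) w \<le> ereal (b w))"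
  proof
    assume "AE w in M. w \<in> D \<longrightarrow> rep (k x) w \<le> ereal (b w)"
    with less have "AE w in M. w \<notin> D" by eventually_elim auto
    then have "D \<in> null_sets M" using AE_iff_null_sets[OF D] by simp
    then show False using D_pos by (auto simp: null_sets_def measure_def)
  qed
  obtain Q e d where Q: "fin Q" and ed: "0 < e" "0 < d" "d < 1" and sep:
    "\<And>y s. y \<in> carrier E \<Longrightarrow> s \<in> borel_measurable M \<Longrightarrow> AE w in M. w \<in> D \<longrightarrow> rep (k y) w \<le> ereal (s w) \<Longrightarrow>
       (1 - d) * prob D < prob {w \<in> D. nrm Q (y \<ominus> x) w < e} \<Longrightarrow>
       prob {w \<in> D. \<bar>s w - b w\<bar> < e} \<le> (1 - d) * prob D"
    by (rule lsc_separation[OF k loc lsc x b nle]) blast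
  define B where "B y = {w \<in> D. nrm Q (y \<ominus> x) w < e \<and> rep (k y) w < ereal (b w + e)}" for y
  have DI: "{w \<in> D. R w} = D \<inter> {w \<in> space M. R w}" for R using sets.sets_into_space[OF D] by auto
  have nm: "nrm Q (y \<ominus> x) \<in> borel_measurable M" if "y \<in> carrier E" for y
    using that x Q by (intro nrm_measurable) auto
  have Bev: "B y \<in> events" if y: "y \<in> carrier E" for y
  proof -
    note [measurable] = fun_measurable[OF k y] nm[OF y]
    show ?thesis unfolding B_def DI by measurable
  qed
  have BD: "B y \<subseteq> D" for y by (auto simp: B_def)
  have B_glue: "AE w in M. w \<in> A \<longrightarrow> (w \<in> B (glue A y z) \<longleftrightarrow> w \<in> B y)"
    "AE w in M. w \<in> space M - A \<longrightarrow> (w \<in> B (glue A y z) \<longleftrightarrow> w \<in> B z)"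
    if y: "y \<in> carrier E" and z: "z \<in> carrier E" and A: "A \<in> events" for y z A
  proof -
    have A': "space M - A \<in> events" using A by simp
    note g = glue_closed[OF A y z]
    have *: "AE w in M. w \<in> C \<longrightarrow> (w \<in> B (glue A y z) \<longleftrightarrow> w \<in> B v)"
      if "v \<in> carrier E" "C \<in> events" "scal (indicator C) (glue A y z) = scal (indicator C) v" for v C
    proof -
      have "scal (indicator C) (glue A y z \<ominus> x) = scal (indicator C) (v \<ominus> x)"
        using that x g by (simp add: scal_diff_right)
      then have "AE w in M. w \<in> C \<longrightarrow> nrm Q (glue A y z \<ominus> x) w = nrm Q (v \<ominus> x) w"
        using that x g by (intro nrm_cong[OF Q]) auto
      moreover have "AE w in M. w \<in> C \<longrightarrow> rep (k (glue A y z)) w = rep (k v) w"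
        using that g by (intro local_fun_cong[OF k loc]) auto
      ultimately show ?thesis by eventually_elim (auto simp: B_def)
    qed
    show "AE w in M. w \<in> A \<longrightarrow> (w \<in> B (glue A y z) \<longleftrightarrow> w \<in> B y)"
      using y A glue_in[OF A y z] by (rule *)
    show "AE w in M. w \<in> space M - A \<longrightarrow> (w \<in> B (glue A y z) \<longleftrightarrow> w \<in> B z)"
      using z A' glue_out[OF A y z] by (rule *)
  qed
  \<comment> \<open>Finite unions only: each step of the induction glues z on \<open>B z\<close>
    with y elsewhere, whereas a countable union would need countable gluing.\<close>
  have directed: "\<exists>y\<in>carrier E. AE w in M. (\<exists>z\<in>Z. w \<in> B z) \<longrightarrow> w \<in> B y"
    if "finite Z" "Z \<subseteq> carrier E" for Z
    using that
  proof (induction Z rule: finite_induct)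
    case empty
    then show ?case using x by auto
  next
    case (insert z Z)
    then obtain y where y: "y \<in> carrier E" "AE w in M. (\<exists>z\<in>Z. w \<in> B z) \<longrightarrow> w \<in> B y" by auto
    have z: "z \<in> carrier E" using insert by auto
    have "AE w in M. (\<exists>v\<in>insert z Z. w \<in> B v) \<longrightarrow> w \<in> B (glue (B z) z y)"
      using B_glue[OF z y(1) Bev[OF z]] y(2) AE_space
      by eventually_elim blast
    then show ?case using y z Bev by blast
  qed
  have "B ` carrier E \<subseteq> events" using Bev by auto
  then obtain \<C> where C: "countable \<C>" "\<C> \<subseteq> B ` carrier E" "\<And>A. A \<in> B ` carrier E \<Longrightarrow> A - \<Union>\<C> \<in> null_sets M"
    by (rule ess_union_countable) blast
  obtain Y where Y: "countable Y" "Y \<subseteq> carrier E" "\<C> = B ` Y"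
    using C(1,2) by (metis countable_subset_image)
  define U where "U = \<Union>\<C>"
  have Uev: "U \<in> events" unfolding U_def using C Bev by (intro sets.countable_Union) auto
  \<comment> \<open>Otherwise finitely many of the events B have a union of probability above (1 -
    d) \<open>prob D\<close>. By directedness a single \<open>B y\<close> has too, and this
    contradicts \<open>sep\<close> once y has been modified off \<open>B y\<close>.\<close>
  have "prob (D - U) \<noteq> 0"
  proof
    assume 0: "prob (D - U) = 0"
    have UD: "U \<subseteq> D" using BD by (auto simp: U_def Y(3))
    then have pU: "prob U = prob D" using 0 finite_measure_Diff[OF D Uev UD] by simp
    have "Y \<noteq> {}" using pU D_pos by (auto simp: U_def Y(3))
    define V where "V n = (\<Union>i\<le>n. B (from_nat_into Y i))" for n
    have fY: "from_nat_into Y i \<in> carrier E" for i using Y(2) from_nat_into[OF \<open>Y \<noteq> {}\<close>] by auto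
    have "(\<lambda>n. prob (V n)) \<longlonglongrightarrow> prob (\<Union>n. V n)"
    proof (rule finite_Lim_measure_incseq)
      show "incseq V" unfolding incseq_def V_def by (auto intro: order_trans)
      show "range V \<subseteq> events" using fY Bev by (auto simp: V_def)
    qed
    moreover have "(\<Union>n. V n) = U"
    proof -
      have "U = (\<Union>i. B (from_nat_into Y i))"
        unfolding U_def Y(3) using range_from_nat_into[OF \<open>Y \<noteq> {}\<close> Y(1)] by (metis image_image)
      then show ?thesis by (auto simp: V_def)
    qed
    ultimately have lim: "(\<lambda>n. prob (V n)) \<longlonglongrightarrow> prob D" by (simp add: pU)
    have "(1 - d) * prob D < prob D" using ed D_pos by (simp add: algebra_simps)
    from order_tendstoD(1)[OF lim this] obtain n where n: "(1 - d) * prob D < prob (V n)"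
      by (auto simp: eventually_sequentially)
    obtain y where y: "y \<in> carrier E" "AE w in M. (\<exists>z\<in>from_nat_into Y ` {..n}. w \<in> B z) \<longrightarrow> w \<in> B y"
      using directed[of "from_nat_into Y ` {..n}"] fY by blast
    have "prob (V n) \<le> prob (B y)"
      using y(2) Bev[OF y(1)] by (intro finite_measure_mono_AE) (auto simp: V_def elim: eventually_mono)
    with n have yp: "(1 - d) * prob D < prob (B y)" by simp
    \<comment> \<open>The epigraph requires a finite value on all of D: on \<open>B y\<close> the
      value is below b + e, and elsewhere y0 provides one.\<close>
    define v where "v = glue (B y) y y0"
    have v: "v \<in> carrier E" unfolding v_def using y y0 Bev by auto
    have vB: "AE w in M. w \<in> B y \<longrightarrow> w \<in> B v"
      using B_glue(1)[OF y(1) y0(1) Bev[OF y(1)]] unfolding v_def by eventually_elim auto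
    have v_out: "AE w in M. w \<in> space M - B y \<longrightarrow> rep (k v) w = rep (k y0) w"
      unfolding v_def using y y0 Bev by (intro local_fun_cong[OF k loc] glue_out) auto
    \<comment> \<open>The maximum with b keeps s within e of b on \<open>B y\<close>, even where k v
      lies far below b.\<close>
    define s where "s w = max (real_of_ereal (rep (k v) w)) (b w)" for w
    have s [measurable]: "s \<in> borel_measurable M"
      unfolding s_def[abs_def] using fun_measurable[OF k v] by measurable
    have fin: "AE w in M. w \<in> D \<longrightarrow> \<bar>rep (k v) w\<bar> \<noteq> \<infinity>"
      using vB v_out y0(2) gt[OF v] AE_space
    proof eventually_elim
      case (elim w)
      show ?case
      proof
        assume "w \<in> D"
        then have "rep (k v) w < \<infinity>" using elim by (cases "w \<in> B y") (auto simp: B_def)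
        then show "\<bar>rep (k v) w\<bar> \<noteq> \<infinity>" using elim \<open>w \<in> D\<close> by auto
      qed
    qed
    have le: "AE w in M. w \<in> D \<longrightarrow> rep (k v) w \<le> ereal (s w)"
      using fin
    proof eventually_elim
      case (elim w)
      show ?case
      proof
        assume "w \<in> D"
        then have "rep (k v) w = ereal (real_of_ereal (rep (k v) w))" using elim by (simp add: ereal_real')
        also have "\<dots> \<le> ereal (s w)" by (simp add: s_def)
        finally show "rep (k v) w \<le> ereal (s w)" .
      qed
    qed
    have sB: "AE w in M. w \<in> B y \<longrightarrow> \<bar>s w - b w\<bar> < e"
      using vB fin
    proof eventually_elim
      case (elim w)
      show ?case
      proof
        assume w: "w \<in> B y"
        then have "rep (k v) w < ereal (b w + e)" "w \<in> D" using elim by (auto simp: B_def)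
        then have "real_of_ereal (rep (k v) w) < b w + e" using elim by (cases "rep (k v) w") auto
        then show "\<bar>s w - b w\<bar> < e" using ed by (auto simp: s_def)
      qed
    qed
    have e1: "{w \<in> D. nrm Q (v \<ominus> x) w < e} \<in> events" "{w \<in> D. \<bar>s w - b w\<bar> < e} \<in> events"
      unfolding DI using nm[OF v] by measurable
    have "prob (B y) \<le> prob {w \<in> D. nrm Q (v \<ominus> x) w < e}"
      using vB e1 by (intro finite_measure_mono_AE) (auto simp: B_def elim: eventually_mono)
    moreover have "prob (B y) \<le> prob {w \<in> D. \<bar>s w - b w\<bar> < e}"
      using sB e1 BD by (intro finite_measure_mono_AE) (auto elim!: eventually_mono)
    ultimately show False using sep[OF v s le] yp by linarith
  qed
  then have pos: "0 < prob (D - U)" by (simp add: zero_less_measure_iff)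
  show ?thesis
  proof (rule that[OF _ _ pos Q ed(1)])
    fix y assume y: "y \<in> carrier E"
    have "B y - U \<in> null_sets M" unfolding U_def using C(3) y by auto
    from AE_in_of_null[OF this]
    show "AE w in M. w \<in> D - U \<longrightarrow> nrm Q (y \<ominus> x) w < e \<longrightarrow> ereal (b w + e) \<le> rep (k y) w"
      by eventually_elim (auto simp: B_def not_less)
  qed (use Uev in auto)
qed

end


section \<open>Supporting functionals and affine minorants\<close>

context rlc
begin

text \<open>The functional is found below \<open>z \<mapsto> N \<parallel>z\<parallel>\<close> and subject to \<open>L (t (y - x)) \<le> t (k y - b)\<close> for
  all \<open>t \<ge> 0\<close> and all \<open>y\<close> with \<open>k y < \<infinity>\<close>; by convexity of \<open>k\<close> these constraints form a
  convex cone.\<close>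

lemma supporting_functional:
  assumes k: "k \<in> carrier E \<rightarrow> carrier (L0bar M)" and loc: "local_fun M E k" and D [measurable]: "D \<in> events"
    and conv: "convex_on_event D (\<lambda>x. rep (k x))"
    and gt: "\<And>y. y \<in> carrier E \<Longrightarrow> AE w in M. w \<in> D \<longrightarrow> rep (k y) w > - \<infinity>"
    and x1: "x1 \<in> carrier E" "AE w in M. w \<in> D \<longrightarrow> rep (k x1) w < \<infinity>"
    and x: "x \<in> carrier E" and b [measurable]: "b \<in> borel_measurable M" and Q: "fin Q"
    and N [measurable]: "N \<in> borel_measurable M" and N_nonneg: "\<And>w. 0 \<le> N w"
    and N_off: "\<And>w. w \<notin> D \<Longrightarrow> N w = 0"
    and lower: "\<And>y. y \<in> carrier E \<Longrightarrow>
      AE w in M. w \<in> D \<longrightarrow> ereal (b w - N w * nrm Q (y \<ominus> x) w) \<le> rep (k y) w"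
  obtains g where "g \<in> random_dual M E P"
    "\<And>y. y \<in> carrier E \<Longrightarrow> AE w in M. w \<in> D \<longrightarrow> ereal (rep (g y) w - rep (g x) w + b w) \<le> rep (k y) w"
proof -
  note [measurable] = fun_measurable[OF k] nrm_measurable[OF Q]
  define p where "p z w = N w * nrm Q z w" for z w
  have p: "sublin p"
  proof (rule sublinI)
    fix y z assume y: "y \<in> carrier E" and z: "z \<in> carrier E"
    show "AE w in M. p (y \<oplus> z) w \<le> p y w + p z w"
      using nrm_add[OF Q y z] by eventually_elim
        (simp add: p_def mult_left_mono N_nonneg flip: distrib_left)
  next
    fix z and u :: "'a \<Rightarrow> real" assume z: "z \<in> carrier E" and u: "u \<in> borel_measurable M" "\<And>w. 0 \<le> u w"
    show "AE w in M. p (scal u z) w \<le> u w * p z w"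
      using nrm_scal[OF Q z u(1)] by eventually_elim (simp add: p_def u(2))
  qed (simp add: p_def[abs_def])
  define dom where "dom = {y \<in> carrier E. AE w in M. w \<in> D \<longrightarrow> rep (k y) w < \<infinity>}"
  have domE: "y \<in> carrier E" if "y \<in> dom" for y using that by (simp add: dom_def)
  \<comment> \<open>The excess of k y over b, cut off outside D. Since N vanishes there too, the
    estimates for the cone are trivial off D.\<close>
  define r where "r y w = indicator D w * (real_of_ereal (rep (k y) w) - b w)" for y w
  have r_meas [measurable]: "y \<in> carrier E \<Longrightarrow> r y \<in> borel_measurable M" for y
    unfolding r_def[abs_def] by measurable
  have k_r: "AE w in M. w \<in> D \<longrightarrow> rep (k y) w = ereal (r y w + b w)" if "y \<in> dom" for y
  proof -
    have "AE w in M. w \<in> D \<longrightarrow> rep (k y) w < \<infinity>" using that by (simp add: dom_def)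
    with gt[OF domE[OF that]] show ?thesis
    proof eventually_elim
      case (elim w)
      then show ?case by (cases "rep (k y) w") (auto simp: r_def)
    qed
  qed
  define C where "C = {(scal t (y \<ominus> x), \<lambda>w. t w * r y w) |t y. t \<in> borel_measurable M \<and> (\<forall>w. 0 \<le> t w) \<and> y \<in> dom}"
  have CI: "(scal t (y \<ominus> x), \<lambda>w. t w * r y w) \<in> C"
    if "t \<in> borel_measurable M" "\<And>w. 0 \<le> t w" "y \<in> dom" for t y
    using that by (auto simp: C_def)
  have CE: "\<exists>t y. z = scal t (y \<ominus> x) \<and> s = (\<lambda>w. t w * r y w) \<and> t \<in> borel_measurable M \<and> (\<forall>w. 0 \<le> t w) \<and> y \<in> dom"
    if "(z, s) \<in> C" for z s using that by (auto simp: C_def)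
  have x1_dom: "x1 \<in> dom" using x1 by (simp add: dom_def)
  have C_sub: "C \<subseteq> carrier E \<times> borel_measurable M" using x domE by (auto simp: C_def)
  have C0: "(\<zero>, \<lambda>_. 0) \<in> C" using CI[of "\<lambda>_. 0" x1] x1 x x1_dom by simp
  have C_add: "\<exists>s''. (z \<oplus> z', s'') \<in> C \<and> (AE w in M. s'' w \<le> s w + s' w)"
    if c: "(z, s) \<in> C" "(z', s') \<in> C" for z s z' s'
  proof -
    obtain t y where t: "z = scal t (y \<ominus> x)" "s = (\<lambda>w. t w * r y w)"
      "t \<in> borel_measurable M" "\<forall>w. 0 \<le> t w" "y \<in> dom"
      using CE[OF c(1)] by blast
    obtain t' y' where t': "z' = scal t' (y' \<ominus> x)" "s' = (\<lambda>w. t' w * r y' w)"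
      "t' \<in> borel_measurable M" "\<forall>w. 0 \<le> t' w" "y' \<in> dom"
      using CE[OF c(2)] by blast
    note [measurable] = t(3) t'(3)
    \<comment> \<open>Constraints with factors t and t' merge into one with factor T = t + t', at
      the convex combination of y and y' with weight u = t/T. Where T = 0 both factors vanish and
      any weight in [0, 1] serves.\<close>
    define T where "T w = t w + t' w" for w
    define u where "u w = (if T w = 0 then 1 else t w / T w)" for w
    have T: "T w = 0 \<Longrightarrow> t w = 0 \<and> t' w = 0" "0 \<le> T w" for w
      using t(4)[rule_format, of w] t'(4)[rule_format, of w] by (auto simp: T_def)
    have [measurable]: "T \<in> borel_measurable M" unfolding T_def[abs_def] by measurable
    have [measurable]: "u \<in> borel_measurable M" unfolding u_def[abs_def] by measurable
    have u: "\<forall>w. 0 \<le> u w \<and> u w \<le> 1"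
    proof
      fix w show "0 \<le> u w \<and> u w \<le> 1"
        using t(4)[rule_format, of w] t'(4)[rule_format, of w]
        by (auto simp: u_def T_def divide_le_eq_1)
    qed
    have Tu: "T w * u w = t w" "T w * (1 - u w) = t' w" for w
    proof -
      show 1: "T w * u w = t w" using T(1)[of w] by (simp add: u_def)
      have "T w * (1 - u w) = T w - T w * u w" by (simp add: right_diff_distrib)
      then show "T w * (1 - u w) = t' w" unfolding 1 by (simp add: T_def)
    qed
    define y2 where "y2 = scal u y \<oplus> scal (\<lambda>w. 1 - u w) y'"
    have y2: "y2 \<in> carrier E" using domE t(5) t'(5) by (simp add: y2_def)
    have "AE w in M. w \<in> D \<longrightarrow> rep (k y2) w \<le> ereal (u w) * rep (k y) w + ereal (1 - u w) * rep (k y') w"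
      unfolding y2_def using conv domE[OF t(5)] domE[OF t'(5)] u \<open>u \<in> borel_measurable M\<close>
      by (auto simp: convex_on_event_def)
    then have le: "AE w in M. w \<in> D \<longrightarrow> rep (k y2) w \<le> ereal (u w * r y w + (1 - u w) * r y' w + b w)"
      using k_r[OF t(5)] k_r[OF t'(5)] by eventually_elim (auto simp: algebra_simps)
    then have y2_dom: "y2 \<in> dom" unfolding dom_def using y2
      by (auto elim!: eventually_mono simp: less_ereal.simps(1) elim: le_less_trans)
    have "scal T (y2 \<ominus> x) = scal T y2 \<ominus> scal T x" using y2 x by (simp add: scal_diff_right)
    also have "scal T y2 = scal t y \<oplus> scal t' y'"
      unfolding y2_def using domE[OF t(5)] domE[OF t'(5)] by (simp add: scal_add_right scal_scal Tu)
    also have "scal T x = scal t x \<oplus> scal t' x"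
      unfolding T_def[abs_def] using x by (simp add: scal_add_left)
    also have "(scal t y \<oplus> scal t' y') \<ominus> (scal t x \<oplus> scal t' x) = z \<oplus> z'"
      unfolding t(1) t'(1) using x domE[OF t(5)] domE[OF t'(5)]
      by (simp add: a_minus_def scal_add_right scal_uminus_right M.minus_add M.a_ac)
    finally have z: "scal T (y2 \<ominus> x) = z \<oplus> z'" .
    have "AE w in M. T w * r y2 w \<le> s w + s' w"
      using le k_r[OF y2_dom]
    proof eventually_elim
      case (elim w)
      have "r y2 w \<le> u w * r y w + (1 - u w) * r y' w"
      proof (cases "w \<in> D")
        case True
        have "ereal (r y2 w + b w) \<le> ereal (u w * r y w + (1 - u w) * r y' w + b w)"
          using mp[OF elim(1) True] unfolding mp[OF elim(2) True] .
        then show ?thesis by simp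
      next
        case False
        then show ?thesis by (simp add: r_def)
      qed
      then have "T w * r y2 w \<le> T w * (u w * r y w + (1 - u w) * r y' w)" using T(2) by (rule mult_left_mono)
      also have "\<dots> = (T w * u w) * r y w + (T w * (1 - u w)) * r y' w" by (simp add: algebra_simps)
      finally show ?case by (simp add: Tu t(2) t'(2))
    qed
    moreover have "(z \<oplus> z', \<lambda>w. T w * r y2 w) \<in> C"
      using CI[of T y2] T(2) y2_dom z by simp
    ultimately show ?thesis by blast
  qed
  have C_scal: "\<exists>s'. (scal u z, s') \<in> C \<and> (AE w in M. s' w \<le> u w * s w)"
    if c: "(z, s) \<in> C" and u: "u \<in> borel_measurable M" "\<And>w. 0 \<le> u w" for z s u
  proof -
    obtain t y where t: "z = scal t (y \<ominus> x)" "s = (\<lambda>w. t w * r y w)"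
      "t \<in> borel_measurable M" "\<forall>w. 0 \<le> t w" "y \<in> dom"
      using CE[OF c] by blast
    have "scal u z = scal (\<lambda>w. u w * t w) (y \<ominus> x)"
      unfolding t(1) using u t x domE by (simp add: scal_scal)
    then have "(scal u z, \<lambda>w. u w * t w * r y w) \<in> C" using CI[of "\<lambda>w. u w * t w" y] t u by simp
    then show ?thesis by (intro exI conjI) (auto simp: t(2))
  qed
  \<comment> \<open>This is \<open>lower\<close> multiplied by t, with \<parallel>-z\<parallel> = t
    \<parallel>y - x\<parallel>.\<close>
  have C_lower: "AE w in M. 0 \<le> p (\<ominus> z) w + s w" if c: "(z, s) \<in> C" for z s
  proof -
    obtain t y where t: "z = scal t (y \<ominus> x)" "s = (\<lambda>w. t w * r y w)"
      "t \<in> borel_measurable M" "\<forall>w. 0 \<le> t w" "y \<in> dom"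
      using CE[OF c] by blast
    have yx: "y \<ominus> x \<in> carrier E" using domE[OF t(5)] x by simp
    show ?thesis
      using nrm_uminus[OF Q scal_closed[OF t(3) yx]] nrm_scal[OF Q yx t(3)] lower[OF domE[OF t(5)]] k_r[OF t(5)]
    proof eventually_elim
      case (elim w)
      have "0 \<le> N w * nrm Q (y \<ominus> x) w + r y w"
      proof (cases "w \<in> D")
        case True
        have "ereal (b w - N w * nrm Q (y \<ominus> x) w) \<le> ereal (r y w + b w)"
          using mp[OF elim(3) True] unfolding mp[OF elim(4) True] .
        then show ?thesis by simp
      next
        case False
        then show ?thesis by (simp add: N_off r_def)
      qed
      then have "0 \<le> t w * (N w * nrm Q (y \<ominus> x) w + r y w)" using t(4) by simp
      with elim(1,2) t(4) show ?case by (simp add: p_def t(1,2) algebra_simps)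
    qed
  qed
  obtain S where S: "sublin S" "\<And>x. x \<in> carrier E \<Longrightarrow> AE w in M. S x w \<le> p x w"
    "\<And>z s. (z, s) \<in> C \<Longrightarrow> AE w in M. S z w \<le> s w"
    by (rule sublin_constraints[OF p C_sub C0 C_add C_scal C_lower]) (assumption+, rule that)
  obtain L where L: "linear_fun L" "\<And>x. x \<in> carrier E \<Longrightarrow> AE w in M. L x w \<le> S x w"
    using Hahn_Banach[OF S(1)] by blast
  have L_p: "AE w in M. L y w \<le> p y w" if "y \<in> carrier E" for y
    using L(2)[OF that] S(2)[OF that] by eventually_elim simp
  have bound: "AE w in M. \<bar>L y w\<bar> \<le> N w * nrm Q y w" if y: "y \<in> carrier E" for y
    using L_p[OF y] L_p[OF M.a_inv_closed[OF y]] linear_fun_uminus[OF L(1) y] nrm_uminus[OF Q y]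
    by eventually_elim (auto simp: p_def)
  define g where "g = (\<lambda>y\<in>carrier E. L0_class M (L y))"
  have g: "g \<in> random_dual M E P" unfolding g_def by (rule random_dualI[OF L(1) Q N bound])
  have rep_g: "AE w in M. rep (g y) w = L y w" if "y \<in> carrier E" for y
    using that rep_L0_class(2)[OF linear_fun_measurable[OF L(1) that]] by (simp add: g_def)
  have "AE w in M. w \<in> D \<longrightarrow> ereal (rep (g y) w - rep (g x) w + b w) \<le> rep (k y) w" if y: "y \<in> carrier E" for y
  proof -
    \<comment> \<open>Where k y = \<infinity> on D the inequality is trivial, but y itself may fail
      to lie in \<open>dom\<close>. Replacing it by x1 off G gives a point of \<open>dom\<close>
      that agrees with y on G.\<close>
    define G where "G = D \<inter> {w \<in> space M. rep (k y) w < \<infinity>}"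
    have G: "G \<in> events" unfolding G_def using y by measurable
    define y' where "y' = glue G y x1"
    have y': "y' \<in> carrier E" unfolding y'_def using G y x1 by simp
    have kG: "AE w in M. w \<in> G \<longrightarrow> rep (k y') w = rep (k y) w"
      unfolding y'_def using G y x1 by (intro local_fun_cong[OF k loc] glue_in) auto
    have kG': "AE w in M. w \<in> space M - G \<longrightarrow> rep (k y') w = rep (k x1) w"
      unfolding y'_def using G y x1 by (intro local_fun_cong[OF k loc] glue_out) auto
    have LG: "AE w in M. w \<in> G \<longrightarrow> L y' w = L y w"
      unfolding y'_def using G y x1 by (intro linear_fun_cong[OF L(1)] glue_in) auto
    have "AE w in M. w \<in> D \<longrightarrow> rep (k y') w < \<infinity>"
      using kG kG' x1(2) AE_space
    proof eventually_elim
      case (elim w)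
      then show ?case by (cases "w \<in> G") (auto simp: G_def)
    qed
    then have y'_dom: "y' \<in> dom" using y' by (simp add: dom_def)
    have "AE w in M. S (scal (\<lambda>_. 1) (y' \<ominus> x)) w \<le> 1 * r y' w"
      using S(3)[OF CI[of "\<lambda>_. 1" y']] y'_dom by simp
    then have "AE w in M. S (y' \<ominus> x) w \<le> r y' w" using x y' by simp
    with L(2)[of "y' \<ominus> x"] linear_fun_diff[OF L(1) y' x] x y'
    have "AE w in M. L (y' \<ominus> x) w \<le> S (y' \<ominus> x) w" "AE w in M. L (y' \<ominus> x) w = L y' w - L x w"
      "AE w in M. S (y' \<ominus> x) w \<le> r y' w" by auto
    with kG LG rep_g[OF x] rep_g[OF y] k_r[OF y'_dom] AE_space show ?thesis
    proof eventually_elim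
      case (elim w)
      show ?case
      proof
        assume w: "w \<in> D"
        show "ereal (rep (g y) w - rep (g x) w + b w) \<le> rep (k y) w"
        proof (cases "w \<in> G")
          case True
          with elim w have "rep (k y) w = ereal (r y' w + b w)" by simp
          then show ?thesis using elim True by simp
        next
          case False
          with w elim show ?thesis by (simp add: G_def)
        qed
      qed
    qed
  qed
  with g show ?thesis by (rule that)
qed

text \<open>A finite value at z makes the restriction to A proper, the case in which closedness says
  something. The lemma is invoked anew each time the event shrinks.\<close>

lemma closedD:
  assumes k: "k \<in> carrier E \<rightarrow> carrier (L0bar M)" and cl: "eps_lambda_closed M E P k"
    and A: "A \<in> events" "A \<subseteq> BP M E k" "0 < prob A"
    and z: "z \<in> carrier E" "AE w in M. w \<in> A \<longrightarrow> rep (k z) w < \<infinity>"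
  shows "convex_on_event A (\<lambda>x. rep (k x))"
    "eps_lambda_lsc (cond_base M A) (restrict_module M A E) (restrict_seminorms M A P) (restrict_fun M A k)"
    "\<And>y. y \<in> carrier E \<Longrightarrow> AE w in M. w \<in> A \<longrightarrow> rep (k y) w > - \<infinity>"
proof -
  interpret rlc_on M E P A using A by unfold_locales auto
  have loc: "local_fun M E k" using cl by (simp add: eps_lambda_closed_def)
  show gt: "AE w in M. w \<in> A \<longrightarrow> rep (k y) w > - \<infinity>" if y: "y \<in> carrier E" for y
    using AE_BP_gt[OF k y] by eventually_elim (use A(2) in auto)
  have "proper_fun N F (restrict_fun M A k)" using gt z by (auto simp: proper_restrict_iff[OF k loc])
  with cl A show "convex_on_event A (\<lambda>x. rep (k x))" "eps_lambda_lsc N F P' (restrict_fun M A k)"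
    by (auto simp: eps_lambda_closed_def convex_restrict_iff[OF k loc, symmetric])
qed

text \<open>The event shrinks three times: to a part where some k x1 is finite, by the gap at x1,
  and by the gap at x. Only positive probability survives, which is enough to contradict a strict
  inequality on A.\<close>

lemma affine_minorant:
  assumes k: "k \<in> carrier E \<rightarrow> carrier (L0bar M)" and cl: "eps_lambda_closed M E P k"
    and A: "A \<in> events" "A \<subseteq> BP M E k" "0 < prob A"
    and x: "x \<in> carrier E" and b [measurable]: "b \<in> borel_measurable M"
    and less: "AE w in M. w \<in> A \<longrightarrow> ereal (b w) < rep (k x) w"
  obtains D g where "D \<in> events" "D \<subseteq> A" "0 < prob D" "g \<in> random_dual M E P"
    "\<And>y. y \<in> carrier E \<Longrightarrow> AE w in M. w \<in> D \<longrightarrow> ereal (rep (g y) w - rep (g x) w + b w) \<le> rep (k y) w"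
proof -
  have loc: "local_fun M E k" using cl by (simp add: eps_lambda_closed_def)
  obtain A1 x1 where A1: "A1 \<in> events" "A1 \<subseteq> A" "0 < prob A1" and x1: "x1 \<in> carrier E"
    "AE w in M. w \<in> A1 \<longrightarrow> rep (k x1) w < \<infinity>"
    by (rule BP_finite_somewhere[OF k A]) blast
  have A1B: "A1 \<subseteq> BP M E k" using A1 A by auto
  note cl1 = closedD[OF k cl A1(1) A1B A1(3) x1]
  define c where "c w = real_of_ereal (rep (k x1) w)" for w
  have c_meas [measurable]: "c \<in> borel_measurable M"
    unfolding c_def[abs_def] using fun_measurable[OF k x1(1)] by measurable
  have c: "AE w in M. w \<in> A1 \<longrightarrow> rep (k x1) w = ereal (c w)"
    using x1(2) cl1(3)[OF x1(1)]
  proof eventually_elim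
    case (elim w)
    then show ?case by (cases "rep (k x1) w") (auto simp: c_def)
  qed
  interpret A1: rlc_on M E P A1 using A1 by unfold_locales auto
  \<comment> \<open>A level strictly below k x1; the distance 1 reappears as the constant in
    \<open>linear_bound\<close>.\<close>
  have m1: "(\<lambda>w. c w - 1) \<in> borel_measurable M" by measurable
  have less1: "AE w in M. w \<in> A1 \<longrightarrow> ereal (c w - 1) < rep (k x1) w" using c by eventually_elim auto
  obtain D1 Q1 e1 where D1: "D1 \<in> events" "D1 \<subseteq> A1" "0 < prob D1" and Q1: "fin Q1" and e1: "0 < e1" and
    gap1: "\<And>y. y \<in> carrier E \<Longrightarrow>
       AE w in M. w \<in> D1 \<longrightarrow> nrm Q1 (y \<ominus> x1) w < e1 \<longrightarrow> ereal (c w - 1 + e1) \<le> rep (k y) w"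
    by (rule A1.gap[OF k loc cl1(2,3) x1 x1(1) m1 less1]) (assumption, rule that)
  have D1B: "D1 \<subseteq> BP M E k" using D1 A1B by auto
  have x1_D1: "AE w in M. w \<in> D1 \<longrightarrow> rep (k x1) w < \<infinity>" using x1(2) D1(2) by (auto elim: eventually_mono)
  note cl2 = closedD[OF k cl D1(1) D1B D1(3) x1(1) x1_D1]
  interpret D1: rlc_on M E P D1 using D1 by unfold_locales auto
  have less2: "AE w in M. w \<in> D1 \<longrightarrow> ereal (b w) < rep (k x) w"
    using less D1(2) A1(2) by (auto elim!: eventually_mono)
  obtain D2 Q2 e2 where D2: "D2 \<in> events" "D2 \<subseteq> D1" "0 < prob D2" and Q2: "fin Q2" and e2: "0 < e2" and
    gap2: "\<And>y. y \<in> carrier E \<Longrightarrow>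
       AE w in M. w \<in> D2 \<longrightarrow> nrm Q2 (y \<ominus> x) w < e2 \<longrightarrow> ereal (b w + e2) \<le> rep (k y) w"
    by (rule D1.gap[OF k loc cl2(2,3) x1(1) x1_D1 x b less2]) (assumption, rule that)
  define Q where "Q = Q1 \<union> Q2"
  have Q: "fin Q" using Q1 Q2 by (simp add: Q_def fin_Un)
  note [measurable] = nrm_measurable[OF Q] and [measurable] = D2(1)
  have linear_bound: "AE w in M. w \<in> D2 \<longrightarrow> ereal (c w - 1 - nrm Q (y \<ominus> x1) w / e1) \<le> rep (k y) w"
    if y: "y \<in> carrier E" for y
  proof -
    \<comment> \<open>The absolute value makes R nonnegative everywhere and not only a.e., because 0
      \<le> u \<le> 1 is required pointwise.\<close>
    define R where "R w = \<bar>nrm Q (y \<ominus> x1) w\<bar>" for w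
    have yx1: "y \<ominus> x1 \<in> carrier E" using y x1 by simp
    have R: "R \<in> borel_measurable M" "0 \<le> R w" for w
      using borel_measurable_abs[OF nrm_measurable[OF Q yx1]] by (simp_all add: R_def[abs_def])
    \<comment> \<open>With this weight the point z between x1 and y satisfies \<parallel>z -
      x1\<parallel> \<le> u R < e1, so the gap at x1 applies to z.\<close>
    define u where "u w = e1 / (e1 + R w)" for w
    have u [measurable]: "u \<in> borel_measurable M" unfolding u_def[abs_def] using R(1) by measurable
    have u01: "\<forall>w. 0 \<le> u w \<and> u w \<le> 1"
    proof
      fix w show "0 \<le> u w \<and> u w \<le> 1" using R(2)[of w] e1 by (simp add: u_def)
    qed
    define z where "z = scal u y \<oplus> scal (\<lambda>w. 1 - u w) x1"
    have z: "z \<in> carrier E" using y x1 by (simp add: z_def)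
    have "scal u x1 \<oplus> scal (\<lambda>w. 1 - u w) x1 = x1"
      using x1(1) by (subst scal_add_left[symmetric]) simp_all
    then have "z \<ominus> x1 = z \<ominus> (scal u x1 \<oplus> scal (\<lambda>w. 1 - u w) x1)" by simp
    also have "\<dots> = scal u (y \<ominus> x1)"
    proof -
      have "scal (\<lambda>w. 1 - u w) x1 \<oplus> \<ominus> scal (\<lambda>w. 1 - u w) x1 = \<zero>"
        using x1(1) by (intro M.r_neg) simp
      then show ?thesis
        using y x1(1) by (simp add: z_def a_minus_def scal_add_right scal_uminus_right M.minus_add M.a_ac M.r_neg2)
    qed
    finally have zx1: "z \<ominus> x1 = scal u (y \<ominus> x1)" .
    have "AE w in M. w \<in> D1 \<longrightarrow> rep (k z) w \<le> ereal (u w) * rep (k y) w + ereal (1 - u w) * rep (k x1) w"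
      unfolding z_def using cl2(1) y x1(1) u u01 by (auto simp: convex_on_event_def)
    then show ?thesis
      using gap1[OF z] nrm_scal[OF Q1 yx1 u] c cl2(3)[OF y] nrm_nonneg[OF Q yx1]
    proof eventually_elim
      case (elim w)
      show ?case
      proof
        assume w: "w \<in> D2"
        then have wD: "w \<in> D1" "w \<in> A1" using D2 D1 by auto
        have Rn: "R w = nrm Q (y \<ominus> x1) w" using elim(6) by (simp add: R_def)
        have pos: "0 < e1 + R w" using e1 R(2)[of w] by simp
        have "nrm Q1 (z \<ominus> x1) w = u w * nrm Q1 (y \<ominus> x1) w"
          unfolding zx1 using elim(3) u01 by simp
        also have "\<dots> \<le> u w * R w"
          unfolding Rn using u01 nrm_mono[OF Q Q1, of "y \<ominus> x1" w] by (intro mult_left_mono) (auto simp: Q_def)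
        also have "\<dots> < e1" using pos e1 by (simp add: u_def field_simps)
        finally have "ereal (c w - 1 + e1) \<le> rep (k z) w" using elim(2) wD by simp
        then have le: "ereal (c w - 1 + e1) \<le> ereal (u w) * rep (k y) w + ereal ((1 - u w) * c w)"
          using elim(1,4) wD by simp
        show "ereal (c w - 1 - nrm Q (y \<ominus> x1) w / e1) \<le> rep (k y) w"
        proof (cases "rep (k y) w")
          case (real t)
          \<comment> \<open>The gain e1 is dropped. What remains is u (c - t) \<le> 1, and 1/u = 1 +
            R/e1.\<close>
          with le have "c w - 1 \<le> u w * t + (1 - u w) * c w" using e1 by simp
          then have "u w * (c w - t) \<le> 1" by (simp add: algebra_simps)
          then have "c w - t \<le> (e1 + R w) / e1" using pos e1 by (simp add: u_def field_simps)
          then show ?thesis using real e1 by (simp add: Rn[symmetric] field_simps)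
        qed (use elim(5) wD in auto)
      qed
    qed
  qed
  \<comment> \<open>The term 1/e1 is the slope of \<open>linear_bound\<close>. The rest is scaled by
    1/e2 so that, at distance at least e2 from x, it outweighs \<bar>b\<bar> + \<bar>c\<bar> + 1 and
    the shift of centre from x1 to x. At smaller distances the gap at x gives the bound. The
    indicator makes N vanish off D2, as \<open>supporting_functional\<close> demands.\<close>
  define N where "N w = indicator D2 w * (1 / e1 + (\<bar>b w\<bar> + \<bar>c w\<bar> + 1 + \<bar>nrm Q (x \<ominus> x1) w\<bar> / e1) / e2)" for w
  have N_meas: "N \<in> borel_measurable M"
    unfolding N_def[abs_def] using nrm_measurable[OF Q M.minus_closed[OF x x1(1)]] by simp
  have N_nonneg: "0 \<le> N w" for w unfolding N_def using e1 e2 by simp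
  have lower: "AE w in M. w \<in> D2 \<longrightarrow> ereal (b w - N w * nrm Q (y \<ominus> x) w) \<le> rep (k y) w" if y: "y \<in> carrier E" for y
  proof -
    have cl: "y \<ominus> x \<in> carrier E" "x \<ominus> x1 \<in> carrier E" using x x1 y by auto
    have "y \<ominus> x1 = (y \<ominus> x) \<oplus> (x \<ominus> x1)"
      using x x1 y by (simp add: a_minus_def M.a_assoc M.r_neg1)
    then have "AE w in M. nrm Q (y \<ominus> x1) w \<le> nrm Q (y \<ominus> x) w + nrm Q (x \<ominus> x1) w"
      using nrm_add[OF Q cl] by simp
    with gap2[OF y] linear_bound[OF y] nrm_nonneg[OF Q cl(1)] show ?thesis
    proof eventually_elim
      case (elim w)
      show ?case
      proof
        assume w: "w \<in> D2"
        let ?n = "nrm Q (y \<ominus> x) w" and ?m = "nrm Q (x \<ominus> x1) w"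
        show "ereal (b w - N w * ?n) \<le> rep (k y) w"
        proof (cases "?n < e2")
          case True
          have "nrm Q2 (y \<ominus> x) w \<le> ?n" by (rule nrm_mono[OF Q Q2]) (simp add: Q_def)
          with True elim(1) w have "ereal (b w + e2) \<le> rep (k y) w" by simp
          moreover have "b w - N w * ?n \<le> b w + e2" using N_nonneg[of w] elim(3) e2
            by (meson add_increasing2 diff_le_eq less_imp_le mult_nonneg_nonneg order_refl order_trans)
          ultimately show ?thesis by (meson ereal_less_eq(3) order_trans)
        next
          case False
          let ?q = "\<bar>b w\<bar> + \<bar>c w\<bar> + 1 + \<bar>?m\<bar> / e1"
          have "?q = ?q / e2 * e2" using e2 by simp
          also have "\<dots> \<le> ?q / e2 * ?n"
            using False e1 e2 by (intro mult_left_mono) auto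
          finally have "?n / e1 + ?q \<le> N w * ?n" using w by (simp add: N_def algebra_simps)
          moreover have "nrm Q (y \<ominus> x1) w / e1 \<le> ?n / e1 + \<bar>?m\<bar> / e1"
            using elim(4) e1 by (simp add: field_simps)
          ultimately have "b w - N w * ?n \<le> c w - 1 - nrm Q (y \<ominus> x1) w / e1" by linarith
          with elim(2) w show ?thesis by (meson ereal_less_eq(3) order_trans)
        qed
      qed
    qed
  qed
  have D2B: "D2 \<subseteq> BP M E k" using D2 D1B by auto
  have x1_D2: "AE w in M. w \<in> D2 \<longrightarrow> rep (k x1) w < \<infinity>" using x1_D1 D2(2) by (auto elim: eventually_mono)
  note cl3 = closedD[OF k cl D2(1) D2B D2(3) x1(1) x1_D2]
  obtain g where g: "g \<in> random_dual M E P"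
    "\<And>y. y \<in> carrier E \<Longrightarrow> AE w in M. w \<in> D2 \<longrightarrow> ereal (rep (g y) w - rep (g x) w + b w) \<le> rep (k y) w"
    by (rule supporting_functional[OF k loc D2(1) cl3(1,3) x1(1) x1_D2 x b Q N_meas N_nonneg _ lower])
      (auto simp: N_def)
  show ?thesis by (rule that[OF D2(1) _ D2(3) g]) (use D2 D1 A1 in auto)
qed

end


section \<open>The biconjugate is closed\<close>

text \<open>Elements of F have seminorm 0 off D, so all of the complement of D counts as small; with
  1 - d \<le> (1 - d) \<open>prob D\<close> + (1 - \<open>prob D\<close>) the same e and d work for
  both measures. Preimages under functionals on E thereby become open sets of F.\<close>

lemma (in rlc_on) openin_restrict:
  assumes U: "openin (eps_lambda_topology M E P) U"
  shows "openin (eps_lambda_topology N F P') (U \<inter> carrier F)"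
  unfolding R.openin_iff
proof (intro conjI ballI)
  fix x assume x: "x \<in> U \<inter> carrier F"
  from conjunct2[OF U[unfolded openin_iff], THEN bspec, of x] x
  obtain Q e d where Q: "fin Q" and ed: "0 < e" "0 < d" "d < 1" and
    U': "\<And>z. z \<in> carrier E \<Longrightarrow> 1 - d < prob {w \<in> space M. nrm Q z w < e} \<Longrightarrow> x \<oplus> z \<in> U"
    by blast
  have "x \<oplus>\<^bsub>F\<^esub> z \<in> U \<inter> carrier F"
    if z: "z \<in> carrier F" and p: "1 - d < measure N {w \<in> space N. R.nrm (restr Q) z w < e}" for z
  proof -
    have zE: "z \<in> carrier E" and zD: "z = scal (indicator D) z" using z by (auto simp: carrier_F)
    note [measurable] = nrm_measurable[OF Q zE]
    have eq: "{w \<in> D. nrm Q z w < e} = D \<inter> {w \<in> space M. nrm Q z w < e}"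
      using sets.sets_into_space[OF D] by auto
    have ev: "{w \<in> D. nrm Q z w < e} \<in> events" unfolding eq by measurable
    have "1 - d \<le> (1 - d) * prob D + (1 - prob D)"
      using ed prob_le_1[of D] mult_left_le[of "prob D" d] by (simp add: algebra_simps)
    also have "\<dots> < prob {w \<in> D. nrm Q z w < e} + (1 - prob D)"
      using p D_pos unfolding measure_N_nrm[OF Q z zE zD] by (simp add: pos_less_divide_eq)
    also have "\<dots> = prob {w \<in> D. nrm Q z w < e} + prob (space M - D)" by (simp add: prob_compl)
    also have "\<dots> = prob ({w \<in> D. nrm Q z w < e} \<union> (space M - D))"
      using ev by (intro finite_measure_Union[symmetric]) auto
    also have "\<dots> \<le> prob {w \<in> space M. nrm Q z w < e}"
    proof (rule finite_measure_mono_AE)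
      have "AE w in M. nrm Q z w = \<bar>indicator D w\<bar> * nrm Q z w"
        using nrm_scal[OF Q zE borel_measurable_indicator[OF D]] zD by simp
      then show "AE w in M. w \<in> {w \<in> D. nrm Q z w < e} \<union> (space M - D) \<longrightarrow> w \<in> {w \<in> space M. nrm Q z w < e}"
        using AE_space
      proof eventually_elim
        case (elim w)
        show ?case using elim ed(1) by (cases "w \<in> D") auto
      qed
    qed measurable
    finally show ?thesis using U'[OF zE] x z by (simp add: add_F)
  qed
  then show "\<exists>Q e d. R.fin Q \<and> 0 < e \<and> 0 < d \<and> d < 1 \<and> (\<forall>z\<in>carrier F.
      1 - d < measure N {w \<in> space N. R.nrm Q z w < e} \<longrightarrow> x \<oplus>\<^bsub>F\<^esub> z \<in> U \<inter> carrier F)"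
    using fin_restr[OF Q] ed by blast
qed auto

lemma ereal_diff_le_swap: "ereal a - y \<le> z \<Longrightarrow> ereal a - z \<le> y"
  by (cases y; cases z) auto

lemma ereal_convex_combination_le:
  assumes u: "0 \<le> u" "u \<le> 1" and x: "ereal (a - s) \<le> x" and y: "ereal (b - s) \<le> y"
  shows "ereal (u * a + (1 - u) * b - s) \<le> ereal u * x + ereal (1 - u) * y"
proof -
  have "ereal (u * a + (1 - u) * b - s) = ereal u * ereal (a - s) + ereal (1 - u) * ereal (b - s)"
    by (simp add: algebra_simps)
  also have "\<dots> \<le> ereal u * x + ereal (1 - u) * y"
    using u x y by (intro add_mono ereal_mult_left_mono) auto
  finally show ?thesis .
qed

section \<open>Elementary properties of the conjugate and the biconjugate\<close>

context rlc
begin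

context
  fixes f :: "'e \<Rightarrow> ('a \<Rightarrow> ereal) set"
  assumes f: "f \<in> carrier E \<rightarrow> carrier (L0bar M)"
begin

lemma rep_L0bar_diff:
  assumes "X \<in> carrier (L0 M)" "Y \<in> carrier (L0bar M)"
  shows "L0bar_diff M (L0_ereal M X) Y \<in> carrier (L0bar M)"
    "AE w in M. rep (L0bar_diff M (L0_ereal M X) Y) w = ereal (rep X w) - rep Y w"
proof -
  have [measurable]: "rep (L0_ereal M X) \<in> borel_measurable M" "rep Y \<in> borel_measurable M"
    using assms by (auto intro: rep_measurable_L0bar)
  show "L0bar_diff M (L0_ereal M X) Y \<in> carrier (L0bar M)"
    by (simp add: L0bar_diff_def carrier_L0bar)
  have "AE w in M. rep (L0bar_diff M (L0_ereal M X) Y) w = rep (L0_ereal M X) w - rep Y w"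
    unfolding L0bar_diff_def by (rule rep_L0_class(2)) measurable
  with rep_L0_ereal[OF assms(1)]
  show "AE w in M. rep (L0bar_diff M (L0_ereal M X) Y) w = ereal (rep X w) - rep Y w"
    by eventually_elim simp
qed

lemma conjugate_family:
  "g \<in> random_dual M E P \<Longrightarrow> {L0bar_diff M (L0_ereal M (g x)) (f x) |x. x \<in> carrier E} \<subseteq> carrier (L0bar M)"
  using f by (auto intro!: rep_L0bar_diff(1) random_dual_closed)

lemma conjugate_closed: "g \<in> random_dual M E P \<Longrightarrow> conjugate M E f g \<in> carrier (L0bar M)"
  unfolding conjugate_def by (rule L0bar_sup(1)[OF conjugate_family])

lemma conjugate_upper:
  assumes g: "g \<in> random_dual M E P" and x: "x \<in> carrier E"
  shows "AE w in M. ereal (rep (g x) w) - rep (f x) w \<le> rep (conjugate M E f g) w"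
proof -
  have fx: "f x \<in> carrier (L0bar M)" using f x by auto
  have "AE w in M. rep (L0bar_diff M (L0_ereal M (g x)) (f x)) w \<le> rep (conjugate M E f g) w"
    unfolding conjugate_def by (rule L0bar_sup(2)[OF conjugate_family[OF g]]) (use x in auto)
  with rep_L0bar_diff(2)[OF random_dual_closed[OF g x] fx] show ?thesis by eventually_elim simp
qed

lemma conjugate_least:
  assumes g: "g \<in> random_dual M E P"
    and le: "\<And>x. x \<in> carrier E \<Longrightarrow> AE w in M. w \<in> B \<longrightarrow> ereal (rep (g x) w) - rep (f x) w \<le> h w"
  shows "AE w in M. w \<in> B \<longrightarrow> rep (conjugate M E f g) w \<le> h w"
  unfolding conjugate_def
proof (rule L0bar_sup_least[OF conjugate_family[OF g]])
  fix X assume "X \<in> {L0bar_diff M (L0_ereal M (g x)) (f x) |x. x \<in> carrier E}"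
  then obtain x where x: "x \<in> carrier E" and X: "X = L0bar_diff M (L0_ereal M (g x)) (f x)" by blast
  have fx: "f x \<in> carrier (L0bar M)" using f x by auto
  show "AE w in M. w \<in> B \<longrightarrow> rep X w \<le> h w"
    using rep_L0bar_diff(2)[OF random_dual_closed[OF g x] fx] le[OF x] unfolding X by eventually_elim simp
qed

abbreviation "fs g \<equiv> rep (conjugate M E f g)"
abbreviation "bic \<equiv> biconjugate M E P f"

lemma fs_measurable: "g \<in> random_dual M E P \<Longrightarrow> fs g \<in> borel_measurable M"
  by (intro rep_measurable_L0bar conjugate_closed)

lemma biconjugate_family:
  "x \<in> carrier E \<Longrightarrow>
    {L0bar_diff M (L0_ereal M (g x)) (conjugate M E f g) |g. g \<in> random_dual M E P} \<subseteq> carrier (L0bar M)"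
  by (auto intro!: rep_L0bar_diff(1) random_dual_closed conjugate_closed)

lemma biconjugate_closed: "bic \<in> carrier E \<rightarrow>\<^sub>E carrier (L0bar M)"
  unfolding biconjugate_def by (auto intro!: L0bar_sup(1)[OF biconjugate_family])

lemma biconjugate_funcset: "bic \<in> carrier E \<rightarrow> carrier (L0bar M)"
  using biconjugate_closed by auto

lemma biconjugate_upper:
  assumes g: "g \<in> random_dual M E P" and x: "x \<in> carrier E"
  shows "AE w in M. ereal (rep (g x) w) - fs g w \<le> rep (bic x) w"
proof -
  have "AE w in M. rep (L0bar_diff M (L0_ereal M (g x)) (conjugate M E f g)) w \<le> rep (bic x) w"
    unfolding biconjugate_def using x
    by simp (rule L0bar_sup(2)[OF biconjugate_family[OF x]], use g in auto)
  with rep_L0bar_diff(2)[OF random_dual_closed[OF g x] conjugate_closed[OF g]]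
  show ?thesis by eventually_elim simp
qed

lemma biconjugate_least:
  assumes x: "x \<in> carrier E"
    and le: "\<And>g. g \<in> random_dual M E P \<Longrightarrow> AE w in M. w \<in> B \<longrightarrow> ereal (rep (g x) w) - fs g w \<le> h w"
  shows "AE w in M. w \<in> B \<longrightarrow> rep (bic x) w \<le> h w"
proof -
  have "AE w in M. w \<in> B \<longrightarrow>
    rep (\<Squnion>\<^bsub>L0bar M\<^esub> {L0bar_diff M (L0_ereal M (g x)) (conjugate M E f g) |g. g \<in> random_dual M E P}) w \<le> h w"
  proof (rule L0bar_sup_least[OF biconjugate_family[OF x]])
    fix X assume "X \<in> {L0bar_diff M (L0_ereal M (g x)) (conjugate M E f g) |g. g \<in> random_dual M E P}"
    then obtain g where g: "g \<in> random_dual M E P" and X: "X = L0bar_diff M (L0_ereal M (g x)) (conjugate M E f g)"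
      by blast
    show "AE w in M. w \<in> B \<longrightarrow> rep X w \<le> h w"
      using rep_L0bar_diff(2)[OF random_dual_closed[OF g x] conjugate_closed[OF g]] le[OF g]
      unfolding X by eventually_elim simp
  qed
  then show ?thesis using x by (simp add: biconjugate_def)
qed

lemma biconjugate_le:
  assumes x: "x \<in> carrier E"
  shows "AE w in M. rep (bic x) w \<le> rep (f x) w"
proof -
  have "AE w in M. w \<in> UNIV \<longrightarrow> rep (bic x) w \<le> rep (f x) w"
  proof (rule biconjugate_least[OF x])
    fix g assume "g \<in> random_dual M E P"
    from conjugate_upper[OF this x]
    show "AE w in M. w \<in> UNIV \<longrightarrow> ereal (rep (g x) w) - fs g w \<le> rep (f x) w"
      by eventually_elim (simp add: ereal_diff_le_swap)
  qed
  then show ?thesis by simp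
qed

text \<open>Each g sees y on A only through the restriction of y to A. This gives one inequality for
  the suprema, and symmetry gives the other.\<close>

lemma biconjugate_local: "local_fun M E bic"
  unfolding local_fun_iff[OF biconjugate_funcset]
proof (intro ballI)
  fix x A assume x: "x \<in> carrier E" and A: "A \<in> events"
  have le: "AE w in M. w \<in> A \<longrightarrow> rep (bic y) w \<le> rep (bic z) w"
    if y: "y \<in> carrier E" and z: "z \<in> carrier E" and eq: "scal (indicator A) y = scal (indicator A) z" for y z
  proof (rule biconjugate_least[OF y])
    fix g assume g: "g \<in> random_dual M E P"
    show "AE w in M. w \<in> A \<longrightarrow> ereal (rep (g y) w) - fs g w \<le> rep (bic z) w"
      using linear_fun_cong[OF linear_fun_random_dual[OF g] y z A eq] biconjugate_upper[OF g z]
      by eventually_elim auto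
  qed
  have "scal (indicator A) (scal (indicator A) x) = scal (indicator A) x"
    using x A by (simp add: scal_indicator_inter)
  then have "AE w in M. w \<in> A \<longrightarrow> rep (bic x) w \<le> rep (bic (scal (indicator A) x)) w"
    "AE w in M. w \<in> A \<longrightarrow> rep (bic (scal (indicator A) x)) w \<le> rep (bic x) w"
    using x A by (auto intro!: le)
  then show "AE w in M. w \<in> A \<longrightarrow> rep (bic x) w = rep (bic (scal (indicator A) x)) w"
    by eventually_elim auto
qed

text \<open>The value -\<infinity> at one point forces \<open>fs g\<close> = \<infinity> for every
  g, and then every other value is -\<infinity> too. This is the condition of closedness on
  \<open>MI\<close>.\<close>

lemma biconjugate_MInfty:
  assumes x: "x \<in> carrier E" and y: "y \<in> carrier E"
  shows "AE w in M. rep (bic x) w = - \<infinity> \<longrightarrow> rep (bic y) w = - \<infinity>"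
proof -
  have "AE w in M. w \<in> {w. rep (bic x) w = - \<infinity>} \<longrightarrow> rep (bic y) w \<le> - \<infinity>"
  proof (rule biconjugate_least[OF y])
    fix g assume g: "g \<in> random_dual M E P"
    show "AE w in M. w \<in> {w. rep (bic x) w = - \<infinity>} \<longrightarrow> ereal (rep (g y) w) - fs g w \<le> - \<infinity>"
      using biconjugate_upper[OF g x]
    proof eventually_elim
      case (elim w)
      then show ?case by (cases "fs g w") auto
    qed
  qed
  then show ?thesis by simp
qed

text \<open>On D some point has a finite value, so \<open>fs g\<close> > -\<infinity> there and each
  affine function in the supremum is real or -\<infinity>. A point outside the epigraph violates the
  bound for a single g, and continuity of this g keeps a whole neighbourhood outside.\<close>

lemma biconjugate_eps_lambda_closed: "eps_lambda_closed M E P bic"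
  unfolding eps_lambda_closed_def
proof (intro conjI ballI impI)
  show "local_fun M E bic" by (rule biconjugate_local)
next
  fix x assume x: "x \<in> carrier E"
  obtain X where X: "countable X" "X \<subseteq> carrier E" "AE w in M. w \<in> MI M E bic \<longrightarrow> (\<exists>y\<in>X. rep (bic y) w = - \<infinity>)"
    by (rule AE_MI_countable[OF biconjugate_funcset]) blast
  have "AE w in M. \<forall>y\<in>X. rep (bic y) w = - \<infinity> \<longrightarrow> rep (bic x) w = - \<infinity>"
    using X(1,2) x by (intro AE_ball_countable' biconjugate_MInfty) auto
  with X(3) have "AE w in M. w \<in> MI M E bic \<longrightarrow> rep (bic x) w = - \<infinity>" by eventually_elim auto
  then show "L0bar_scale M (L0_ind M (MI M E bic)) (bic x) =
      L0bar_scale M (L0_ind M (MI M E bic)) (L0_class M (\<lambda>_. - \<infinity>))"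
    using scale_const_iff[OF biconjugate_funcset MI_events[OF biconjugate_funcset] x] by simp
next
  fix D assume D: "D \<in> events" "D \<subseteq> BP M E bic" "0 < prob D"
    and proper: "proper_fun (cond_base M D) (restrict_module M D E) (restrict_fun M D bic)"
  interpret rlc_on M E P D using D by unfold_locales auto
  note K = biconjugate_funcset biconjugate_local
  have gt: "AE w in M. w \<in> D \<longrightarrow> rep (bic x) w > - \<infinity>" if "x \<in> carrier E" for x
    using proper that by (auto simp: proper_restrict_iff[OF K])
  obtain x1 where x1: "x1 \<in> carrier E" "AE w in M. w \<in> D \<longrightarrow> rep (bic x1) w < \<infinity>"
    using proper by (auto simp: proper_restrict_iff[OF K])
  have fs_gt: "AE w in M. w \<in> D \<longrightarrow> fs g w > - \<infinity>" if g: "g \<in> random_dual M E P" for g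
    using biconjugate_upper[OF g x1(1)] x1(2) by eventually_elim auto
  have "convex_on_event D (\<lambda>x. rep (bic x))"
    unfolding convex_on_event_def
  proof (intro ballI impI)
    fix x y and u :: "'a \<Rightarrow> real"
    assume x: "x \<in> carrier E" and y: "y \<in> carrier E" and u: "u \<in> borel_measurable M" "\<forall>w. 0 \<le> u w \<and> u w \<le> 1"
    have u': "(\<lambda>w. 1 - u w) \<in> borel_measurable M" using u(1) by simp
    show "AE w in M. w \<in> D \<longrightarrow> rep (bic (scal u x \<oplus> scal (\<lambda>w. 1 - u w) y)) w
       \<le> ereal (u w) * rep (bic x) w + ereal (1 - u w) * rep (bic y) w"
    proof (rule biconjugate_least)
      show "scal u x \<oplus> scal (\<lambda>w. 1 - u w) y \<in> carrier E" using x y u u' by simp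
      fix g assume g: "g \<in> random_dual M E P"
      note L = linear_fun_random_dual[OF g]
      show "AE w in M. w \<in> D \<longrightarrow> ereal (rep (g (scal u x \<oplus> scal (\<lambda>w. 1 - u w) y)) w) - fs g w
         \<le> ereal (u w) * rep (bic x) w + ereal (1 - u w) * rep (bic y) w"
        using linear_fun_add[OF L scal_closed[OF u(1) x] scal_closed[OF u' y]] linear_fun_scal[OF L x u(1)]
          linear_fun_scal[OF L y u'] biconjugate_upper[OF g x] biconjugate_upper[OF g y] fs_gt[OF g]
      proof eventually_elim
        case (elim w)
        show ?case
        proof
          assume w: "w \<in> D"
          show "ereal (rep (g (scal u x \<oplus> scal (\<lambda>w. 1 - u w) y)) w) - fs g w
             \<le> ereal (u w) * rep (bic x) w + ereal (1 - u w) * rep (bic y) w"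
          proof (cases "fs g w")
            case (real s)
            have "ereal (u w * rep (g x) w + (1 - u w) * rep (g y) w - s)
                \<le> ereal (u w) * rep (bic x) w + ereal (1 - u w) * rep (bic y) w"
              using elim(4,5) real u(2) by (intro ereal_convex_combination_le) auto
            then show ?thesis using elim(1-3) real by simp
          qed (use elim(6) w in auto)
        qed
      qed
    qed
  qed
  then show "L0_convex N F (restrict_fun M D bic)" by (simp add: convex_restrict_iff[OF K])
  interpret T: rlc M "L0 M" "{L0_abs M}" by (rule rlc_L0) unfold_locales
  let ?T = "prod_topology (eps_lambda_topology N F P') (L0_topology N)"
  have "epi N F (restrict_fun M D bic) \<subseteq> topspace ?T"
    by (auto simp: epi_def R.topspace_eq S.topspace_eq)
  moreover have "\<exists>U V. openin (eps_lambda_topology N F P') U \<and> openin (L0_topology N) V \<and> x \<in> U \<and> r \<in> V \<and>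
      U \<times> V \<subseteq> topspace ?T - epi N F (restrict_fun M D bic)"
    if xr: "(x, r) \<in> topspace ?T - epi N F (restrict_fun M D bic)" for x r
  proof -
    have xF: "x \<in> carrier F" and r: "r \<in> carrier (L0 N)" and not_epi: "(x, r) \<notin> epi N F (restrict_fun M D bic)"
      using xr by (auto simp: R.topspace_eq S.topspace_eq)
    have x: "x \<in> carrier E" and xD: "scal (indicator D) x = x" using xF by (auto simp: carrier_F)
    obtain s where s [measurable]: "s \<in> borel_measurable M" and rs: "r = L0_class N s" using r by (rule L0_N_cases)
    have "\<not> (AE w in M. w \<in> D \<longrightarrow> rep (bic x) w \<le> ereal (s w))"
      using not_epi epi_restrict_iff[OF K x s] by (simp add: xD rs)
    \<comment> \<open>Contraposition of \<open>biconjugate_least\<close>: a bound that fails for the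
      supremum already fails for one g.\<close>
    then obtain g where g: "g \<in> random_dual M E P"
      and nle: "\<not> (AE w in M. w \<in> D \<longrightarrow> ereal (rep (g x) w) - fs g w \<le> ereal (s w))"
      using biconjugate_least[OF x, of D "\<lambda>w. ereal (s w)"] by blast
    note L = linear_fun_random_dual[OF g]
    have gm [measurable]: "y \<in> carrier E \<Longrightarrow> rep (g y) \<in> borel_measurable M" for y
      using linear_fun_measurable[OF L] by simp
    note [measurable] = fs_measurable[OF g]
    define h where "h w = rep (g x) w - real_of_ereal (fs g w) - s w" for w
    have [measurable]: "h \<in> borel_measurable M" unfolding h_def[abs_def] using x by measurable
    \<comment> \<open>The excess h is shown to be uniformly positive on an event of positive
      probability. The factor 2 leaves one half for g y near g x and the other half for t near
      s.\<close>
    have "\<exists>n::nat. \<not> (AE w in M. w \<in> D \<longrightarrow> fs g w = \<infinity> \<or> h w \<le> 2 / (real n + 1))"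
    proof (rule ccontr)
      assume "\<not> ?thesis"
      then have "\<forall>n::nat. AE w in M. w \<in> D \<longrightarrow> fs g w = \<infinity> \<or> h w \<le> 2 / (real n + 1)" by blast
      then have "AE w in M. \<forall>n::nat. w \<in> D \<longrightarrow> fs g w = \<infinity> \<or> h w \<le> 2 / (real n + 1)"
        unfolding AE_all_countable .
      then have "AE w in M. w \<in> D \<longrightarrow> ereal (rep (g x) w) - fs g w \<le> ereal (s w)"
        using fs_gt[OF g]
      proof eventually_elim
        case (elim w)
        show ?case
        proof
          assume w: "w \<in> D"
          show "ereal (rep (g x) w) - fs g w \<le> ereal (s w)"
          proof (cases "fs g w")
            case (real c)
            have "h w \<le> 0"
            proof (rule ccontr)
              assume "\<not> h w \<le> 0"
              then have "0 < h w / 2" by simp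
              from nat_approx_posE[OF this] obtain n where "1 / real (Suc n) < h w / 2" by blast
              moreover have "h w \<le> 2 / (real n + 1)" using elim(1) w real by auto
              ultimately show False by (simp add: field_simps)
            qed
            then show ?thesis using real by (simp add: h_def)
          qed (use elim(2) w in auto)
        qed
      qed
      with nle show False by simp
    qed
    then obtain n :: nat where n: "\<not> (AE w in M. w \<in> D \<longrightarrow> fs g w = \<infinity> \<or> h w \<le> 2 / (real n + 1))" by blast
    define \<eta> where "\<eta> = 1 / (real n + 1)"
    have \<eta>: "0 < \<eta>" by (simp add: \<eta>_def)
    define A where "A = {w \<in> D. \<not> (fs g w = \<infinity> \<or> h w \<le> 2 / (real n + 1))}"
    have A_eq: "A = D \<inter> {w \<in> space M. \<not> (fs g w = \<infinity> \<or> h w \<le> 2 / (real n + 1))}"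
      unfolding A_def using sets.sets_into_space[OF D] by auto
    have A: "A \<in> events" unfolding A_eq by measurable
    have pA: "0 < prob A" unfolding A_def
      by (rule prob_pos_of_not_AE[OF n]) (use A in \<open>simp only: A_def\<close>)
    \<comment> \<open>The thresholds are such that the event where g y is far from g x, and the
      event in D where t is far from s, each have probability below \<open>prob A / 2\<close>;
      together they cannot cover A. In V the extra \<open>prob D\<close> converts the measure of N
      into that of M.\<close>
    define W where "W = {Y \<in> carrier (L0 M). 1 - prob A / 2 <
      prob {w \<in> space M. T.nrm {L0_abs M} (Y \<ominus>\<^bsub>L0 M\<^esub> g x) w < \<eta>}}"
    have "openin (L0_topology M) W"
      unfolding W_def using random_dual_closed[OF g x] by (intro T.openin_ball) (auto simp: T.fin_def)
    moreover have "continuous_map (eps_lambda_topology M E P) (L0_topology M) g"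
      using g by (simp add: random_dual_def)
    ultimately have "openin (eps_lambda_topology M E P) {y \<in> carrier E. g y \<in> W}"
      using openin_continuous_map_preimage topspace_eq by metis
    then have U: "openin (eps_lambda_topology N F P') ({y \<in> carrier E. g y \<in> W} \<inter> carrier F)" (is "openin _ ?U")
      by (rule openin_restrict)
    define V where "V = {Y \<in> carrier (L0 N). 1 - prob A / (2 * prob D) <
      measure N {w \<in> space N. S.nrm {L0_abs N} (Y \<ominus>\<^bsub>L0 N\<^esub> r) w < \<eta>}}"
    have V: "openin (L0_topology N) V"
      unfolding V_def using r by (intro S.openin_ball) (auto simp: S.fin_def)
    have gD: "prob {w \<in> space M. T.nrm {L0_abs M} (g y \<ominus>\<^bsub>L0 M\<^esub> g x) w < \<eta>} =
        prob {w \<in> space M. \<bar>rep (g y) w - rep (g x) w\<bar> < \<eta>}" if y: "y \<in> carrier E" for y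
    proof (rule finite_measure_eq_AE)
      have "g y \<ominus>\<^bsub>L0 M\<^esub> g x = L0_class M (\<lambda>w. rep (g y) w - rep (g x) w)"
        using L0_class_minus[OF gm[OF y] gm[OF x]] random_dual_closed[OF g] x y by simp
      moreover have m: "(\<lambda>w. rep (g y) w - rep (g x) w) \<in> borel_measurable M" using x y by simp
      ultimately have *: "AE w in M. T.nrm {L0_abs M} (g y \<ominus>\<^bsub>L0 M\<^esub> g x) w = \<bar>rep (g y) w - rep (g x) w\<bar>"
        using nrm_L0_class[OF m] by simp
      then show "AE w in M. (w \<in> {w \<in> space M. T.nrm {L0_abs M} (g y \<ominus>\<^bsub>L0 M\<^esub> g x) w < \<eta>}) =
         (w \<in> {w \<in> space M. \<bar>rep (g y) w - rep (g x) w\<bar> < \<eta>})"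
        by eventually_elim simp
      have "T.nrm {L0_abs M} (g y \<ominus>\<^bsub>L0 M\<^esub> g x) \<in> borel_measurable M"
        using random_dual_closed[OF g] x y by (intro T.nrm_measurable) (auto simp: T.fin_def)
      then show "{w \<in> space M. T.nrm {L0_abs M} (g y \<ominus>\<^bsub>L0 M\<^esub> g x) w < \<eta>} \<in> events" by simp
      show "{w \<in> space M. \<bar>rep (g y) w - rep (g x) w\<bar> < \<eta>} \<in> events" using x y by measurable
    qed
    have sD: "measure N {w \<in> space N. S.nrm {L0_abs N} (L0_class N t \<ominus>\<^bsub>L0 N\<^esub> r) w < \<eta>} =
        prob {w \<in> D. \<bar>t w - s w\<bar> < \<eta>} / prob D" if t: "t \<in> borel_measurable M" for t
      unfolding rs using measure_N_abs[OF borel_measurable_diff[OF t s], of \<eta>]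
        L0_class_minus[OF measurable_N[OF t] measurable_N[OF s]] by simp
    have "x \<in> ?U"
    proof -
      have "{w \<in> space M. \<bar>rep (g x) w - rep (g x) w\<bar> < \<eta>} = space M" using \<eta> by auto
      then have "prob {w \<in> space M. T.nrm {L0_abs M} (g x \<ominus>\<^bsub>L0 M\<^esub> g x) w < \<eta>} = 1"
        using gD[OF x] by (simp add: prob_space)
      then show ?thesis using x xF pA random_dual_closed[OF g x] by (simp add: W_def)
    qed
    moreover have "r \<in> V"
    proof -
      have "{w \<in> D. \<bar>s w - s w\<bar> < \<eta>} = D" using \<eta> by auto
      then have "measure N {w \<in> space N. S.nrm {L0_abs N} (r \<ominus>\<^bsub>L0 N\<^esub> r) w < \<eta>} = 1"
        using sD[OF s] D_pos by (simp add: rs)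
      then show ?thesis using r pA D_pos by (simp add: V_def)
    qed
    moreover have "(y, q) \<in> topspace ?T - epi N F (restrict_fun M D bic)" if yq: "y \<in> ?U" "q \<in> V" for y q
    proof -
      have y: "y \<in> carrier E" "y \<in> carrier F" "g y \<in> W" and q: "q \<in> carrier (L0 N)" using yq by (auto simp: V_def)
      have yD: "scal (indicator D) y = y" using y(2) by (simp add: carrier_F)
      obtain t where t [measurable]: "t \<in> borel_measurable M" and qt: "q = L0_class N t"
        using q by (rule L0_N_cases)
      define B1 where "B1 = {w \<in> space M. \<bar>rep (g y) w - rep (g x) w\<bar> < \<eta>}"
      define B2 where "B2 = {w \<in> D. \<bar>t w - s w\<bar> < \<eta>}"
      have B1: "B1 \<in> events" unfolding B1_def using x y by measurable
      have B2_eq: "B2 = D \<inter> {w \<in> space M. \<bar>t w - s w\<bar> < \<eta>}"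
        unfolding B2_def using sets.sets_into_space[OF D] by auto
      have B2: "B2 \<in> events" unfolding B2_eq by measurable
      have p1: "1 - prob A / 2 < prob B1" using y(3) gD[OF y(1)] by (simp add: W_def B1_def)
      have "1 - prob A / (2 * prob D) < prob B2 / prob D"
        using yq(2) sD[OF t] by (simp add: V_def qt B2_def)
      then have "(1 - prob A / (2 * prob D)) * prob D < prob B2" using D_pos by (simp only: pos_less_divide_eq)
      then have p2: "prob D - prob A / 2 < prob B2" using D_pos by (simp add: left_diff_distrib)
      have "\<not> (AE w in M. w \<in> D \<longrightarrow> rep (bic y) w \<le> ereal (t w))"
      proof
        assume "AE w in M. w \<in> D \<longrightarrow> rep (bic y) w \<le> ereal (t w)"
        then have "AE w in M. w \<notin> A \<inter> (B1 \<inter> B2)"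
          using biconjugate_upper[OF g y(1)] fs_gt[OF g]
        proof eventually_elim
          case (elim w)
          show ?case
          proof
            assume w: "w \<in> A \<inter> (B1 \<inter> B2)"
            then have "w \<in> D" and fin: "fs g w \<noteq> \<infinity>" and hw: "2 * \<eta> < h w" by (auto simp: A_def \<eta>_def)
            then obtain c where c: "fs g w = ereal c" using elim(3) by (cases "fs g w") auto
            have "ereal (rep (g y) w - c) \<le> rep (bic y) w" using elim(2) by (simp add: c)
            also have "\<dots> \<le> ereal (t w)" using elim(1) \<open>w \<in> D\<close> by blast
            finally have "ereal (rep (g y) w - c) \<le> ereal (t w)" .
            then have "rep (g y) w - c \<le> t w" by simp
            moreover have "\<bar>rep (g y) w - rep (g x) w\<bar> < \<eta>" "\<bar>t w - s w\<bar> < \<eta>" using w by (auto simp: B1_def B2_def)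
            moreover have "2 * \<eta> < rep (g x) w - c - s w" using hw by (simp add: h_def c)
            ultimately show False by linarith
          qed
        qed
        then have "A \<inter> (B1 \<inter> B2) \<in> null_sets M" using A B1 B2 by (subst AE_iff_null_sets) auto
        then have 0: "prob (A \<inter> (B1 \<inter> B2)) = 0" by (simp add: null_sets_def measure_def)
        have "A \<subseteq> (A \<inter> (B1 \<inter> B2)) \<union> (space M - B1) \<union> (D - B2)"
          using sets.sets_into_space[OF A] by (auto simp: A_def)
        then have "prob A \<le> prob ((A \<inter> (B1 \<inter> B2)) \<union> (space M - B1) \<union> (D - B2))"
          using A B1 B2 D by (intro finite_measure_mono) auto
        also have "\<dots> \<le> prob ((A \<inter> (B1 \<inter> B2)) \<union> (space M - B1)) + prob (D - B2)"
          using A B1 B2 D by (intro measure_Un_le) auto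
        also have "\<dots> \<le> prob (A \<inter> (B1 \<inter> B2)) + prob (space M - B1) + prob (D - B2)"
          using A B1 B2 D by (intro add_right_mono measure_Un_le) auto
        also have "prob (D - B2) = prob D - prob B2"
          using B2 D by (intro finite_measure_Diff) (auto simp: B2_def)
        finally show False using 0 p1 p2 B1 by (simp add: prob_compl)
      qed
      then have "(y, q) \<notin> epi N F (restrict_fun M D bic)"
        using epi_restrict_iff[OF K y(1) t] by (simp add: yD qt)
      then show ?thesis using y q by (simp add: R.topspace_eq S.topspace_eq)
    qed
    ultimately show ?thesis using U V by (intro exI[of _ ?U] exI[of _ V]) auto
  qed
  ultimately show "eps_lambda_lsc N F P' (restrict_fun M D bic)"
    unfolding eps_lambda_lsc_def closedin_def openin_prod_topology_alt by blast
qed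

section \<open>Closed minorants lie below the biconjugate\<close>

text \<open>The zero functional is the one that makes the biconjugate infinite on \<open>PI\<close>
  of a minorant.\<close>

lemma zero_random_dual: "(\<lambda>x\<in>carrier E. L0_class M (\<lambda>_. 0)) \<in> random_dual M E P"
proof -
  obtain n where "n \<in> P" using seminorms_nonempty by blast
  then have "fin {n}" by (simp add: fin_def)
  then show ?thesis
    by (intro random_dualI[where L = "\<lambda>_ _. 0" and Q = "{n}" and N = "\<lambda>_. 0"]) (simp_all add: linear_fun_def)
qed

lemma closed_minorant_le_biconjugate:
  assumes h: "h \<in> carrier E \<rightarrow> carrier (L0bar M)" and cl: "eps_lambda_closed M E P h"
    and le: "\<And>y. y \<in> carrier E \<Longrightarrow> AE w in M. rep (h y) w \<le> rep (f y) w"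
    and x: "x \<in> carrier E"
  shows "AE w in M. rep (h x) w \<le> rep (bic x) w"
proof (rule ccontr)
  assume not_le: "\<not> ?thesis"
  note [measurable] = fun_measurable[OF h x] fun_measurable[OF biconjugate_funcset x]
  have "\<exists>\<beta>\<in>\<rat>. \<not> (AE w in M. \<not> (rep (bic x) w < ereal \<beta> \<and> ereal \<beta> < rep (h x) w))"
  proof (rule ccontr)
    assume "\<not> ?thesis"
    then have "\<And>\<beta>. \<beta> \<in> \<rat> \<Longrightarrow> AE w in M. \<not> (rep (bic x) w < ereal \<beta> \<and> ereal \<beta> < rep (h x) w)" by blast
    from AE_ball_countable'[OF this countable_rat]
    have "AE w in M. \<forall>\<beta>\<in>\<rat>. \<not> (rep (bic x) w < ereal \<beta> \<and> ereal \<beta> < rep (h x) w)" .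
    then have "AE w in M. rep (h x) w \<le> rep (bic x) w"
    proof eventually_elim
      case (elim w)
      show ?case
      proof (rule ccontr)
        assume "\<not> ?thesis"
        then have "rep (bic x) w < rep (h x) w" by simp
        from ereal_dense2[OF this] obtain a where a: "rep (bic x) w < ereal a" "ereal a < rep (h x) w" by blast
        from ereal_dense2[OF a(2)] obtain b where ab:
          "rep (bic x) w < ereal a" "ereal a < ereal b" "ereal b < rep (h x) w"
          using a(1) by blast
        then obtain \<beta> where "\<beta> \<in> \<rat>" "a < \<beta>" "\<beta> < b" using Rats_dense_in_real by auto
        moreover have "rep (bic x) w < ereal \<beta>" using ab(1) by (rule less_trans) (simp add: \<open>a < \<beta>\<close>)
        moreover have "ereal \<beta> < rep (h x) w" using _ ab(3) by (rule less_trans) (simp add: \<open>\<beta> < b\<close>)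
        ultimately show False using elim by blast
      qed
    qed
    with not_le show False by simp
  qed
  then obtain \<beta> :: real where \<beta>: "\<not> (AE w in M. \<not> (rep (bic x) w < ereal \<beta> \<and> ereal \<beta> < rep (h x) w))" by blast
  \<comment> \<open>The double negation matches the form of
    \<open>prob_pos_of_not_AE\<close>.\<close>
  define A where "A = {w \<in> BP M E h. \<not> \<not> (rep (bic x) w < ereal \<beta> \<and> ereal \<beta> < rep (h x) w)}"
  have BPh: "BP M E h \<in> events" by (rule BP_events[OF h])
  have A_eq: "A = BP M E h \<inter> {w \<in> space M. rep (bic x) w < ereal \<beta> \<and> ereal \<beta> < rep (h x) w}"
    unfolding A_def using sets.sets_into_space[OF BPh] by auto
  have A: "A \<in> events" unfolding A_eq using BPh by measurable
  have MI_h: "AE w in M. w \<in> MI M E h \<longrightarrow> rep (h x) w = - \<infinity>"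
    using cl x scale_const_iff[OF h MI_events[OF h] x] by (auto simp: eps_lambda_closed_def)
  \<comment> \<open>On this event h, and hence f, is \<infinity> at every point, so the conjugate is
    -\<infinity> at the zero functional.\<close>
  have PI_h: "AE w in M. w \<in> PI M E h \<longrightarrow> rep (bic x) w = \<infinity>"
  proof -
    let ?g = "\<lambda>x\<in>carrier E. L0_class M (\<lambda>_. 0)"
    have "AE w in M. w \<in> PI M E h \<longrightarrow> fs ?g w \<le> - \<infinity>"
    proof (rule conjugate_least[OF zero_random_dual])
      fix y assume y: "y \<in> carrier E"
      show "AE w in M. w \<in> PI M E h \<longrightarrow> ereal (rep (?g y) w) - rep (f y) w \<le> - \<infinity>"
        using AE_PI[OF h y] le[OF y] by eventually_elim auto
    qed
    with biconjugate_upper[OF zero_random_dual x] show ?thesis by eventually_elim auto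
  qed
  \<comment> \<open>The strict inequalities fail on \<open>MI M E h\<close>, where h x =
    -\<infinity>, and on \<open>PI M E h\<close>, where the biconjugate is \<infinity>. So they must
    hold on a part of \<open>BP M E h\<close>.\<close>
  have "\<not> (AE w in M. w \<in> BP M E h \<longrightarrow> \<not> (rep (bic x) w < ereal \<beta> \<and> ereal \<beta> < rep (h x) w))"
  proof
    assume "AE w in M. w \<in> BP M E h \<longrightarrow> \<not> (rep (bic x) w < ereal \<beta> \<and> ereal \<beta> < rep (h x) w)"
    with MI_h PI_h AE_space have "AE w in M. \<not> (rep (bic x) w < ereal \<beta> \<and> ereal \<beta> < rep (h x) w)"
      by eventually_elim (auto simp: BP_def)
    with \<beta> show False by simp
  qed
  then have pA: "0 < prob A" unfolding A_def by (rule prob_pos_of_not_AE) (use A in \<open>simp only: A_def\<close>)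
  have AB: "A \<subseteq> BP M E h" by (auto simp: A_def)
  have less: "AE w in M. w \<in> A \<longrightarrow> ereal \<beta> < rep (h x) w" by (simp add: A_def)
  obtain D g where D: "D \<in> events" "D \<subseteq> A" "0 < prob D" and g: "g \<in> random_dual M E P" and minorant:
    "\<And>y. y \<in> carrier E \<Longrightarrow> AE w in M. w \<in> D \<longrightarrow> ereal (rep (g y) w - rep (g x) w + \<beta>) \<le> rep (h y) w"
    by (rule affine_minorant[OF h cl A AB pA x borel_measurable_const less]) (rule that)
  \<comment> \<open>The affine minorant of h lies below f as well and so bounds the conjugate at g.
    Inserting this g into the biconjugate at x gives at least \<beta> on D, against the definition
    of A.\<close>
  have "AE w in M. w \<in> D \<longrightarrow> fs g w \<le> ereal (rep (g x) w - \<beta>)"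
  proof (rule conjugate_least[OF g])
    fix y assume y: "y \<in> carrier E"
    show "AE w in M. w \<in> D \<longrightarrow> ereal (rep (g y) w) - rep (f y) w \<le> ereal (rep (g x) w - \<beta>)"
      using minorant[OF y] le[OF y]
    proof eventually_elim
      case (elim w)
      show ?case
      proof
        assume "w \<in> D"
        then have "ereal (rep (g y) w - rep (g x) w + \<beta>) \<le> rep (f y) w" using elim by (blast intro: order_trans)
        then show "ereal (rep (g y) w) - rep (f y) w \<le> ereal (rep (g x) w - \<beta>)"
          by (cases "rep (f y) w") auto
      qed
    qed
  qed
  with biconjugate_upper[OF g x] have "AE w in M. w \<notin> D"
  proof eventually_elim
    case (elim w)
    show ?case
    proof
      assume w: "w \<in> D"
      have "ereal \<beta> \<le> ereal (rep (g x) w) - fs g w" using elim(2) w by (cases "fs g w") auto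
      also have "\<dots> \<le> rep (bic x) w" by (rule elim(1))
      also have "\<dots> < ereal \<beta>" using w D(2) by (auto simp: A_def)
      finally show False by simp
    qed
  qed
  then have "D \<in> null_sets M" using AE_iff_null_sets[OF D(1)] by simp
  then show False using D(3) by (auto simp: null_sets_def measure_def)
qed

lemma biconjugate_greatest:
  "greatest (L0bar_fun M E) bic
     {k \<in> carrier (L0bar_fun M E). eps_lambda_closed M E P k \<and> k \<sqsubseteq>\<^bsub>L0bar_fun M E\<^esub> f}"
  unfolding greatest_def
  using biconjugate_closed biconjugate_eps_lambda_closed biconjugate_le
  by (auto simp: L0bar_fun_def L0_le_def intro!: closed_minorant_le_biconjugate)

end

text \<open>The pointwise order is antisymmetric because classes are determined by their a.e. values
  and the functions are extensional off \<open>carrier E\<close>. This resolves the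
  \<open>THE\<close> in \<open>Cl\<close>.\<close>

lemma greatest_L0bar_fun_unique:
  assumes "greatest (L0bar_fun M E) h S" "greatest (L0bar_fun M E) k S"
  shows "h = k"
proof
  fix x
  have hk: "h \<in> carrier E \<rightarrow>\<^sub>E carrier (L0bar M)" "k \<in> carrier E \<rightarrow>\<^sub>E carrier (L0bar M)"
    and le: "\<forall>x\<in>carrier E. L0_le M (h x) (k x)" "\<forall>x\<in>carrier E. L0_le M (k x) (h x)"
    using assms by (auto simp: greatest_def L0bar_fun_def)
  show "h x = k x"
  proof (cases "x \<in> carrier E")
    case True
    then have "AE w in M. rep (h x) w \<le> rep (k x) w" "AE w in M. rep (k x) w \<le> rep (h x) w"
      using le by (auto simp: L0_le_def)
    then have "AE w in M. rep (h x) w = rep (k x) w" by eventually_elim simp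
    moreover have "h x \<in> carrier (L0bar M)" "k x \<in> carrier (L0bar M)" using hk True by auto
    ultimately show ?thesis by (intro L0bar_eqI)
  qed (use hk in auto)
qed

end

theorem theorem5p14:
  fixes M :: "'a measure"
    and E :: "(('a \<Rightarrow> real) set, 'e) module"
    and P :: "('e \<Rightarrow> ('a \<Rightarrow> real) set) set"
    and f :: "'e \<Rightarrow> ('a \<Rightarrow> ereal) set"
  assumes "rlc_module M E P"
    and "f \<in> carrier E \<rightarrow> carrier (L0bar M)"
    and "local_fun M E f"
  shows "biconjugate M E P f = Cl M E P f"
proof -
  interpret rlc M E P by (rule rlc.intro) fact
  show ?thesis
    unfolding Cl_def
    using biconjugate_greatest[OF assms(2)] greatest_L0bar_fun_unique
    by (intro the_equality[symmetric]) auto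
qed

end
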